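(* Let $\mathcal{C}$ be a non-zero $A$-coring with ${}_A\mathcal{C}$ locally projective and let $M$ be a non-zero right $\mathcal{C}$-comodule that is self-injective and self-cogenerator. Suppose that at least one of the following holds: (1) $M$ has finite length; (2) $A$ is right Artinian and $M_A$ is finitely generated; (3) $M$ is Artinian and self-projective. Then $M$ is fully coprime if and only if $M$ is simple as a $({}^{\ast}\mathcal{C},\mathrm{E}_M^{\mathcal{C}})$-bimodule.
   Context: $R$ is a commutative ring with $1\neq 0$, $A$ is a unital $R$-algebra, $\mathcal{C}$ is an $A$-coring (a coalgebra in the monoidal category of $(A,A)$-bimodules), and comodules are right $\mathcal{C}$-comodules with $\mathcal{C}$-colinear maps. A left $A$-module $W$ is locally projective (in the sense of Zimmermann-Huisgen) if for every finitely generated submodule $F\subseteq W$, every surjective $A$-linear $\pi:L\to N$ and every $A$-linear $g:W\to N$ there is an $A$-linear $g':W\to L$ with $\pi g'|_F=g|_F$. Locally projective modules are flat, so $\mathbb{M}^{\mathcal{C}}$ is a Grothendieck category with kernels formed in right $A$-modules. ${}^{\ast}\mathcal{C}=\mathrm{Hom}_{A-}(\mathcal{C},A)$ (left $A$-linear maps) is a ring with product $(f\ast^l g)(c)=\sum f(c_1g(c_2))$ and unit $\varepsilon$; a right $\mathcal{C}$-comodule $M$ is a left ${}^{\ast}\mathcal{C}$-module via $f\rightharpoonup m=\sum m_{<0>}f(m_{<1>})$. $\mathrm{E}_M^{\mathcal{C}}=\mathrm{End}^{\mathcal{C}}(M)^{op}$ acts on the right of $M$ by $mf:=f(m)$; so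 $M$ is a $({}^{\ast}\mathcal{C},\mathrm{E}_M^{\mathcal{C}})$-bimodule. Finite length and Artinian refer to the lattice of $\mathcal{C}$-subcomodules of $M$. $M$ is self-injective if for every subcomodule $K\subseteq M$ every colinear map $K\to M$ extends to a colinear endomorphism of $M$; self-projective if for every subcomodule $K\subseteq M$ every colinear map $g:M\to M/K$ factors as $g=\pi_K\circ\widetilde g$ with $\widetilde g\in\mathrm{End}^{\mathcal{C}}(M)$, $\pi_K:M\to M/K$ the projection; self-cogenerator if for every subcomodule $K\subseteq M$ the intersection of the kernels of all $h\in\mathrm{Hom}^{\mathcal{C}}(M/K,M)$ is $0$ (i.e. $M$ cogenerates all its factor comodules). A subcomodule $X\subseteq M$ is fully invariant if $f(X)\subseteq X$ for all $f\in\mathrm{End}^{\mathcal{C}}(M)$. For subcomodules $X,Y\subseteq M$ let $(X:_M^{\mathcal{C}}Y):=\bigcap\{f^{-1}(Y): f\in \mathrm{End}^{\mathcal{C}}(M),\ f(X)=0\}$. $M\neq 0$ is fully coprime if for any fully invariant subcomodules $X,Y\subseteq M$ with $M=(X:_M^{\mathcal{C}}Y)$ one has $X=M$ or $Y=M$. *)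

theory Defs
  imports "HOL-Algebra.Module" "HOL-Algebra.AbelCoset" "HOL-Algebra.Free_Abelian_Groups"
begin

section \<open>Modules over noncommutative rings\<close>

text \<open>
  The library's locales \<^locale>\<open>module\<close> and \<^locale>\<open>algebra\<close> assume commutative rings; only the
  record \<^typ>\<open>('a, 'm) module\<close> is reused for left modules over an arbitrary ring.
  A one-sided right module is stored in a \<open>bimodule\<close> record whose field \<^const>\<open>smult\<close> is ignored (just
  as HOL-Algebra stores an abelian group in a ring record and ignores the multiplication), so that
  a single tensor product serves one- and two-sided modules.
\<close>

locale unital_algebra = module + ring M +
  assumes smult_mult_left:
      "\<lbrakk>a \<in> carrier R; x \<in> carrier M; y \<in> carrier M\<rbrakk> \<Longrightarrow>
      (a \<odot>\<^bsub>M\<^esub> x) \<otimes>\<^bsub>M\<^esub> y = a \<odot>\<^bsub>M\<^esub> (x \<otimes>\<^bsub>M\<^esub> y)"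
    and smult_mult_right:
      "\<lbrakk>a \<in> carrier R; x \<in> carrier M; y \<in> carrier M\<rbrakk> \<Longrightarrow>
      x \<otimes>\<^bsub>M\<^esub> (a \<odot>\<^bsub>M\<^esub> y) = a \<odot>\<^bsub>M\<^esub> (x \<otimes>\<^bsub>M\<^esub> y)"

record ('a, 'b, 'm) bimodule = "('a, 'm) module" +
  ract :: "['m, 'b] \<Rightarrow> 'm" (infixl \<open>\<triangleleft>\<index>\<close> 70)

locale left_module = A?: ring A + M?: abelian_group M
  for A :: "('a, 'z) ring_scheme" (structure)
    and M :: "('a, 'm, 'x) module_scheme" (structure) +
  assumes lact_closed:
      "\<lbrakk>a \<in> carrier A; x \<in> carrier M\<rbrakk> \<Longrightarrow> a \<odot>\<^bsub>M\<^esub> x \<in> carrier M"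
    and lact_l_distr:
      "\<lbrakk>a \<in> carrier A; b \<in> carrier A; x \<in> carrier M\<rbrakk> \<Longrightarrow>
      (a \<oplus>\<^bsub>A\<^esub> b) \<odot>\<^bsub>M\<^esub> x = a \<odot>\<^bsub>M\<^esub> x \<oplus>\<^bsub>M\<^esub> b \<odot>\<^bsub>M\<^esub> x"
    and lact_r_distr:
      "\<lbrakk>a \<in> carrier A; x \<in> carrier M; y \<in> carrier M\<rbrakk> \<Longrightarrow>
      a \<odot>\<^bsub>M\<^esub> (x \<oplus>\<^bsub>M\<^esub> y) = a \<odot>\<^bsub>M\<^esub> x \<oplus>\<^bsub>M\<^esub> a \<odot>\<^bsub>M\<^esub> y"
    and lact_assoc:
      "\<lbrakk>a \<in> carrier A; b \<in> carrier A; x \<in> carrier M\<rbrakk> \<Longrightarrow>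
      (a \<otimes>\<^bsub>A\<^esub> b) \<odot>\<^bsub>M\<^esub> x = a \<odot>\<^bsub>M\<^esub> (b \<odot>\<^bsub>M\<^esub> x)"
    and lact_one: "x \<in> carrier M \<Longrightarrow> \<one>\<^bsub>A\<^esub> \<odot>\<^bsub>M\<^esub> x = x"

locale right_module = A?: ring A + M?: abelian_group M
  for A :: "('a, 'z) ring_scheme" (structure)
    and M :: "('l, 'a, 'm, 'x) bimodule_scheme" (structure) +
  assumes ract_closed:
      "\<lbrakk>x \<in> carrier M; a \<in> carrier A\<rbrakk> \<Longrightarrow> x \<triangleleft>\<^bsub>M\<^esub> a \<in> carrier M"
    and ract_r_distr:
      "\<lbrakk>x \<in> carrier M; a \<in> carrier A; b \<in> carrier A\<rbrakk> \<Longrightarrow>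
      x \<triangleleft>\<^bsub>M\<^esub> (a \<oplus>\<^bsub>A\<^esub> b) = x \<triangleleft>\<^bsub>M\<^esub> a \<oplus>\<^bsub>M\<^esub> x \<triangleleft>\<^bsub>M\<^esub> b"
    and ract_l_distr:
      "\<lbrakk>x \<in> carrier M; y \<in> carrier M; a \<in> carrier A\<rbrakk> \<Longrightarrow>
      (x \<oplus>\<^bsub>M\<^esub> y) \<triangleleft>\<^bsub>M\<^esub> a = x \<triangleleft>\<^bsub>M\<^esub> a \<oplus>\<^bsub>M\<^esub> y \<triangleleft>\<^bsub>M\<^esub> a"
    and ract_assoc:
      "\<lbrakk>x \<in> carrier M; a \<in> carrier A; b \<in> carrier A\<rbrakk> \<Longrightarrow>
      x \<triangleleft>\<^bsub>M\<^esub> (a \<otimes>\<^bsub>A\<^esub> b) = (x \<triangleleft>\<^bsub>M\<^esub> a) \<triangleleft>\<^bsub>M\<^esub> b"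
    and ract_one: "x \<in> carrier M \<Longrightarrow> x \<triangleleft>\<^bsub>M\<^esub> \<one>\<^bsub>A\<^esub> = x"

locale bimodule = L?: left_module A M + R: right_module B M
  for A :: "('a, 'z) ring_scheme" (structure) and B :: "('b, 'w) ring_scheme" (structure)
    and M :: "('a, 'b, 'm, 'x) bimodule_scheme" (structure) +
  assumes lact_ract:
      "\<lbrakk>a \<in> carrier A; x \<in> carrier M; b \<in> carrier B\<rbrakk> \<Longrightarrow>
      (a \<odot>\<^bsub>M\<^esub> x) \<triangleleft>\<^bsub>M\<^esub> b = a \<odot>\<^bsub>M\<^esub> (x \<triangleleft>\<^bsub>M\<^esub> b)"

definition regular_bimodule :: "('a, 'z) ring_scheme \<Rightarrow> ('a, 'a, 'a) bimodule" where
  "regular_bimodule A =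
    \<lparr>carrier = carrier A, monoid.mult = monoid.mult A, one = \<one>\<^bsub>A\<^esub>, ring.zero = \<zero>\<^bsub>A\<^esub>, add = add A,
     smult = monoid.mult A, ract = monoid.mult A\<rparr>"

definition left_hom ::
  "('a, 'z) ring_scheme \<Rightarrow> ('a, 'm, 'x) module_scheme \<Rightarrow> ('a, 'n, 'y) module_scheme
    \<Rightarrow> ('m \<Rightarrow> 'n) set" where
  "left_hom A M N = {f \<in> carrier M \<rightarrow> carrier N.
     (\<forall>x\<in>carrier M. \<forall>y\<in>carrier M. f (x \<oplus>\<^bsub>M\<^esub> y) = f x \<oplus>\<^bsub>N\<^esub> f y) \<and>
     (\<forall>a\<in>carrier A. \<forall>x\<in>carrier M. f (a \<odot>\<^bsub>M\<^esub> x) = a \<odot>\<^bsub>N\<^esub> f x)}"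

definition right_hom ::
  "('a, 'z) ring_scheme \<Rightarrow> ('l, 'a, 'm, 'x) bimodule_scheme \<Rightarrow> ('k, 'a, 'n, 'y) bimodule_scheme
    \<Rightarrow> ('m \<Rightarrow> 'n) set" where
  "right_hom A M N = {f \<in> carrier M \<rightarrow> carrier N.
     (\<forall>x\<in>carrier M. \<forall>y\<in>carrier M. f (x \<oplus>\<^bsub>M\<^esub> y) = f x \<oplus>\<^bsub>N\<^esub> f y) \<and>
     (\<forall>x\<in>carrier M. \<forall>a\<in>carrier A. f (x \<triangleleft>\<^bsub>M\<^esub> a) = f x \<triangleleft>\<^bsub>N\<^esub> a)}"

definition left_submodule ::
  "('a, 'z) ring_scheme \<Rightarrow> ('a, 'm, 'x) module_scheme \<Rightarrow> 'm set \<Rightarrow> bool" where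
  "left_submodule A M F \<longleftrightarrow>
     subgroup F (add_monoid M) \<and> (\<forall>a\<in>carrier A. \<forall>x\<in>F. a \<odot>\<^bsub>M\<^esub> x \<in> F)"

definition right_submodule ::
  "('a, 'z) ring_scheme \<Rightarrow> ('l, 'a, 'm, 'x) bimodule_scheme \<Rightarrow> 'm set \<Rightarrow> bool" where
  "right_submodule A M F \<longleftrightarrow>
     subgroup F (add_monoid M) \<and> (\<forall>x\<in>F. \<forall>a\<in>carrier A. x \<triangleleft>\<^bsub>M\<^esub> a \<in> F)"

definition fin_gen_left_submodule ::
  "('a, 'z) ring_scheme \<Rightarrow> ('a, 'm, 'x) module_scheme \<Rightarrow> 'm set \<Rightarrow> bool" where
  "fin_gen_left_submodule A M F \<longleftrightarrow> left_submodule A M F \<and>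
     (\<exists>S. finite S \<and> S \<subseteq> F \<and> (\<forall>F'. left_submodule A M F' \<and> S \<subseteq> F' \<longrightarrow> F \<subseteq> F'))"

definition fin_gen_right_module ::
  "('a, 'z) ring_scheme \<Rightarrow> ('l, 'a, 'm, 'x) bimodule_scheme \<Rightarrow> bool" where
  "fin_gen_right_module A M \<longleftrightarrow>
     (\<exists>S. finite S \<and> S \<subseteq> carrier M \<and> (\<forall>F. right_submodule A M F \<and> S \<subseteq> F \<longrightarrow> F = carrier M))"

definition right_artinian :: "('a, 'z) ring_scheme \<Rightarrow> bool" where
  "right_artinian A \<longleftrightarrow>
     (\<forall>I :: nat \<Rightarrow> 'a set.
        (\<forall>i. right_submodule A (regular_bimodule A) (I i) \<and> I (Suc i) \<subseteq> I i) \<longrightarrow>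
        (\<exists>n. \<forall>i\<ge>n. I i = I n))"

subsection \<open>Local projectivity\<close>

text \<open>
  A formula cannot quantify over types, so the modules \<open>L\<close> and \<open>N\<close> of the definition range over
  carriers in the types \<^typ>\<open>'w \<Rightarrow> 'a\<close> and \<^typ>\<open>'w\<close>. No generality is lost:
  \<open>locally_projective_lifts\<close> below derives the lifting property for \<open>L\<close> and \<open>N\<close> over arbitrary types
  (test on the free module with basis \<open>W\<close>).
\<close>

definition locally_projective ::
  "('a, 'z) ring_scheme \<Rightarrow> ('a, 'w, 'x) module_scheme \<Rightarrow> bool" where
  "locally_projective A W \<longleftrightarrow>
     (\<forall>F (L :: ('a, 'w \<Rightarrow> 'a) module) (N :: ('a, 'w) module) p g.
        fin_gen_left_submodule A W F \<and> left_module A L \<and> left_module A N \<and>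
        p \<in> left_hom A L N \<and> p ` carrier L = carrier N \<and> g \<in> left_hom A W N \<longrightarrow>
        (\<exists>g'\<in>left_hom A W L. \<forall>x\<in>F. p (g' x) = g x))"

definition free_module ::
  "('a, 'z) ring_scheme \<Rightarrow> 'w set \<Rightarrow> ('a, 'w \<Rightarrow> 'a) module" where
  "free_module A S =
     \<lparr>carrier = {u. (\<forall>w. u w \<in> carrier A) \<and> finite {w. u w \<noteq> \<zero>\<^bsub>A\<^esub>} \<and> {w. u w \<noteq> \<zero>\<^bsub>A\<^esub>} \<subseteq> S},
      monoid.mult = undefined, one = undefined,
      ring.zero = (\<lambda>_. \<zero>\<^bsub>A\<^esub>), add = (\<lambda>u v w. u w \<oplus>\<^bsub>A\<^esub> v w), smult = (\<lambda>a u w. a \<otimes>\<^bsub>A\<^esub> u w)\<rparr>"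

definition free_module_ext ::
  "('a, 'z) ring_scheme \<Rightarrow> ('a, 'm, 'x) module_scheme \<Rightarrow> ('w \<Rightarrow> 'm) \<Rightarrow> ('w \<Rightarrow> 'a) \<Rightarrow> 'm" where
  "free_module_ext A M h u = (\<Oplus>\<^bsub>M\<^esub>w\<in>{w. u w \<noteq> \<zero>\<^bsub>A\<^esub>}. u w \<odot>\<^bsub>M\<^esub> h w)"

lemma left_module_free_module:
  assumes "ring A"
  shows "left_module A (free_module A S)"
proof -
  interpret A: ring A by fact
  have add_fin: "finite {w. u w \<oplus>\<^bsub>A\<^esub> v w \<noteq> \<zero>\<^bsub>A\<^esub>}"
    if "finite {w. u w \<noteq> \<zero>\<^bsub>A\<^esub>}" "finite {w. v w \<noteq> \<zero>\<^bsub>A\<^esub>}" for u v :: "'c \<Rightarrow> 'a"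
    by (rule finite_subset[OF _ finite_UnI[OF that]]) auto
  have mult_fin: "finite {w. a \<otimes>\<^bsub>A\<^esub> u w \<noteq> \<zero>\<^bsub>A\<^esub>}"
    if "finite {w. u w \<noteq> \<zero>\<^bsub>A\<^esub>}" "a \<in> carrier A" for u :: "'c \<Rightarrow> 'a" and a
    by (rule finite_subset[OF _ that(1)]) (use that in auto)
  have add_sub: "u w \<oplus>\<^bsub>A\<^esub> v w = \<zero>\<^bsub>A\<^esub>"
    if "{w. u w \<noteq> \<zero>\<^bsub>A\<^esub>} \<subseteq> S" "{w. v w \<noteq> \<zero>\<^bsub>A\<^esub>} \<subseteq> S" "w \<notin> S" for u v :: "'c \<Rightarrow> 'a" and w S
  proof -
    have "u w = \<zero>\<^bsub>A\<^esub>" "v w = \<zero>\<^bsub>A\<^esub>" using that by auto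
    then show ?thesis by simp
  qed
  have mult_sub: "a \<otimes>\<^bsub>A\<^esub> u w = \<zero>\<^bsub>A\<^esub>"
    if "{w. u w \<noteq> \<zero>\<^bsub>A\<^esub>} \<subseteq> S" "w \<notin> S" "a \<in> carrier A" for u :: "'c \<Rightarrow> 'a" and w S a
  proof -
    have "u w = \<zero>\<^bsub>A\<^esub>" using that by auto
    then show ?thesis using that by simp
  qed
  have ab: "abelian_group (free_module A S)"
  proof (rule abelian_groupI)
    show "\<exists>v\<in>carrier (free_module A S). v \<oplus>\<^bsub>free_module A S\<^esub> u = \<zero>\<^bsub>free_module A S\<^esub>"
      if "u \<in> carrier (free_module A S)" for u
    proof
      have "{w. \<ominus>\<^bsub>A\<^esub> u w \<noteq> \<zero>\<^bsub>A\<^esub>} \<subseteq> {w. u w \<noteq> \<zero>\<^bsub>A\<^esub>}" by auto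
      then show "(\<lambda>w. \<ominus>\<^bsub>A\<^esub> u w) \<in> carrier (free_module A S)"
        using that by (auto simp: free_module_def intro: finite_subset)
      show "(\<lambda>w. \<ominus>\<^bsub>A\<^esub> u w) \<oplus>\<^bsub>free_module A S\<^esub> u = \<zero>\<^bsub>free_module A S\<^esub>"
        using that by (auto simp: free_module_def A.l_neg)
    qed
  qed (auto simp: free_module_def add_fin A.a_ac intro: ccontr dest: add_sub)
  show ?thesis
    by (intro left_module.intro left_module_axioms.intro ab \<open>ring A\<close>)
      (auto simp: free_module_def mult_fin A.l_distr A.r_distr A.m_assoc
        intro: ccontr dest: mult_sub)
qed

lemma free_module_ext_superset:
  assumes M: "left_module A M" and h: "h \<in> S \<rightarrow> carrier M" and u: "\<And>w. u w \<in> carrier A"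
    and B: "finite B" "{w. u w \<noteq> \<zero>\<^bsub>A\<^esub>} \<subseteq> B" "B \<subseteq> S"
  shows "free_module_ext A M h u = (\<Oplus>\<^bsub>M\<^esub>w\<in>B. u w \<odot>\<^bsub>M\<^esub> h w)"
proof -
  interpret M: left_module A M by fact
  have z: "\<zero>\<^bsub>A\<^esub> \<odot>\<^bsub>M\<^esub> x = \<zero>\<^bsub>M\<^esub>" if "x \<in> carrier M" for x
    using M.lact_l_distr[of "\<zero>\<^bsub>A\<^esub>" "\<zero>\<^bsub>A\<^esub>" x] that M.lact_closed[of "\<zero>\<^bsub>A\<^esub>" x]
    by (simp add: M.M.add.l_cancel_one')
  show ?thesis
    unfolding free_module_ext_def
  proof (rule M.M.add.finprod_mono_neutral_cong_left)
    show "(\<lambda>w. u w \<odot>\<^bsub>M\<^esub> h w) \<in> B \<rightarrow> carrier M"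
      using B(3) h u by (blast intro: M.lact_closed)
    show "u w \<odot>\<^bsub>M\<^esub> h w = \<zero>\<^bsub>M\<^esub>" if "w \<in> B - {w. u w \<noteq> \<zero>\<^bsub>A\<^esub>}" for w
      using that B h z by auto
  qed (use B in auto)
qed

lemma left_hom_finsum:
  assumes M: "left_module A M" and N: "left_module A N" and q: "q \<in> left_hom A M N"
    and "finite B" "f \<in> B \<rightarrow> carrier M"
  shows "q (\<Oplus>\<^bsub>M\<^esub>w\<in>B. f w) = (\<Oplus>\<^bsub>N\<^esub>w\<in>B. q (f w))"
proof -
  interpret M: left_module A M by fact
  interpret N: left_module A N by fact
  have qc: "q x \<in> carrier N" if "x \<in> carrier M" for x using q that by (auto simp: left_hom_def)
  have qa: "q (x \<oplus>\<^bsub>M\<^esub> y) = q x \<oplus>\<^bsub>N\<^esub> q y" if "x \<in> carrier M" "y \<in> carrier M" for x y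
    using q that by (auto simp: left_hom_def)
  have "q \<zero>\<^bsub>M\<^esub> = \<zero>\<^bsub>N\<^esub>"
    using qa[of "\<zero>\<^bsub>M\<^esub>" "\<zero>\<^bsub>M\<^esub>"] qc[of "\<zero>\<^bsub>M\<^esub>"] by (simp add: N.M.add.l_cancel_one')
  with assms(4,5) show ?thesis
    by (induction B rule: finite_induct) (auto simp: qa qc Pi_iff)
qed

lemma free_module_ext_hom:
  assumes M: "left_module A M" and h: "h \<in> S \<rightarrow> carrier M"
  shows "free_module_ext A M h \<in> left_hom A (free_module A S) M"
proof -
  interpret M: left_module A M by fact
  have cl: "free_module_ext A M h u \<in> carrier M" if "u \<in> carrier (free_module A S)" for u
    unfolding free_module_ext_def
    by (rule M.M.finsum_closed) (use that h in \<open>auto simp: free_module_def intro!: M.lact_closed\<close>)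
  have add: "free_module_ext A M h (u \<oplus>\<^bsub>free_module A S\<^esub> v)
      = free_module_ext A M h u \<oplus>\<^bsub>M\<^esub> free_module_ext A M h v"
    if u: "u \<in> carrier (free_module A S)" and v: "v \<in> carrier (free_module A S)" for u v
  proof -
    let ?B = "{w. u w \<noteq> \<zero>\<^bsub>A\<^esub>} \<union> {w. v w \<noteq> \<zero>\<^bsub>A\<^esub>}"
    note sup = free_module_ext_superset[OF M h, of _ ?B]
    have B: "finite ?B" "?B \<subseteq> S" and uc: "\<And>w. u w \<in> carrier A" "\<And>w. v w \<in> carrier A"
      using u v by (auto simp: free_module_def)
    have hc: "\<And>w. w \<in> ?B \<Longrightarrow> h w \<in> carrier M" using B h by blast
    have "free_module_ext A M h (\<lambda>w. u w \<oplus>\<^bsub>A\<^esub> v w) = (\<Oplus>\<^bsub>M\<^esub>w\<in>?B. (u w \<oplus>\<^bsub>A\<^esub> v w) \<odot>\<^bsub>M\<^esub> h w)"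
      by (rule sup) (use B uc in auto)
    also have "\<dots> = (\<Oplus>\<^bsub>M\<^esub>w\<in>?B. u w \<odot>\<^bsub>M\<^esub> h w \<oplus>\<^bsub>M\<^esub> v w \<odot>\<^bsub>M\<^esub> h w)"
      by (rule M.M.finsum_cong') (use uc hc in \<open>auto simp: M.lact_l_distr M.lact_closed\<close>)
    also have "\<dots> = (\<Oplus>\<^bsub>M\<^esub>w\<in>?B. u w \<odot>\<^bsub>M\<^esub> h w) \<oplus>\<^bsub>M\<^esub> (\<Oplus>\<^bsub>M\<^esub>w\<in>?B. v w \<odot>\<^bsub>M\<^esub> h w)"
      by (rule M.M.finsum_addf) (use uc hc in \<open>auto intro!: M.lact_closed\<close>)
    also have "(\<Oplus>\<^bsub>M\<^esub>w\<in>?B. u w \<odot>\<^bsub>M\<^esub> h w) = free_module_ext A M h u"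
      by (rule sup[symmetric]) (use B uc in auto)
    also have "(\<Oplus>\<^bsub>M\<^esub>w\<in>?B. v w \<odot>\<^bsub>M\<^esub> h w) = free_module_ext A M h v"
      by (rule sup[symmetric]) (use B uc in auto)
    finally show ?thesis by (simp add: free_module_def)
  qed
  have smult: "free_module_ext A M h (a \<odot>\<^bsub>free_module A S\<^esub> u) = a \<odot>\<^bsub>M\<^esub> free_module_ext A M h u"
    if a: "a \<in> carrier A" and u: "u \<in> carrier (free_module A S)" for a u
  proof -
    let ?B = "{w. u w \<noteq> \<zero>\<^bsub>A\<^esub>}"
    note sup = free_module_ext_superset[OF M h, of _ ?B]
    have B: "finite ?B" "?B \<subseteq> S" and uc: "\<And>w. u w \<in> carrier A"
      using u by (auto simp: free_module_def)
    have hc: "\<And>w. w \<in> ?B \<Longrightarrow> h w \<in> carrier M" using B h by blast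
    have hom: "(\<lambda>x. a \<odot>\<^bsub>M\<^esub> x) (\<Oplus>\<^bsub>M\<^esub>w\<in>B. f w) = (\<Oplus>\<^bsub>M\<^esub>w\<in>B. a \<odot>\<^bsub>M\<^esub> f w)"
      if "finite B" "f \<in> B \<rightarrow> carrier M" for B f
    proof -
      have "a \<odot>\<^bsub>M\<^esub> \<zero>\<^bsub>M\<^esub> = \<zero>\<^bsub>M\<^esub>"
        using M.lact_r_distr[of a "\<zero>\<^bsub>M\<^esub>" "\<zero>\<^bsub>M\<^esub>"] a M.lact_closed[of a "\<zero>\<^bsub>M\<^esub>"]
        by (simp add: M.M.add.l_cancel_one')
      with that show ?thesis
        by (induction B rule: finite_induct) (auto simp: a M.lact_closed M.lact_r_distr Pi_iff)
    qed
    have "free_module_ext A M h (\<lambda>w. a \<otimes>\<^bsub>A\<^esub> u w) = (\<Oplus>\<^bsub>M\<^esub>w\<in>?B. (a \<otimes>\<^bsub>A\<^esub> u w) \<odot>\<^bsub>M\<^esub> h w)"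
      by (rule sup) (use B uc a in auto)
    also have "\<dots> = (\<Oplus>\<^bsub>M\<^esub>w\<in>?B. a \<odot>\<^bsub>M\<^esub> (u w \<odot>\<^bsub>M\<^esub> h w))"
      by (rule M.M.finsum_cong') (use uc hc a in \<open>auto simp: M.lact_assoc M.lact_closed\<close>)
    also have "\<dots> = a \<odot>\<^bsub>M\<^esub> (\<Oplus>\<^bsub>M\<^esub>w\<in>?B. u w \<odot>\<^bsub>M\<^esub> h w)"
      by (rule hom[symmetric]) (use B uc hc in \<open>auto intro!: M.lact_closed\<close>)
    finally show ?thesis by (simp add: free_module_def free_module_ext_def)
  qed
  show ?thesis using cl add smult by (auto simp: left_hom_def)
qed

lemma locally_projective_lifts:
  fixes L :: "('a, 'l, 'x) module_scheme" and N :: "('a, 'n, 'y) module_scheme"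
  assumes W: "left_module A W" and lp: "locally_projective A W"
    and F: "fin_gen_left_submodule A W F"
    and L: "left_module A L" and N: "left_module A N"
    and p: "p \<in> left_hom A L N" "p ` carrier L = carrier N" and g: "g \<in> left_hom A W N"
  shows "\<exists>g'\<in>left_hom A W L. \<forall>x\<in>F. p (g' x) = g x"
proof -
  interpret W: left_module A W by fact
  interpret L: left_module A L by fact
  let ?A0 = "free_module A (carrier W)" and ?W = "module.truncate W"
  have Wsel [simp]: "carrier ?W = carrier W" "add ?W = add W" "\<zero>\<^bsub>?W\<^esub> = \<zero>\<^bsub>W\<^esub>" "smult ?W = smult W"
    by (simp_all add: module.truncate_def)
  have W': "left_module A ?W"
  proof (intro left_module.intro left_module_axioms.intro abelian_groupI)
    show "\<exists>y\<in>carrier ?W. y \<oplus>\<^bsub>?W\<^esub> x = \<zero>\<^bsub>?W\<^esub>" if "x \<in> carrier ?W" for x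
      using that by (auto intro!: bexI[of _ "\<ominus>\<^bsub>W\<^esub> x"] simp: W.M.l_neg)
  qed (auto simp: W.A.ring_axioms W.M.a_ac W.lact_closed W.lact_l_distr W.lact_r_distr
      W.lact_assoc W.lact_one)
  let ?q = "free_module_ext A ?W (\<lambda>w. w)"
  have q: "?q \<in> left_hom A ?A0 ?W" by (rule free_module_ext_hom[OF W']) simp
  have q_delta: "?q (\<lambda>v. if v = x then \<one>\<^bsub>A\<^esub> else \<zero>\<^bsub>A\<^esub>) = x" if "x \<in> carrier W" for x
  proof -
    interpret W': left_module A ?W by (rule W')
    have "?q (\<lambda>v. if v = x then \<one>\<^bsub>A\<^esub> else \<zero>\<^bsub>A\<^esub>)
        = (\<Oplus>\<^bsub>?W\<^esub>w\<in>{x}. (if w = x then \<one>\<^bsub>A\<^esub> else \<zero>\<^bsub>A\<^esub>) \<odot>\<^bsub>?W\<^esub> w)"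
      by (rule free_module_ext_superset[OF W', where S = "carrier W"]) (use that in auto)
    also have "\<dots> = x" using that W'.lact_one[of x] by simp
    finally show ?thesis .
  qed
  have surj: "?q ` carrier ?A0 = carrier ?W"
  proof
    show "?q ` carrier ?A0 \<subseteq> carrier ?W" using q by (auto simp: left_hom_def)
    show "carrier ?W \<subseteq> ?q ` carrier ?A0"
    proof
      fix x assume x: "x \<in> carrier ?W"
      have "(\<lambda>v. if v = x then \<one>\<^bsub>A\<^esub> else \<zero>\<^bsub>A\<^esub>) \<in> carrier ?A0"
        using x by (auto simp: free_module_def)
      then show "x \<in> ?q ` carrier ?A0" using q_delta[of x] x by (metis Wsel(1) imageI)
    qed
  qed
  have id: "(\<lambda>x. x) \<in> left_hom A W ?W" by (auto simp: left_hom_def)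
  from lp[unfolded locally_projective_def, rule_format, of F ?A0 ?W ?q "\<lambda>x. x"]
  obtain s where s: "s \<in> left_hom A W ?A0" "\<forall>x\<in>F. ?q (s x) = x"
    using F left_module_free_module[OF W.A.ring_axioms] W' q surj id by blast
  have FW: "F \<subseteq> carrier W"
    using F using subgroup.subset[of F "add_monoid W"]
    by (simp add: fin_gen_left_submodule_def left_submodule_def)
  have gc: "g \<in> carrier W \<rightarrow> carrier N" using g by (simp add: left_hom_def)
  have "\<forall>w\<in>carrier W. \<exists>l\<in>carrier L. p l = g w"
    using gc p(2) by (metis PiE imageE)
  then obtain h where h: "\<And>w. w \<in> carrier W \<Longrightarrow> h w \<in> carrier L \<and> p (h w) = g w" by metis
  let ?e = "free_module_ext A L h"
  have e: "?e \<in> left_hom A ?A0 L" by (rule free_module_ext_hom[OF L]) (use h in auto)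
  have g_W': "g \<in> left_hom A ?W N" using g by (simp add: left_hom_def)
  have pe: "p (?e u) = g (?q u)" if u: "u \<in> carrier ?A0" for u
  proof -
    let ?B = "{w. u w \<noteq> \<zero>\<^bsub>A\<^esub>}"
    have B: "finite ?B" "?B \<subseteq> carrier W" and uc: "\<And>w. u w \<in> carrier A"
      using u by (auto simp: free_module_def)
    have Bc: "w \<in> ?B \<Longrightarrow> w \<in> carrier W" for w using B(2) by blast
    have "p (?e u) = (\<Oplus>\<^bsub>N\<^esub>w\<in>?B. p (u w \<odot>\<^bsub>L\<^esub> h w))"
      unfolding free_module_ext_def
      by (rule left_hom_finsum[OF L N p(1) B(1)]) (use uc h Bc in \<open>blast intro: L.lact_closed\<close>)
    also have "\<dots> = (\<Oplus>\<^bsub>N\<^esub>w\<in>?B. g (u w \<odot>\<^bsub>?W\<^esub> w))"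
    proof -
      interpret N: left_module A N by fact
      show ?thesis
      proof (rule N.M.finsum_cong')
        show "p (u w \<odot>\<^bsub>L\<^esub> h w) = g (u w \<odot>\<^bsub>?W\<^esub> w)" if "w \<in> ?B" for w
          using p(1) g uc h[OF Bc[OF that]] Bc[OF that] by (simp add: left_hom_def)
        show "(\<lambda>w. g (u w \<odot>\<^bsub>?W\<^esub> w)) \<in> ?B \<rightarrow> carrier N"
          using gc uc Bc W.lact_closed by (simp add: Pi_iff) 
      qed simp
    qed
    also have "\<dots> = g (?q u)"
      unfolding free_module_ext_def
      by (rule left_hom_finsum[OF W' N g_W' B(1), symmetric])
        (use uc Bc in \<open>auto intro!: W.lact_closed\<close>)
    finally show ?thesis .
  qed
  have sc: "s x \<in> carrier ?A0" if "x \<in> carrier W" for x using s(1) that by (auto simp: left_hom_def)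
  show ?thesis
  proof (intro bexI ballI)
    show "(\<lambda>x. ?e (s x)) \<in> left_hom A W L"
      using s(1) e by (auto simp: left_hom_def Pi_iff)
    show "p (?e (s x)) = g x" if "x \<in> F" for x
      using pe[OF sc] s(2) that FW by auto
  qed
qed

section \<open>Tensor products\<close>

text \<open>
  \<open>M \<otimes>\<^sub>A N\<close> is the free abelian group on pairs modulo the subgroup generated by the bilinearity and
  balancing relations; its elements are cosets of formal integer combinations of pairs.
\<close>

definition tensor_relations ::
  "('a, 'z) ring_scheme \<Rightarrow> ('l, 'a, 'm, 'x) bimodule_scheme \<Rightarrow> ('a, 'b, 'n, 'y) bimodule_scheme
    \<Rightarrow> ('m \<times> 'n \<Rightarrow>\<^sub>0 int) set" where
  "tensor_relations A M N =
     {frag_of (x \<oplus>\<^bsub>M\<^esub> y, n) - frag_of (x, n) - frag_of (y, n) | x y n.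
        x \<in> carrier M \<and> y \<in> carrier M \<and> n \<in> carrier N} \<union>
     {frag_of (m, x \<oplus>\<^bsub>N\<^esub> y) - frag_of (m, x) - frag_of (m, y) | m x y.
        m \<in> carrier M \<and> x \<in> carrier N \<and> y \<in> carrier N} \<union>
     {frag_of (m \<triangleleft>\<^bsub>M\<^esub> a, n) - frag_of (m, a \<odot>\<^bsub>N\<^esub> n) | m a n.
        m \<in> carrier M \<and> a \<in> carrier A \<and> n \<in> carrier N}"

definition tensor_null ::
  "('a, 'z) ring_scheme \<Rightarrow> ('l, 'a, 'm, 'x) bimodule_scheme \<Rightarrow> ('a, 'b, 'n, 'y) bimodule_scheme
    \<Rightarrow> ('m \<times> 'n \<Rightarrow>\<^sub>0 int) set" where
  "tensor_null A M N =
     generate (free_Abelian_group (carrier M \<times> carrier N)) (tensor_relations A M N)"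

definition tensor_group ::
  "('a, 'z) ring_scheme \<Rightarrow> ('l, 'a, 'm, 'x) bimodule_scheme \<Rightarrow> ('a, 'b, 'n, 'y) bimodule_scheme
    \<Rightarrow> ('m \<times> 'n \<Rightarrow>\<^sub>0 int) set monoid" where
  "tensor_group A M N = free_Abelian_group (carrier M \<times> carrier N) Mod tensor_null A M N"

definition pure_tensor ::
  "('a, 'z) ring_scheme \<Rightarrow> ('l, 'a, 'm, 'x) bimodule_scheme \<Rightarrow> ('a, 'b, 'n, 'y) bimodule_scheme
    \<Rightarrow> 'm \<Rightarrow> 'n \<Rightarrow> ('m \<times> 'n \<Rightarrow>\<^sub>0 int) set" where
  "pure_tensor A M N m n =
     tensor_null A M N #>\<^bsub>free_Abelian_group (carrier M \<times> carrier N)\<^esub> frag_of (m, n)"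

text \<open>
  \<open>tensor_lift P \<phi>\<close> sends \<open>\<Sum>\<^sub>i k\<^sub>i (m\<^sub>i \<otimes> n\<^sub>i)\<close> to \<open>\<Sum>\<^sub>i k\<^sub>i \<phi>(m\<^sub>i, n\<^sub>i)\<close>, evaluated on a chosen representative.
  For balanced \<open>\<phi>\<close> it is the additive map given by the universal property
  (\<open>tensor_lift_hom\<close>, \<open>tensor_lift_pure\<close>). In Sweedler notation,
  \<open>tensor_lift P \<phi> (\<Delta> c) = \<Sum> \<phi>(c\<^sub>1, c\<^sub>2)\<close>.
\<close>

definition tensor_eval ::
  "('p, 'z) ring_scheme \<Rightarrow> ('m \<Rightarrow> 'n \<Rightarrow> 'p) \<Rightarrow> ('m \<times> 'n \<Rightarrow>\<^sub>0 int) \<Rightarrow> 'p" where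
  "tensor_eval P \<phi> u =
     (\<Oplus>\<^bsub>P\<^esub>k\<in>Poly_Mapping.keys u. [Poly_Mapping.lookup u k] \<cdot>\<^bsub>P\<^esub> \<phi> (fst k) (snd k))"

definition tensor_lift ::
  "('p, 'z) ring_scheme \<Rightarrow> ('m \<Rightarrow> 'n \<Rightarrow> 'p) \<Rightarrow> ('m \<times> 'n \<Rightarrow>\<^sub>0 int) set \<Rightarrow> 'p" where
  "tensor_lift P \<phi> t = tensor_eval P \<phi> (SOME u. u \<in> t)"

definition tensor_ab ::
  "('a, 'z) ring_scheme \<Rightarrow> ('l, 'a, 'm, 'x) bimodule_scheme \<Rightarrow> ('a, 'b, 'n, 'y) bimodule_scheme
    \<Rightarrow> ('m \<times> 'n \<Rightarrow>\<^sub>0 int) set ring" where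
  "tensor_ab A M N =
     \<lparr>carrier = carrier (tensor_group A M N), monoid.mult = undefined, one = undefined,
      ring.zero = \<one>\<^bsub>tensor_group A M N\<^esub>, add = monoid.mult (tensor_group A M N)\<rparr>"

definition tensor ::
  "('a, 'z) ring_scheme \<Rightarrow> ('l, 'a, 'm, 'x) bimodule_scheme \<Rightarrow> ('a, 'b, 'n, 'y) bimodule_scheme
    \<Rightarrow> ('l, 'b, ('m \<times> 'n \<Rightarrow>\<^sub>0 int) set) bimodule" where
  "tensor A M N =
     \<lparr>carrier = carrier (tensor_group A M N), monoid.mult = undefined, one = undefined,
      ring.zero = \<one>\<^bsub>tensor_group A M N\<^esub>, add = monoid.mult (tensor_group A M N),
      smult = (\<lambda>a. tensor_lift (tensor_ab A M N) (\<lambda>m n. pure_tensor A M N (a \<odot>\<^bsub>M\<^esub> m) n)),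
      ract = (\<lambda>t b. tensor_lift (tensor_ab A M N) (\<lambda>m n. pure_tensor A M N m (n \<triangleleft>\<^bsub>N\<^esub> b)) t)\<rparr>"

definition balanced ::
  "('a, 'z) ring_scheme \<Rightarrow> ('l, 'a, 'm, 'x) bimodule_scheme \<Rightarrow> ('a, 'b, 'n, 'y) bimodule_scheme
    \<Rightarrow> ('p, 'w) ring_scheme \<Rightarrow> ('m \<Rightarrow> 'n \<Rightarrow> 'p) \<Rightarrow> bool" where
  "balanced A M N P \<phi> \<longleftrightarrow>
     (\<forall>m\<in>carrier M. \<forall>n\<in>carrier N. \<phi> m n \<in> carrier P) \<and>
     (\<forall>x\<in>carrier M. \<forall>y\<in>carrier M. \<forall>n\<in>carrier N. \<phi> (x \<oplus>\<^bsub>M\<^esub> y) n = \<phi> x n \<oplus>\<^bsub>P\<^esub> \<phi> y n) \<and>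
     (\<forall>m\<in>carrier M. \<forall>x\<in>carrier N. \<forall>y\<in>carrier N. \<phi> m (x \<oplus>\<^bsub>N\<^esub> y) = \<phi> m x \<oplus>\<^bsub>P\<^esub> \<phi> m y) \<and>
     (\<forall>m\<in>carrier M. \<forall>a\<in>carrier A. \<forall>n\<in>carrier N. \<phi> (m \<triangleleft>\<^bsub>M\<^esub> a) n = \<phi> m (a \<odot>\<^bsub>N\<^esub> n))"

lemma free_Abelian_group_diff:
  "u \<in> carrier (free_Abelian_group S) \<Longrightarrow> v \<in> carrier (free_Abelian_group S)
    \<Longrightarrow> u - v \<in> carrier (free_Abelian_group S)"
  using keys_diff[of u v] by auto

lemma tensor_relations_closed:
  assumes "right_module A M" "left_module A N"
  shows "tensor_relations A M N \<subseteq> carrier (free_Abelian_group (carrier M \<times> carrier N))"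
proof -
  interpret M: right_module A M by fact
  interpret N: left_module A N by fact
  show ?thesis
    unfolding tensor_relations_def
    by (auto intro!: free_Abelian_group_diff M.ract_closed N.lact_closed
        simp del: carrier_free_Abelian_group_iff)
qed

lemma tensor_null_subgroup:
  assumes "right_module A M" "left_module A N"
  shows "subgroup (tensor_null A M N) (free_Abelian_group (carrier M \<times> carrier N))"
  unfolding tensor_null_def
  by (rule group.generate_is_subgroup[OF group_free_Abelian_group tensor_relations_closed[OF assms]])

lemma tensor_null_normal:
  assumes "right_module A M" "left_module A N"
  shows "tensor_null A M N \<lhd> free_Abelian_group (carrier M \<times> carrier N)"
  by (rule comm_group.normal_iff_subgroup[OF abelian_free_Abelian_group, THEN iffD2,
        OF tensor_null_subgroup[OF assms]])

lemma tensor_eval_superset: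
  assumes P: "abelian_group P" and f: "\<And>k. k \<in> S \<Longrightarrow> \<phi> (fst k) (snd k) \<in> carrier P"
    and B: "finite B" "Poly_Mapping.keys u \<subseteq> B" "B \<subseteq> S"
  shows "tensor_eval P \<phi> u = (\<Oplus>\<^bsub>P\<^esub>k\<in>B. [Poly_Mapping.lookup u k] \<cdot>\<^bsub>P\<^esub> \<phi> (fst k) (snd k))"
proof -
  interpret P: abelian_group P by fact
  show ?thesis
    unfolding tensor_eval_def
  proof (rule P.add.finprod_mono_neutral_cong_left)
    show "(\<lambda>k. [Poly_Mapping.lookup u k] \<cdot>\<^bsub>P\<^esub> \<phi> (fst k) (snd k)) \<in> B \<rightarrow> carrier P"
      using B(3) f by blast
    show "[Poly_Mapping.lookup u k] \<cdot>\<^bsub>P\<^esub> \<phi> (fst k) (snd k) = \<zero>\<^bsub>P\<^esub>"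
      if "k \<in> B - Poly_Mapping.keys u" for k
      using that by (simp add: Poly_Mapping.in_keys_iff add_pow_def)
  qed (use B in auto)
qed

lemma tensor_eval_hom:
  assumes P: "abelian_group P" and f: "\<And>k. k \<in> S \<Longrightarrow> \<phi> (fst k) (snd k) \<in> carrier P"
  shows "tensor_eval P \<phi> \<in> hom (free_Abelian_group S) (add_monoid P)"
proof -
  interpret P: abelian_group P by fact
  have cl: "tensor_eval P \<phi> u \<in> carrier P" if "Poly_Mapping.keys u \<subseteq> S" for u
    unfolding tensor_eval_def by (rule P.finsum_closed) (use f that in auto)
  have "tensor_eval P \<phi> (u + v) = tensor_eval P \<phi> u \<oplus>\<^bsub>P\<^esub> tensor_eval P \<phi> v"
    if uv: "Poly_Mapping.keys u \<subseteq> S" "Poly_Mapping.keys v \<subseteq> S" for u v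
  proof -
    let ?B = "Poly_Mapping.keys u \<union> Poly_Mapping.keys v"
    note sup = tensor_eval_superset[where \<phi> = \<phi> and B = ?B, OF P f]
    have "tensor_eval P \<phi> (u + v) =
        (\<Oplus>\<^bsub>P\<^esub>k\<in>?B. [Poly_Mapping.lookup (u + v) k] \<cdot>\<^bsub>P\<^esub> \<phi> (fst k) (snd k))"
      by (rule sup) (use uv keys_add[of u v] in auto)
    also have "\<dots> = (\<Oplus>\<^bsub>P\<^esub>k\<in>?B. [Poly_Mapping.lookup u k] \<cdot>\<^bsub>P\<^esub> \<phi> (fst k) (snd k)
        \<oplus>\<^bsub>P\<^esub> [Poly_Mapping.lookup v k] \<cdot>\<^bsub>P\<^esub> \<phi> (fst k) (snd k))"
      by (rule P.finsum_cong') (use f uv in \<open>auto simp: lookup_add P.add.int_pow_mult\<close>)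
    also have "\<dots> = (\<Oplus>\<^bsub>P\<^esub>k\<in>?B. [Poly_Mapping.lookup u k] \<cdot>\<^bsub>P\<^esub> \<phi> (fst k) (snd k))
        \<oplus>\<^bsub>P\<^esub> (\<Oplus>\<^bsub>P\<^esub>k\<in>?B. [Poly_Mapping.lookup v k] \<cdot>\<^bsub>P\<^esub> \<phi> (fst k) (snd k))"
      by (rule P.finsum_addf) (use f uv in auto)
    also have "\<dots> = tensor_eval P \<phi> u \<oplus>\<^bsub>P\<^esub> tensor_eval P \<phi> v"
      by (subst (1 2) sup) (use uv in auto)
    finally show ?thesis .
  qed
  then show ?thesis
    by (auto simp: hom_def cl)
qed

lemma tensor_eval_frag_of:
  assumes P: "abelian_group P" and f: "\<phi> m n \<in> carrier P"
  shows "tensor_eval P \<phi> (frag_of (m, n)) = \<phi> m n"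
proof -
  interpret P: abelian_group P by fact
  show ?thesis
    unfolding tensor_eval_def using f by (simp add: keys_frag_of P.finsum_insert)
qed

lemma tensor_eval_null:
  assumes MN: "right_module A M" "left_module A N" and P: "abelian_group P"
    and bal: "balanced A M N P \<phi>" and u: "u \<in> tensor_null A M N"
  shows "tensor_eval P \<phi> u = \<zero>\<^bsub>P\<^esub>"
proof -
  interpret M: right_module A M by fact
  interpret N: left_module A N by fact
  interpret P: abelian_group P by fact
  let ?G = "free_Abelian_group (carrier M \<times> carrier N)"
  have cl: "\<phi> m n \<in> carrier P" if "m \<in> carrier M" "n \<in> carrier N" for m n
    using bal that by (auto simp: balanced_def)
  have hom: "tensor_eval P \<phi> \<in> hom ?G (add_monoid P)"
    by (rule tensor_eval_hom[OF P]) (use cl in auto)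
  interpret h: group_hom ?G "add_monoid P" "tensor_eval P \<phi>"
    by (intro group_hom.intro group_hom_axioms.intro hom group_free_Abelian_group P.a_group)
  have diff: "tensor_eval P \<phi> (u - v) = tensor_eval P \<phi> u \<ominus>\<^bsub>P\<^esub> tensor_eval P \<phi> v"
    if "u \<in> carrier ?G" "v \<in> carrier ?G" for u v
  proof -
    have "tensor_eval P \<phi> (u - v) = tensor_eval P \<phi> (u \<otimes>\<^bsub>?G\<^esub> inv\<^bsub>?G\<^esub> v)"
      using that by simp
    also have "\<dots> = tensor_eval P \<phi> u \<oplus>\<^bsub>P\<^esub> (inv\<^bsub>add_monoid P\<^esub> tensor_eval P \<phi> v)"
      using that by (subst h.hom_mult) (auto simp del: inv_free_Abelian_group mult_free_Abelian_group
          carrier_free_Abelian_group_iff)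
    finally show ?thesis by (simp add: a_minus_def a_inv_def)
  qed
  note ev = tensor_eval_frag_of[where \<phi> = \<phi>, OF P cl]
  have "tensor_relations A M N \<subseteq> kernel ?G (add_monoid P) (tensor_eval P \<phi>)"
  proof
    fix r assume r: "r \<in> tensor_relations A M N"
    then have rG: "r \<in> carrier ?G"
      using tensor_relations_closed[OF MN] by blast
    have "tensor_eval P \<phi> r = \<zero>\<^bsub>P\<^esub>"
    proof -
      have pq: "p \<oplus>\<^bsub>P\<^esub> q \<ominus>\<^bsub>P\<^esub> p \<ominus>\<^bsub>P\<^esub> q = \<zero>\<^bsub>P\<^esub>" if "p \<in> carrier P" "q \<in> carrier P" for p q
        using that P.r_neg[of "p \<oplus>\<^bsub>P\<^esub> q"] P.minus_add[of p q]
        by (simp add: a_minus_def P.a_assoc)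
      have add1: "\<phi> (x \<oplus>\<^bsub>M\<^esub> y) n \<ominus>\<^bsub>P\<^esub> \<phi> x n \<ominus>\<^bsub>P\<^esub> \<phi> y n = \<zero>\<^bsub>P\<^esub>"
        if "x \<in> carrier M" "y \<in> carrier M" "n \<in> carrier N" for x y n
        using bal that cl[of x n] cl[of y n] by (simp add: balanced_def pq)
      have add2: "\<phi> m (x \<oplus>\<^bsub>N\<^esub> y) \<ominus>\<^bsub>P\<^esub> \<phi> m x \<ominus>\<^bsub>P\<^esub> \<phi> m y = \<zero>\<^bsub>P\<^esub>"
        if "x \<in> carrier N" "y \<in> carrier N" "m \<in> carrier M" for x y m
        using bal that cl[of m x] cl[of m y] by (simp add: balanced_def pq)
      have mid: "\<phi> (m \<triangleleft>\<^bsub>M\<^esub> a) n \<ominus>\<^bsub>P\<^esub> \<phi> m (a \<odot>\<^bsub>N\<^esub> n) = \<zero>\<^bsub>P\<^esub>"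
        if "m \<in> carrier M" "a \<in> carrier A" "n \<in> carrier N" for m a n
        using bal that cl[of m "a \<odot>\<^bsub>N\<^esub> n"] N.lact_closed[of a n]
        by (simp add: balanced_def a_minus_def P.r_neg)
      show ?thesis
        using r unfolding tensor_relations_def
        by (auto simp: diff ev free_Abelian_group_diff add1 add2 mid M.ract_closed N.lact_closed
            simp del: carrier_free_Abelian_group_iff)
    qed
    then show "r \<in> kernel ?G (add_monoid P) (tensor_eval P \<phi>)"
      using rG by (simp add: kernel_def del: carrier_free_Abelian_group_iff)
  qed
  then have "tensor_null A M N \<subseteq> kernel ?G (add_monoid P) (tensor_eval P \<phi>)"
    unfolding tensor_null_def by (rule h.generate_subgroup_incl[OF _ h.subgroup_kernel])
  then show ?thesis
    using u by (auto simp: kernel_def)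
qed

lemma tensor_lift_coset:
  assumes MN: "right_module A M" "left_module A N" and P: "abelian_group P"
    and bal: "balanced A M N P \<phi>" and v: "v \<in> carrier (free_Abelian_group (carrier M \<times> carrier N))"
  shows "tensor_lift P \<phi> (tensor_null A M N #>\<^bsub>free_Abelian_group (carrier M \<times> carrier N)\<^esub> v)
    = tensor_eval P \<phi> v"
proof -
  interpret P: abelian_group P by fact
  let ?G = "free_Abelian_group (carrier M \<times> carrier N)"
  let ?t = "tensor_null A M N #>\<^bsub>?G\<^esub> v"
  have cl: "\<phi> (fst k) (snd k) \<in> carrier P" if "k \<in> carrier M \<times> carrier N" for k
    using bal that by (auto simp: balanced_def)
  note hom = tensor_eval_hom[where \<phi> = \<phi>, OF P cl]
  interpret S: subgroup "tensor_null A M N" ?G by (rule tensor_null_subgroup[OF MN])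
  have ne: "v \<in> ?t"
    by (rule group.rcos_self[OF group_free_Abelian_group v S.subgroup_axioms])
  then have "(SOME u. u \<in> ?t) \<in> ?t" by (rule someI)
  then obtain w where w: "w \<in> tensor_null A M N" "(SOME u. u \<in> ?t) = w \<otimes>\<^bsub>?G\<^esub> v"
    by (auto simp: r_coset_def)
  have "tensor_eval P \<phi> (w \<otimes>\<^bsub>?G\<^esub> v) = tensor_eval P \<phi> w \<oplus>\<^bsub>P\<^esub> tensor_eval P \<phi> v"
    using hom_mult[OF hom S.mem_carrier[OF w(1)] v] by simp
  also have "\<dots> = tensor_eval P \<phi> v"
    using tensor_eval_null[OF MN P bal w(1)] hom_in_carrier[OF hom v] by simp
  finally show ?thesis
    unfolding tensor_lift_def w(2) .
qed

lemma tensor_lift_pure: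
  assumes "right_module A M" "left_module A N" "abelian_group P" "balanced A M N P \<phi>"
    and "m \<in> carrier M" "n \<in> carrier N"
  shows "tensor_lift P \<phi> (pure_tensor A M N m n) = \<phi> m n"
  unfolding pure_tensor_def using assms
  by (subst tensor_lift_coset) (auto simp: balanced_def tensor_eval_frag_of)

lemma tensor_lift_hom:
  assumes MN: "right_module A M" "left_module A N" and P: "abelian_group P"
    and bal: "balanced A M N P \<phi>"
  shows "tensor_lift P \<phi> \<in> hom (add_monoid (tensor A M N)) (add_monoid P)"
proof (rule homI)
  let ?G = "free_Abelian_group (carrier M \<times> carrier N)"
  let ?N = "tensor_null A M N"
  interpret nr: normal ?N ?G by (rule tensor_null_normal[OF MN])
  have cl: "\<phi> (fst k) (snd k) \<in> carrier P" if "k \<in> carrier M \<times> carrier N" for k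
    using bal that by (auto simp: balanced_def)
  note hom = tensor_eval_hom[where \<phi> = \<phi>, OF P cl]
  have ex: "\<exists>u\<in>carrier ?G. t = ?N #>\<^bsub>?G\<^esub> u" if "t \<in> carrier (add_monoid (tensor A M N))" for t
    using that by (auto simp: tensor_def tensor_group_def FactGroup_def RCOSETS_def)
  fix s t assume st: "s \<in> carrier (add_monoid (tensor A M N))" "t \<in> carrier (add_monoid (tensor A M N))"
  obtain u where u: "u \<in> carrier ?G" "s = ?N #>\<^bsub>?G\<^esub> u" using ex[OF st(1)] by blast
  obtain v where v: "v \<in> carrier ?G" "t = ?N #>\<^bsub>?G\<^esub> v" using ex[OF st(2)] by blast
  show "tensor_lift P \<phi> s \<in> carrier (add_monoid P)"
    unfolding u(2) tensor_lift_coset[OF MN P bal u(1)] by (rule hom_in_carrier[OF hom u(1)])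
  have "s \<otimes>\<^bsub>add_monoid (tensor A M N)\<^esub> t = ?N #>\<^bsub>?G\<^esub> (u \<otimes>\<^bsub>?G\<^esub> v)"
    using nr.rcos_sum[OF u(1) v(1)] u(2) v(2) by (simp add: tensor_def tensor_group_def FactGroup_def)
  then show "tensor_lift P \<phi> (s \<otimes>\<^bsub>add_monoid (tensor A M N)\<^esub> t)
      = tensor_lift P \<phi> s \<otimes>\<^bsub>add_monoid P\<^esub> tensor_lift P \<phi> t"
    using tensor_lift_coset[OF MN P bal u(1)] tensor_lift_coset[OF MN P bal v(1)] u(2) v(2)
      tensor_lift_coset[OF MN P bal, of "u \<otimes>\<^bsub>?G\<^esub> v"] hom_mult[OF hom u(1) v(1)] nr.m_closed[OF u(1) v(1)]
    by simp
qed

text \<open>\<open>tensor_map A M' N' f g\<close> is \<open>f \<otimes> g\<close> into \<open>M' \<otimes>\<^sub>A N'\<close>; \<open>tensor_assoc A M N P\<close> is the canonical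
  map from \<open>(M \<otimes>\<^sub>A N) \<otimes>\<^sub>A P\<close> to \<open>M \<otimes>\<^sub>A (N \<otimes>\<^sub>A P)\<close>.\<close>

definition tensor_map ::
  "('a, 'z) ring_scheme \<Rightarrow> ('l, 'a, 'm2, 'x) bimodule_scheme \<Rightarrow> ('a, 'b, 'n2, 'y) bimodule_scheme
    \<Rightarrow> ('m \<Rightarrow> 'm2) \<Rightarrow> ('n \<Rightarrow> 'n2) \<Rightarrow> ('m \<times> 'n \<Rightarrow>\<^sub>0 int) set \<Rightarrow> ('m2 \<times> 'n2 \<Rightarrow>\<^sub>0 int) set" where
  "tensor_map A M' N' f g = tensor_lift (tensor A M' N') (\<lambda>m n. pure_tensor A M' N' (f m) (g n))"

definition tensor_assoc ::
  "('a, 'z) ring_scheme \<Rightarrow> ('l, 'a, 'm, 'x) bimodule_scheme \<Rightarrow> ('a, 'a, 'n, 'y) bimodule_scheme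
    \<Rightarrow> ('a, 'b, 'p, 'w) bimodule_scheme \<Rightarrow> (('m \<times> 'n \<Rightarrow>\<^sub>0 int) set \<times> 'p \<Rightarrow>\<^sub>0 int) set
    \<Rightarrow> ('m \<times> ('n \<times> 'p \<Rightarrow>\<^sub>0 int) set \<Rightarrow>\<^sub>0 int) set" where
  "tensor_assoc A M N P =
     (let T = tensor A M (tensor A N P) in
      tensor_lift T (\<lambda>t p.
        tensor_lift T (\<lambda>m n. pure_tensor A M (tensor A N P) m (pure_tensor A N P n p)) t))"

section \<open>Corings and comodules\<close>

record ('a, 'c) coring = "('a, 'a, 'c) bimodule" +
  comul :: "'c \<Rightarrow> ('c \<times> 'c \<Rightarrow>\<^sub>0 int) set"
  counit :: "'c \<Rightarrow> 'a"

locale coring = bimodule A A C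
  for A :: "('a, 'z) ring_scheme" (structure) and C :: "('a, 'c) coring" (structure) +
  assumes comul_hom: "comul C \<in> left_hom A C (tensor A C C) \<inter> right_hom A C (tensor A C C)"
    and counit_hom:
      "counit C \<in> left_hom A C (regular_bimodule A) \<inter> right_hom A C (regular_bimodule A)"
    and comul_coassoc: "c \<in> carrier C \<Longrightarrow>
      tensor_assoc A C C C (tensor_map A (tensor A C C) C (comul C) id (comul C c)) =
      tensor_map A C (tensor A C C) id (comul C) (comul C c)"
    and counit_left: "c \<in> carrier C \<Longrightarrow>
      tensor_lift C (\<lambda>x y. counit C x \<odot>\<^bsub>C\<^esub> y) (comul C c) = c"
    and counit_right: "c \<in> carrier C \<Longrightarrow>
      tensor_lift C (\<lambda>x y. x \<triangleleft>\<^bsub>C\<^esub> counit C y) (comul C c) = c"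

record ('l, 'a, 'm, 'c) comodule = "('l, 'a, 'm) bimodule" +
  coact :: "'m \<Rightarrow> ('m \<times> 'c \<Rightarrow>\<^sub>0 int) set"

locale comodule = C: coring A C + M: right_module A M
  for A :: "('a, 'z) ring_scheme" (structure) and C :: "('a, 'c) coring" (structure)
    and M :: "('l, 'a, 'm, 'c) comodule" (structure) +
  assumes coact_hom: "coact M \<in> right_hom A M (tensor A M C)"
    and coact_coassoc: "m \<in> carrier M \<Longrightarrow>
      tensor_assoc A M C C (tensor_map A (tensor A M C) C (coact M) id (coact M m)) =
      tensor_map A M (tensor A C C) id (comul C) (coact M m)"
    and coact_counit: "m \<in> carrier M \<Longrightarrow>
      tensor_lift M (\<lambda>x c. x \<triangleleft>\<^bsub>M\<^esub> counit C c) (coact M m) = m"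

definition comod_hom ::
  "('a, 'z) ring_scheme \<Rightarrow> ('a, 'c) coring \<Rightarrow> ('l, 'a, 'm, 'c) comodule \<Rightarrow> ('k, 'a, 'n, 'c) comodule
    \<Rightarrow> ('m \<Rightarrow> 'n) set" where
  "comod_hom A C M N = {f \<in> right_hom A M N.
     \<forall>m\<in>carrier M. coact N (f m) = tensor_map A N C f id (coact M m)}"

text \<open>A subcomodule is a comodule on a subset for which the inclusion is colinear. Its coaction is
  part of the data \<open>K\<close> (it is unique when \<open>K \<otimes>\<^sub>A C \<rightarrow> M \<otimes>\<^sub>A C\<close> is injective, in particular for
  locally projective \<open>C\<close>).\<close>

definition is_subcomodule ::
  "('a, 'z) ring_scheme \<Rightarrow> ('a, 'c) coring \<Rightarrow> ('l, 'a, 'm, 'c) comodule \<Rightarrow> ('l, 'a, 'm, 'c) comodule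
    \<Rightarrow> bool" where
  "is_subcomodule A C K M \<longleftrightarrow>
     comodule A C K \<and> carrier K \<subseteq> carrier M \<and> (\<lambda>x. x) \<in> comod_hom A C K M"

definition subcomodules ::
  "('a, 'z) ring_scheme \<Rightarrow> ('a, 'c) coring \<Rightarrow> ('l, 'a, 'm, 'c) comodule \<Rightarrow> 'm set set" where
  "subcomodules A C M = carrier ` {K. is_subcomodule A C K M}"

definition quotient_module ::
  "('l, 'a, 'm, 'x) bimodule_scheme \<Rightarrow> 'm set \<Rightarrow> ('l, 'a, 'm set) bimodule" where
  "quotient_module M K =
     \<lparr>carrier = a_rcosets\<^bsub>M\<^esub> K, monoid.mult = undefined, one = undefined,
      ring.zero = K, add = set_add M, smult = undefined,
      ract = (\<lambda>X a. \<Union>x\<in>X. K +>\<^bsub>M\<^esub> (x \<triangleleft>\<^bsub>M\<^esub> a))\<rparr>"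

text \<open>The coaction of \<open>M/K\<close> is \<open>x + K \<mapsto> (\<pi>\<^sub>K \<otimes> id) (\<rho>\<^sub>M x)\<close>.\<close>

definition quotient_comodule ::
  "('a, 'z) ring_scheme \<Rightarrow> ('a, 'c) coring \<Rightarrow> ('l, 'a, 'm, 'c) comodule \<Rightarrow> 'm set
    \<Rightarrow> ('l, 'a, 'm set, 'c) comodule" where
  "quotient_comodule A C M K =
     bimodule.extend (quotient_module M K)
       (comodule.fields (\<lambda>X. tensor_map A (quotient_module M K) C (\<lambda>x. K +>\<^bsub>M\<^esub> x) id
                               (coact M (SOME x. x \<in> X))))"

definition self_injective ::
  "('a, 'z) ring_scheme \<Rightarrow> ('a, 'c) coring \<Rightarrow> ('l, 'a, 'm, 'c) comodule \<Rightarrow> bool" where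
  "self_injective A C M \<longleftrightarrow>
     (\<forall>K. is_subcomodule A C K M \<longrightarrow>
        (\<forall>f\<in>comod_hom A C K M. \<exists>g\<in>comod_hom A C M M. \<forall>x\<in>carrier K. g x = f x))"

definition self_projective ::
  "('a, 'z) ring_scheme \<Rightarrow> ('a, 'c) coring \<Rightarrow> ('l, 'a, 'm, 'c) comodule \<Rightarrow> bool" where
  "self_projective A C M \<longleftrightarrow>
     (\<forall>K\<in>subcomodules A C M. \<forall>g\<in>comod_hom A C M (quotient_comodule A C M K).
        \<exists>h\<in>comod_hom A C M M. \<forall>x\<in>carrier M. g x = K +>\<^bsub>M\<^esub> h x)"

definition self_cogenerator ::
  "('a, 'z) ring_scheme \<Rightarrow> ('a, 'c) coring \<Rightarrow> ('l, 'a, 'm, 'c) comodule \<Rightarrow> bool" where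
  "self_cogenerator A C M \<longleftrightarrow>
     (\<forall>K\<in>subcomodules A C M.
        (\<Inter>h\<in>comod_hom A C (quotient_comodule A C M K) M.
           a_kernel (quotient_comodule A C M K) M h) = {\<zero>\<^bsub>quotient_comodule A C M K\<^esub>})"

definition finite_length ::
  "('a, 'z) ring_scheme \<Rightarrow> ('a, 'c) coring \<Rightarrow> ('l, 'a, 'm, 'c) comodule \<Rightarrow> bool" where
  "finite_length A C M \<longleftrightarrow>
     (\<exists>n (K :: nat \<Rightarrow> 'm set). K 0 = {\<zero>\<^bsub>M\<^esub>} \<and> K n = carrier M \<and>
        (\<forall>i\<le>n. K i \<in> subcomodules A C M) \<and>
        (\<forall>i<n. K i \<subset> K (Suc i) \<and> \<not> (\<exists>X\<in>subcomodules A C M. K i \<subset> X \<and> X \<subset> K (Suc i))))"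

definition artinian_comodule ::
  "('a, 'z) ring_scheme \<Rightarrow> ('a, 'c) coring \<Rightarrow> ('l, 'a, 'm, 'c) comodule \<Rightarrow> bool" where
  "artinian_comodule A C M \<longleftrightarrow>
     (\<forall>K :: nat \<Rightarrow> 'm set.
        (\<forall>i. K i \<in> subcomodules A C M \<and> K (Suc i) \<subseteq> K i) \<longrightarrow> (\<exists>n. \<forall>i\<ge>n. K i = K n))"

definition fully_invariant ::
  "('a, 'z) ring_scheme \<Rightarrow> ('a, 'c) coring \<Rightarrow> ('l, 'a, 'm, 'c) comodule \<Rightarrow> 'm set \<Rightarrow> bool" where
  "fully_invariant A C M X \<longleftrightarrow> (\<forall>f\<in>comod_hom A C M M. f ` X \<subseteq> X)"

definition colon_subcomodule ::
  "('a, 'z) ring_scheme \<Rightarrow> ('a, 'c) coring \<Rightarrow> ('l, 'a, 'm, 'c) comodule \<Rightarrow> 'm set \<Rightarrow> 'm set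
    \<Rightarrow> 'm set" where
  "colon_subcomodule A C M X Y =
     (\<Inter>f\<in>{f \<in> comod_hom A C M M. f ` X = {\<zero>\<^bsub>M\<^esub>}}. {m \<in> carrier M. f m \<in> Y})"

definition fully_coprime ::
  "('a, 'z) ring_scheme \<Rightarrow> ('a, 'c) coring \<Rightarrow> ('l, 'a, 'm, 'c) comodule \<Rightarrow> bool" where
  "fully_coprime A C M \<longleftrightarrow> carrier M \<noteq> {\<zero>\<^bsub>M\<^esub>} \<and>
     (\<forall>X\<in>subcomodules A C M. \<forall>Y\<in>subcomodules A C M.
        fully_invariant A C M X \<and> fully_invariant A C M Y \<and>
        carrier M = colon_subcomodule A C M X Y \<longrightarrow> X = carrier M \<or> Y = carrier M)"

section \<open>The bimodule structure over the left dual ring and the endomorphism ring\<close>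

text \<open>Elements of both rings are extensional functions, so that equality of ring elements is
  equality of maps on the carrier.\<close>

definition left_dual_ring :: "('a, 'z) ring_scheme \<Rightarrow> ('a, 'c) coring \<Rightarrow> ('c \<Rightarrow> 'a) ring" where
  "left_dual_ring A C =
     \<lparr>carrier = left_hom A C (regular_bimodule A) \<inter> extensional (carrier C),
      monoid.mult =
        (\<lambda>f g. \<lambda>c\<in>carrier C. tensor_lift A (\<lambda>x y. f (x \<triangleleft>\<^bsub>C\<^esub> g y)) (comul C c)),
      one = restrict (counit C) (carrier C),
      ring.zero = (\<lambda>c\<in>carrier C. \<zero>\<^bsub>A\<^esub>),
      add = (\<lambda>f g. \<lambda>c\<in>carrier C. f c \<oplus>\<^bsub>A\<^esub> g c)\<rparr>"

definition comod_end_op ::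
  "('a, 'z) ring_scheme \<Rightarrow> ('a, 'c) coring \<Rightarrow> ('l, 'a, 'm, 'c) comodule \<Rightarrow> ('m \<Rightarrow> 'm) ring" where
  "comod_end_op A C M =
     \<lparr>carrier = comod_hom A C M M \<inter> extensional (carrier M),
      monoid.mult = (\<lambda>f g. compose (carrier M) g f),
      one = (\<lambda>m\<in>carrier M. m),
      ring.zero = (\<lambda>m\<in>carrier M. \<zero>\<^bsub>M\<^esub>),
      add = (\<lambda>f g. \<lambda>m\<in>carrier M. f m \<oplus>\<^bsub>M\<^esub> g m)\<rparr>"

definition dual_end_bimodule ::
  "('l, 'a, 'm, 'c) comodule \<Rightarrow> ('c \<Rightarrow> 'a, 'm \<Rightarrow> 'm, 'm) bimodule" where
  "dual_end_bimodule M =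
     \<lparr>carrier = carrier M, monoid.mult = undefined, one = undefined,
      ring.zero = \<zero>\<^bsub>M\<^esub>, add = add M,
      smult = (\<lambda>f m. tensor_lift M (\<lambda>x c. x \<triangleleft>\<^bsub>M\<^esub> f c) (coact M m)),
      ract = (\<lambda>m f. f m)\<rparr>"

definition simple_bimodule ::
  "('a, 'z) ring_scheme \<Rightarrow> ('b, 'w) ring_scheme \<Rightarrow> ('a, 'b, 'm, 'x) bimodule_scheme \<Rightarrow> bool" where
  "simple_bimodule S T M \<longleftrightarrow> carrier M \<noteq> {\<zero>\<^bsub>M\<^esub>} \<and>
     (\<forall>N. left_submodule S M N \<and> right_submodule T M N \<longrightarrow> N = {\<zero>\<^bsub>M\<^esub>} \<or> N = carrier M)"

end

(*
A subgroup of M stable under the action of the left dual ring is the same thing as a subcomodule: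
local projectivity makes the identity of C, and of C \<otimes> C, locally a map of finite rank, so an element of
P \<otimes> C is determined by its slices (id \<otimes> f), f a functional on C. For the same reason colinear maps are
the maps commuting with the functionals. So everything takes place in the lattice of stable subgroups.

If M is simple as a bimodule, then a fully invariant proper X is 0, and (0 : 0) = 0.
Conversely, each of the three finiteness conditions gives the minimum condition, hence a least
essential subcomodule S, the socle, which is fully invariant. The ideal J of the endomorphisms killing S
is nilpotent: if M has finite length (which (2) implies, by Hopkins--Levitzki), because every factor from J
enlarges the kernel; in case (3), by the argument of Hopkins for right artinian rings. Were S proper, take n
least with J^n = 0; then (S : Y) = M with Y the common kernel of J^(n-1), against coprimeness. So S = M, and
no proper subcomodule is essential. A fully invariant N \<noteq> 0 then has a complement W. An endomorphism
h \<noteq> 0 killing W maps M to N, and self-injectivity shows that h f = 0 for all f killing N; so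
(N : Y) = M with Y the intersection of the kernels of h e, and coprimeness gives N = M.
*)

theory Submission
  imports Defs "HOL-Algebra.Ideal_Product"
begin

text \<open>Each hypothesis on M enters through one property of endomorphisms. Self-cogeneration: a
  point outside a stable W is separated from W by an endomorphism killing W. Self-injectivity: an
  endomorphism injective on a stable W has a left inverse there. Self-projectivity: f = b g as soon
  as f(M) \<subseteq> b(M), so that images f(M) take the place of principal right ideals in the
  argument of Hopkins. Coprimeness is applied to pairs X, Y with Y the common kernel of a set of
  endomorphisms closed under composition on the right with all endomorphisms; that closure makes Y
  fully invariant.

  The obstacle on the comodule side is that the coaction of a subcomodule has to be constructed.
  Pulling the coaction of M back to a stable X needs X \<otimes> C -> M \<otimes> C to be injective,
  and its coassociativity is an equation in X \<otimes> (C \<otimes> C), which calls for the same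
  injectivity with C \<otimes> C. Hence the finite-rank approximation is carried over to the tensor
  square.\<close>

no_notation Sum_Type.Plus (infixr \<open><+>\<close> 65)

section \<open>Minimum and descending chain conditions on families of sets\<close>

definition minimum_condition :: "'a set set \<Rightarrow> bool" where
  "minimum_condition \<F> \<longleftrightarrow>
     (\<forall>\<G>\<subseteq>\<F>. \<G> \<noteq> {} \<longrightarrow> (\<exists>X\<in>\<G>. \<forall>Y\<in>\<G>. Y \<subseteq> X \<longrightarrow> Y = X))"

lemma minimum_conditionD:
  assumes "minimum_condition \<F>" "\<G> \<subseteq> \<F>" "Z \<in> \<G>"
  shows "\<exists>X\<in>\<G>. \<forall>Y\<in>\<G>. Y \<subseteq> X \<longrightarrow> Y = X"
  using assms unfolding minimum_condition_def by auto

lemma minimum_condition_subset: "minimum_condition \<F> \<Longrightarrow> \<F>' \<subseteq> \<F> \<Longrightarrow> minimum_condition \<F>'"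
  unfolding minimum_condition_def by (meson subset_trans)

lemma minimum_condition_if_dcc:
  assumes dcc: "\<And>K :: nat \<Rightarrow> 'a set. (\<And>i. K i \<in> \<F> \<and> K (Suc i) \<subseteq> K i) \<Longrightarrow> \<exists>n. \<forall>i\<ge>n. K i = K n"
  shows "minimum_condition \<F>"
  unfolding minimum_condition_def
proof (intro allI impI, rule ccontr)
  fix \<G> assume G: "\<G> \<subseteq> \<F>" "\<G> \<noteq> {}" and no: "\<not> (\<exists>X\<in>\<G>. \<forall>Y\<in>\<G>. Y \<subseteq> X \<longrightarrow> Y = X)"
  from no have "\<exists>Y. Y \<in> \<G> \<and> Y \<subset> X" if "X \<in> \<G>" for X using that by blast
  then obtain s where s: "\<And>X. X \<in> \<G> \<Longrightarrow> s X \<in> \<G> \<and> s X \<subset> X" by metis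
  obtain X0 where X0: "X0 \<in> \<G>" using G by blast
  let ?K = "\<lambda>i. (s ^^ i) X0"
  have K: "?K i \<in> \<G>" for i by (induction i) (use X0 s in auto)
  have "?K i \<in> \<F> \<and> ?K (Suc i) \<subseteq> ?K i" for i using K[of i] s[OF K[of i]] G(1) by auto
  then obtain n where "\<forall>i\<ge>n. ?K i = ?K n" using dcc[of ?K] by blast
  then have "?K (Suc n) = ?K n" using le_SucI[OF order_refl] by blast
  then show False using s[OF K[of n]] by simp
qed

lemma stabilizes_if_minimum_condition:
  fixes K :: "nat \<Rightarrow> 'a set"
  assumes "minimum_condition \<F>" "\<And>i. K i \<in> \<F>" "\<And>i. K (Suc i) \<subseteq> K i"
  shows "\<exists>n. \<forall>i\<ge>n. K i = K n"
proof -
  have anti: "K j \<subseteq> K i" if "i \<le> j" for i j using lift_Suc_antimono_le[of K, OF assms(3) that] .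
  have "range K \<subseteq> \<F>" using assms(2) by auto
  then obtain X where X: "X \<in> range K" "\<forall>Y\<in>range K. Y \<subseteq> X \<longrightarrow> Y = X"
    using minimum_conditionD[OF assms(1), of "range K" "K 0"] by auto
  then obtain n where "X = K n" by blast
  then have "K i = K n" if "n \<le> i" for i using X(2) anti[OF that] \<open>X = K n\<close> by simp
  then show ?thesis by blast
qed

lemma minimum_condition_if_rank:
  fixes \<l> :: "'a set \<Rightarrow> nat"
  assumes "\<And>X Y. X \<in> \<F> \<Longrightarrow> Y \<in> \<F> \<Longrightarrow> X \<subset> Y \<Longrightarrow> \<l> X < \<l> Y"
  shows "minimum_condition \<F>"
  unfolding minimum_condition_def
proof (intro allI impI)
  fix \<G> assume G: "\<G> \<subseteq> \<F>" "\<G> \<noteq> {}"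
  then obtain X where X: "X \<in> \<G>" "\<And>Y. Y \<in> \<G> \<Longrightarrow> \<l> X \<le> \<l> Y"
    using ex_has_least_nat[of "\<lambda>X. X \<in> \<G>" _ \<l>] by blast
  then show "\<exists>X\<in>\<G>. \<forall>Y\<in>\<G>. Y \<subseteq> X \<longrightarrow> Y = X"
    using assms G(1) by (meson leD psubsetI subsetD)
qed

section \<open>Groups with operators\<close>

text \<open>One theory of stable subgroups serves three lattices: the subcomodules of M (operators
  \<open>act f\<close>), the right A-submodules of M and the right ideals of A (operators the right
  multiplications). The operators form a bare set of additive maps, so the lattice arguments need no
  ring behind them.\<close>

locale operator_group = abelian_group G for G :: "('g, 'z) ring_scheme" (structure) +
  fixes \<Omega> :: "('g \<Rightarrow> 'g) set"
  assumes op_closed: "\<omega> \<in> \<Omega> \<Longrightarrow> x \<in> carrier G \<Longrightarrow> \<omega> x \<in> carrier G"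
    and op_add: "\<omega> \<in> \<Omega> \<Longrightarrow> x \<in> carrier G \<Longrightarrow> y \<in> carrier G \<Longrightarrow> \<omega> (x \<oplus> y) = \<omega> x \<oplus> \<omega> y"
begin

definition stable :: "'g set \<Rightarrow> bool" where
  "stable X \<longleftrightarrow> subgroup X (add_monoid G) \<and> (\<forall>\<omega>\<in>\<Omega>. \<forall>x\<in>X. \<omega> x \<in> X)"

lemma stableI:
  assumes "X \<subseteq> carrier G" "\<zero> \<in> X" "\<And>x y. x \<in> X \<Longrightarrow> y \<in> X \<Longrightarrow> x \<ominus> y \<in> X"
    and "\<And>\<omega> x. \<omega> \<in> \<Omega> \<Longrightarrow> x \<in> X \<Longrightarrow> \<omega> x \<in> X"
  shows "stable X"
proof -
  have inv: "\<ominus> x \<in> X" if "x \<in> X" for x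
    using assms(3)[OF assms(2) that] that assms(1) by (auto simp: a_minus_def)
  have "x \<oplus> y \<in> X" if "x \<in> X" "y \<in> X" for x y
    using assms(3)[OF that(1) inv[OF that(2)]] that assms(1) by (auto simp: a_minus_def)
  then show ?thesis using assms inv unfolding stable_def
    by (auto intro!: add.subgroupI simp flip: a_inv_def)
qed

lemma
  assumes "stable X"
  shows stable_subset: "X \<subseteq> carrier G"
    and stable_carrier: "x \<in> X \<Longrightarrow> x \<in> carrier G"
    and stable_zero: "\<zero> \<in> X"
    and stable_add: "x \<in> X \<Longrightarrow> y \<in> X \<Longrightarrow> x \<oplus> y \<in> X"
    and stable_inv: "x \<in> X \<Longrightarrow> \<ominus> x \<in> X"
    and stable_minus: "x \<in> X \<Longrightarrow> y \<in> X \<Longrightarrow> x \<ominus> y \<in> X"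
    and stable_op: "\<omega> \<in> \<Omega> \<Longrightarrow> x \<in> X \<Longrightarrow> \<omega> x \<in> X"
proof -
  interpret X: subgroup X "add_monoid G" using assms by (simp add: stable_def)
  show "X \<subseteq> carrier G" "x \<in> X \<Longrightarrow> x \<in> carrier G" "\<zero> \<in> X"
    "x \<in> X \<Longrightarrow> y \<in> X \<Longrightarrow> x \<oplus> y \<in> X" "x \<in> X \<Longrightarrow> \<ominus> x \<in> X" "x \<in> X \<Longrightarrow> y \<in> X \<Longrightarrow> x \<ominus> y \<in> X"
    using X.subset X.one_closed X.m_closed X.m_inv_closed
    by (auto simp: a_minus_def a_inv_def)
  show "\<omega> \<in> \<Omega> \<Longrightarrow> x \<in> X \<Longrightarrow> \<omega> x \<in> X" using assms by (simp add: stable_def)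
qed

lemma op_zero: "\<omega> \<in> \<Omega> \<Longrightarrow> \<omega> \<zero> = \<zero>"
  using op_add[of \<omega> \<zero> \<zero>] op_closed[of \<omega> \<zero>] by (simp add: add.l_cancel_one')

lemma op_inv: "\<omega> \<in> \<Omega> \<Longrightarrow> x \<in> carrier G \<Longrightarrow> \<omega> (\<ominus> x) = \<ominus> \<omega> x"
  using op_add[of \<omega> "\<ominus> x" x] op_closed[of \<omega> x] op_closed[of \<omega> "\<ominus> x"] op_zero[of \<omega>]
  by (simp add: l_neg) (metis a_inv_closed minus_equality)

lemma op_minus:
  "\<omega> \<in> \<Omega> \<Longrightarrow> x \<in> carrier G \<Longrightarrow> y \<in> carrier G \<Longrightarrow> \<omega> (x \<ominus> y) = \<omega> x \<ominus> \<omega> y"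
  by (simp add: a_minus_def op_add op_inv)

lemma stable_carrierI: "stable (carrier G)"
  by (rule stableI) (auto intro: op_closed)

lemma stable_zeroI: "stable {\<zero>}"
  by (rule stableI) (auto simp: op_zero a_minus_def)

lemma stable_Inter:
  assumes "\<And>X. X \<in> \<F> \<Longrightarrow> stable X" "\<F> \<noteq> {}"
  shows "stable (\<Inter>\<F>)"
proof (rule stableI)
  show "\<Inter>\<F> \<subseteq> carrier G" using assms stable_subset by blast
qed (use assms in \<open>auto intro: stable_zero stable_minus stable_op\<close>)

lemma stable_Int: "stable X \<Longrightarrow> stable Y \<Longrightarrow> stable (X \<inter> Y)"
  using stable_Inter[of "{X, Y}"] by auto

lemma stable_Union_chain:
  assumes "\<And>X. X \<in> \<C> \<Longrightarrow> stable X" "\<C> \<noteq> {}" "\<And>X Y. X \<in> \<C> \<Longrightarrow> Y \<in> \<C> \<Longrightarrow> X \<subseteq> Y \<or> Y \<subseteq> X"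
  shows "stable (\<Union>\<C>)"
proof (rule stableI)
  show "\<Union>\<C> \<subseteq> carrier G" using assms(1) stable_subset by blast
  show "\<zero> \<in> \<Union>\<C>" using assms stable_zero by blast
  fix x y assume "x \<in> \<Union>\<C>" "y \<in> \<Union>\<C>"
  then obtain X Y where XY: "X \<in> \<C>" "Y \<in> \<C>" "x \<in> X" "y \<in> Y" by blast
  then obtain Z where "Z \<in> \<C>" "x \<in> Z" "y \<in> Z" using assms(3)[OF XY(1,2)] by blast
  then show "x \<ominus> y \<in> \<Union>\<C>" using assms(1) stable_minus by blast
qed (use assms(1) stable_op in blast)

lemma minus_zero: "x \<in> carrier G \<Longrightarrow> x \<ominus> \<zero> = x"
  by (simp add: a_minus_def add.inv_one[folded a_inv_def])

lemma minus_self: "x \<in> carrier G \<Longrightarrow> x \<ominus> x = \<zero>"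
  by (simp add: a_minus_def r_neg)

lemma minus_eq_zeroD: "x \<in> carrier G \<Longrightarrow> y \<in> carrier G \<Longrightarrow> x \<ominus> y = \<zero> \<Longrightarrow> x = y"
  by (metis a_inv_closed a_minus_def minus_equality minus_minus)

lemma minus_add_minus:
  assumes "a \<in> carrier G" "b \<in> carrier G" "c \<in> carrier G" "d \<in> carrier G"
  shows "(a \<oplus> b) \<ominus> (c \<oplus> d) = (a \<ominus> c) \<oplus> (b \<ominus> d)"
  using assms by (simp add: a_minus_def minus_add a_assoc a_lcomm[of b "\<ominus> c" "\<ominus> d"])

lemma set_addE:
  assumes "p \<in> X <+> Y" obtains x y where "x \<in> X" "y \<in> Y" "p = x \<oplus> y"
  using assms unfolding set_add_def' by auto

lemma set_addI: "x \<in> X \<Longrightarrow> y \<in> Y \<Longrightarrow> x \<oplus> y \<in> X <+> Y"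
  unfolding set_add_def' by blast

lemma stable_set_add:
  assumes "stable X" "stable Y" shows "stable (X <+> Y)"
proof (rule stableI)
  note sub = stable_subset[OF assms(1)] stable_subset[OF assms(2)]
  show "X <+> Y \<subseteq> carrier G" using sub by (auto elim!: set_addE)
  show "\<zero> \<in> X <+> Y"
    using set_addI[OF stable_zero[OF assms(1)] stable_zero[OF assms(2)]] by simp
  fix p q assume "p \<in> X <+> Y" "q \<in> X <+> Y"
  then obtain x y x' y' where *: "x \<in> X" "y \<in> Y" "x' \<in> X" "y' \<in> Y" "p = x \<oplus> y" "q = x' \<oplus> y'"
    by (auto elim!: set_addE)
  then have "p \<ominus> q = (x \<ominus> x') \<oplus> (y \<ominus> y')"
    using stable_carrier[OF assms(1)] stable_carrier[OF assms(2)] by (simp add: minus_add_minus)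
  then show "p \<ominus> q \<in> X <+> Y"
    using set_addI[OF stable_minus[OF assms(1) *(1,3)] stable_minus[OF assms(2) *(2,4)]] by simp
next
  fix \<omega> p assume w: "\<omega> \<in> \<Omega>" "p \<in> X <+> Y"
  then obtain x y where *: "x \<in> X" "y \<in> Y" "p = x \<oplus> y" by (auto elim!: set_addE)
  then have "\<omega> p = \<omega> x \<oplus> \<omega> y"
    using w(1) stable_carrier[OF assms(1)] stable_carrier[OF assms(2)] by (simp add: op_add)
  then show "\<omega> p \<in> X <+> Y"
    using set_addI[OF stable_op[OF assms(1) w(1) *(1)] stable_op[OF assms(2) w(1) *(2)]] by simp
qed

lemma subset_set_add:
  assumes "stable X" "stable Y" shows "X \<subseteq> X <+> Y" "Y \<subseteq> X <+> Y"
proof -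
  show "X \<subseteq> X <+> Y"
  proof
    fix x assume "x \<in> X"
    moreover from this have "x = x \<oplus> \<zero>" using stable_carrier[OF assms(1)] by simp
    ultimately show "x \<in> X <+> Y" using set_addI[OF _ stable_zero[OF assms(2)]] by metis
  qed
  show "Y \<subseteq> X <+> Y"
  proof
    fix y assume "y \<in> Y"
    moreover from this have "y = \<zero> \<oplus> y" using stable_carrier[OF assms(2)] by simp
    ultimately show "y \<in> X <+> Y" using set_addI[OF stable_zero[OF assms(1)]] by metis
  qed
qed

lemma set_add_subset:
  assumes "stable Z" "X \<subseteq> Z" "Y \<subseteq> Z" shows "X <+> Y \<subseteq> Z"
  using assms stable_add[OF assms(1)] unfolding set_add_def' by auto

definition hull :: "'g set \<Rightarrow> 'g set" where
  "hull S = \<Inter>{X. stable X \<and> S \<subseteq> X}"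

lemma stable_hull: "S \<subseteq> carrier G \<Longrightarrow> stable (hull S)"
  unfolding hull_def by (rule stable_Inter) (use stable_carrierI in auto)

lemma subset_hull: "S \<subseteq> hull S"
  unfolding hull_def by blast

lemma hull_subset: "stable X \<Longrightarrow> S \<subseteq> X \<Longrightarrow> hull S \<subseteq> X"
  unfolding hull_def by blast

definition essential :: "'g set \<Rightarrow> bool" where
  "essential W \<longleftrightarrow> stable W \<and> (\<forall>X. stable X \<and> X \<noteq> {\<zero>} \<longrightarrow> X \<inter> W \<noteq> {\<zero>})"

lemma essential_meets:
  assumes "essential W" "stable X" "X \<noteq> {\<zero>}"
  obtains x where "x \<in> X" "x \<in> W" "x \<noteq> \<zero>"
proof -
  have "X \<inter> W \<noteq> {\<zero>}" "\<zero> \<in> X \<inter> W" using assms stable_zero unfolding essential_def by auto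
  then show thesis using that by blast
qed

lemma essential_carrier: "essential (carrier G)"
  unfolding essential_def using stable_carrierI stable_subset by (simp add: Int_absorb2)

end

section \<open>Endomorphisms of groups with operators\<close>

text \<open>E abstracts the ring of colinear endomorphisms. Its members are plain functions,
  unconstrained outside the carrier, so equations between them are stated pointwise on the carrier.
  Closure under differences supplies 1 - b g in the argument of Hopkins.\<close>

locale operator_group_endo = operator_group +
  fixes E :: "('a \<Rightarrow> 'a) set"
  assumes endo_closed: "f \<in> E \<Longrightarrow> x \<in> carrier G \<Longrightarrow> f x \<in> carrier G"
    and endo_add: "f \<in> E \<Longrightarrow> x \<in> carrier G \<Longrightarrow> y \<in> carrier G \<Longrightarrow> f (x \<oplus> y) = f x \<oplus> f y"
    and endo_op: "f \<in> E \<Longrightarrow> \<omega> \<in> \<Omega> \<Longrightarrow> x \<in> carrier G \<Longrightarrow> f (\<omega> x) = \<omega> (f x)"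
    and endo_id: "(\<lambda>x. x) \<in> E"
    and endo_comp: "f \<in> E \<Longrightarrow> g \<in> E \<Longrightarrow> f \<circ> g \<in> E"
    and endo_diff: "f \<in> E \<Longrightarrow> g \<in> E \<Longrightarrow> (\<lambda>x. f x \<ominus> g x) \<in> E"
begin

lemma endo_zero: "f \<in> E \<Longrightarrow> f \<zero> = \<zero>"
  using endo_add[of f \<zero> \<zero>] endo_closed[of f \<zero>] by (simp add: add.l_cancel_one')

lemma endo_inv: "f \<in> E \<Longrightarrow> x \<in> carrier G \<Longrightarrow> f (\<ominus> x) = \<ominus> f x"
  using endo_add[of f "\<ominus> x" x] endo_closed[of f x] endo_closed[of f "\<ominus> x"] endo_zero[of f]
  by (simp add: l_neg) (metis a_inv_closed minus_equality)

lemma endo_minus: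
  "f \<in> E \<Longrightarrow> x \<in> carrier G \<Longrightarrow> y \<in> carrier G \<Longrightarrow> f (x \<ominus> y) = f x \<ominus> f y"
  by (simp add: a_minus_def endo_add endo_inv)

definition fully_inv :: "'a set \<Rightarrow> bool" where
  "fully_inv X \<longleftrightarrow> (\<forall>f\<in>E. \<forall>x\<in>X. f x \<in> X)"

lemma stable_preimage:
  assumes "f \<in> E" "stable W" shows "stable {x \<in> carrier G. f x \<in> W}"
  by (rule stableI)
    (use assms in \<open>auto simp: endo_zero endo_minus endo_op op_closed
       intro: stable_zero stable_minus stable_op\<close>)

lemma stable_ker: "f \<in> E \<Longrightarrow> stable {x \<in> carrier G. f x = \<zero>}"
  using stable_preimage[OF _ stable_zeroI, of f] by simp

lemma stable_image:
  assumes "f \<in> E" "stable W" shows "stable (f ` W)"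
proof (rule stableI)
  note W = stable_carrier[OF assms(2)]
  show "f ` W \<subseteq> carrier G" using W endo_closed[OF assms(1)] by blast
  show "\<zero> \<in> f ` W" using stable_zero[OF assms(2)] endo_zero[OF assms(1)] by force
  show "x \<ominus> y \<in> f ` W" if xy: "x \<in> f ` W" "y \<in> f ` W" for x y
  proof -
    obtain u v where uv: "u \<in> W" "v \<in> W" "x = f u" "y = f v" using xy by auto
    then have "x \<ominus> y = f (u \<ominus> v)" using W by (simp add: endo_minus[OF assms(1)])
    then show ?thesis using stable_minus[OF assms(2) uv(1,2)] by simp
  qed
  show "\<omega> x \<in> f ` W" if wx: "\<omega> \<in> \<Omega>" "x \<in> f ` W" for \<omega> x
  proof -
    obtain u where u: "u \<in> W" "x = f u" using wx(2) by auto
    then have "\<omega> x = f (\<omega> u)" using W wx(1) by (simp add: endo_op[OF assms(1)])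
    then show ?thesis using stable_op[OF assms(2) wx(1) u(1)] by simp
  qed
qed

text \<open>A nonzero X is either killed by f, and then lies in the preimage, or has a nonzero
  image, which meets W. This is the source of the full invariance of the socle.\<close>

lemma essential_preimage:
  assumes f: "f \<in> E" and W: "essential W"
  shows "essential {x \<in> carrier G. f x \<in> W}"
  unfolding essential_def
proof (intro conjI allI impI)
  have sW: "stable W" using W by (simp add: essential_def)
  show "stable {x \<in> carrier G. f x \<in> W}" by (rule stable_preimage[OF f sW])
  fix X assume X: "stable X \<and> X \<noteq> {\<zero>}"
  then have Xc: "X \<subseteq> carrier G" "\<zero> \<in> X" using stable_subset stable_zero by auto
  show "X \<inter> {x \<in> carrier G. f x \<in> W} \<noteq> {\<zero>}"
  proof (cases "f ` X = {\<zero>}")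
    case True
    then have "f x = \<zero>" if "x \<in> X" for x using that by auto
    then have "X \<subseteq> {x \<in> carrier G. f x \<in> W}" using Xc stable_zero[OF sW] by auto
    then show ?thesis using X by blast
  next
    case False
    obtain y where y: "y \<in> f ` X" "y \<in> W" "y \<noteq> \<zero>"
      using essential_meets[OF W stable_image[OF f, of X] False] X by blast
    then obtain x where x: "x \<in> X" "f x \<in> W" "f x \<noteq> \<zero>" by auto
    then have "x \<noteq> \<zero>" using endo_zero[OF f] by auto
    moreover have "x \<in> X \<inter> {x \<in> carrier G. f x \<in> W}" using x Xc by auto
    ultimately show ?thesis by auto
  qed
qed

text \<open>This is the socle, obtained without reference to simple subgroups.\<close>

lemma least_essential:
  assumes "minimum_condition {X. stable X}"
  shows "\<exists>S. essential S \<and> (\<forall>W. essential W \<longrightarrow> S \<subseteq> W) \<and> fully_inv S"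
proof -
  have "{W. essential W} \<subseteq> {X. stable X}" by (auto simp: essential_def)
  then obtain S where S: "essential S" "\<And>Y. essential Y \<Longrightarrow> Y \<subseteq> S \<Longrightarrow> Y = S"
    using minimum_conditionD[OF assms, of "{W. essential W}" "carrier G"] essential_carrier by auto
  \<comment> \<open>Essential subgroups are closed under intersection, so a minimal one is
    least.\<close>
  have least: "S \<subseteq> W" if W: "essential W" for W
  proof -
    have "essential (W \<inter> S)"
      unfolding essential_def
    proof (intro conjI allI impI)
      show "stable (W \<inter> S)" using W S(1) by (simp add: essential_def stable_Int)
      fix X assume X: "stable X \<and> X \<noteq> {\<zero>}"
      then have "stable (X \<inter> W)" "X \<inter> W \<noteq> {\<zero>}"
        using W by (auto simp: essential_def stable_Int)
      then have "X \<inter> W \<inter> S \<noteq> {\<zero>}" using S(1) by (simp add: essential_def)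
      then show "X \<inter> (W \<inter> S) \<noteq> {\<zero>}" by (simp add: Int_assoc)
    qed
    then show ?thesis using S(2)[of "W \<inter> S"] by blast
  qed
  \<comment> \<open>S is contained in its own preimage under f, since that preimage is
    essential.\<close>
  moreover have "fully_inv S"
    unfolding fully_inv_def
  proof (intro ballI)
    fix f x assume "f \<in> E" "x \<in> S"
    then show "f x \<in> S" using least[OF essential_preimage[of f S]] S(1) by auto
  qed
  ultimately show ?thesis using S(1) by auto
qed

text \<open>Products of n factors from J, without the sums that belong to the ideal power J^n; that
  power vanishes as soon as all these products do.\<close>

primrec comp_power :: "('a \<Rightarrow> 'a) set \<Rightarrow> nat \<Rightarrow> ('a \<Rightarrow> 'a) set" where
  "comp_power J 0 = {\<lambda>x. x}"
| "comp_power J (Suc n) = {f \<circ> g | f g. f \<in> J \<and> g \<in> comp_power J n}"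

lemma comp_power_endo: "J \<subseteq> E \<Longrightarrow> b \<in> comp_power J n \<Longrightarrow> b \<in> E"
  by (induction n arbitrary: b) (auto intro: endo_id endo_comp)

lemma comp_power_add:
  "c \<in> comp_power J (m + n) \<Longrightarrow> \<exists>a\<in>comp_power J m. \<exists>b\<in>comp_power J n. c = a \<circ> b"
proof (induction m arbitrary: c)
  case 0
  then show ?case by (auto simp: comp_def)
next
  case (Suc m)
  then obtain f g where "c = f \<circ> g" "f \<in> J" "g \<in> comp_power J (m + n)" by auto
  moreover from this Suc.IH obtain a b where "a \<in> comp_power J m" "b \<in> comp_power J n" "g = a \<circ> b"
    by blast
  ultimately have "f \<circ> a \<in> comp_power J (Suc m)" "c = (f \<circ> a) \<circ> b" "b \<in> comp_power J n"
    by (auto simp: comp_assoc)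
  then show ?case by blast
qed

lemma comp_power_snoc: "b \<in> comp_power J n \<Longrightarrow> f \<in> J \<Longrightarrow> b \<circ> f \<in> comp_power J (Suc n)"
proof (induction n arbitrary: b)
  case 0
  then have "b \<circ> f = f \<circ> (\<lambda>x. x)" by (simp add: comp_def)
  moreover have "(\<lambda>x. x) \<in> comp_power J 0" by simp
  ultimately show ?case using 0(2) unfolding comp_power.simps(2) by blast
next
  case (Suc n)
  then obtain j g where "b = j \<circ> g" "j \<in> J" "g \<in> comp_power J n" by auto
  moreover from this Suc have "g \<circ> f \<in> comp_power J (Suc n)" by blast
  ultimately have "b \<circ> f = j \<circ> (g \<circ> f)" "j \<in> J" "g \<circ> f \<in> comp_power J (Suc n)"
    by (simp_all only: comp_assoc)
  then show ?case unfolding comp_power.simps(2)[of J "Suc n"] by blast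
qed

definition null :: "('a \<Rightarrow> 'a) set \<Rightarrow> bool" where
  "null F \<longleftrightarrow> (\<forall>f\<in>F. \<forall>x\<in>carrier G. f x = \<zero>)"

definition annihilator :: "'a set \<Rightarrow> ('a \<Rightarrow> 'a) set" where
  "annihilator X = {f \<in> E. \<forall>x\<in>X. f x = \<zero>}"

lemma annihilator_endo: "annihilator X \<subseteq> E"
  by (auto simp: annihilator_def)

text \<open>Each further factor from \<open>J\<close> kills a nonzero element of the image of the preceding ones, since
  that image meets \<open>S\<close>; so the kernels increase strictly.\<close>

lemma annihilator_nilpotent_if_bounded:
  fixes \<l> :: "'a set \<Rightarrow> nat"
  assumes S: "essential S"
    and mono: "\<And>X Y. stable X \<Longrightarrow> stable Y \<Longrightarrow> X \<subset> Y \<Longrightarrow> \<l> X < \<l> Y"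
    and bound: "\<And>X. stable X \<Longrightarrow> \<l> X \<le> n"
  shows "null (comp_power (annihilator S) (Suc n))"
proof -
  let ?J = "annihilator S" and ?ker = "\<lambda>f. {x \<in> carrier G. f x = \<zero>}"
  note JE = comp_power_endo[OF annihilator_endo]
  \<comment> \<open>A nonvanishing product of k factors has a kernel of rank at least k. Ranks are
    at most n, which excludes k = \<open>Suc n\<close>.\<close>
  have "(\<forall>x\<in>carrier G. g x = \<zero>) \<or> k \<le> \<l> (?ker g)" if "g \<in> comp_power ?J k" for g k
    using that
  proof (induction k arbitrary: g)
    case (Suc k)
    then obtain j h where jh: "g = j \<circ> h" "j \<in> ?J" "h \<in> comp_power ?J k"
      unfolding comp_power.simps(2) by blast
    have E: "j \<in> E" "h \<in> E" "g \<in> E"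
      using subsetD[OF annihilator_endo jh(2)] JE[OF jh(3)] JE[OF Suc.prems] .
    show ?case
    proof (cases "\<forall>x\<in>carrier G. h x = \<zero>")
      case True
      then show ?thesis using jh(1) endo_zero[OF E(1)] by simp
    next
      case False
      have "stable (h ` carrier G)" by (rule stable_image[OF E(2) stable_carrierI])
      moreover have "h ` carrier G \<noteq> {\<zero>}" using False by auto
      ultimately obtain y where y: "y \<in> h ` carrier G" "y \<in> S" "y \<noteq> \<zero>"
        using essential_meets[OF S] by blast
      then obtain x where "x \<in> carrier G" "h x \<in> S" "h x \<noteq> \<zero>" by auto
      then have "x \<in> ?ker g" "x \<notin> ?ker h" using jh(1,2) by (simp_all add: annihilator_def)
      moreover have "?ker h \<subseteq> ?ker g" using jh(1) endo_zero[OF E(1)] by auto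
      ultimately have "?ker h \<subset> ?ker g" by blast
      then have "\<l> (?ker h) < \<l> (?ker g)"
        by (intro mono stable_ker E)
      then show ?thesis using Suc.IH[OF jh(3)] False by linarith
    qed
  qed simp
  then have "(\<forall>x\<in>carrier G. g x = \<zero>) \<or> Suc n \<le> \<l> (?ker g)" if "g \<in> comp_power ?J (Suc n)" for g
    using that by blast
  moreover have "\<l> (?ker g) \<le> n" if "g \<in> comp_power ?J (Suc n)" for g
    by (rule bound[OF stable_ker[OF JE[OF that]]])
  ultimately show ?thesis unfolding null_def using not_less_eq_eq by blast
qed

text \<open>The argument of Hopkins: if the powers of \<open>J\<close> do not vanish, a minimal image \<open>f(G)\<close> not killed
  by the stable power yields \<open>f = f \<circ> b \<circ> g\<close> with \<open>1 - b \<circ> g\<close> bijective.\<close>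

lemma annihilator_nilpotent_if_projective:
  assumes S: "essential S" "fully_inv S"
    and min: "minimum_condition {X. stable X}"
    and proj: "\<And>f b. f \<in> E \<Longrightarrow> b \<in> E \<Longrightarrow> f ` carrier G \<subseteq> b ` carrier G \<Longrightarrow>
      \<exists>g\<in>E. \<forall>x\<in>carrier G. f x = b (g x)"
  obtains n where "null (comp_power (annihilator S) n)"
proof -
  let ?J = "annihilator S"
  \<comment> \<open>\<open>P n\<close> is J^n G: the hull restores the sums that
    \<open>comp_power\<close> omits.\<close>
  define P where "P n = hull (\<Union>b\<in>comp_power ?J n. b ` carrier G)" for n
  note JE = comp_power_endo[OF annihilator_endo]
  have im: "(\<Union>b\<in>comp_power ?J n. b ` carrier G) \<subseteq> carrier G" for n
    by (rule UN_least) (use JE endo_closed in auto)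
  have sP: "stable (P n)" for n unfolding P_def by (rule stable_hull[OF im])
  have imP: "b x \<in> P n" if "b \<in> comp_power ?J n" "x \<in> carrier G" for b n x
    unfolding P_def by (rule subsetD[OF subset_hull]) (use that in auto)
  have "P (Suc n) \<subseteq> P n" for n
    unfolding P_def[of "Suc n"]
  proof (rule hull_subset[OF sP], clarify)
    fix b x assume b: "b \<in> comp_power ?J (Suc n)" and x: "x \<in> carrier G"
    then obtain c f where cf: "b = c \<circ> f" "c \<in> comp_power ?J n" "f \<in> comp_power ?J 1"
      using comp_power_add[of b ?J n 1] by (auto simp del: comp_power.simps)
    show "b x \<in> P n" using imP[OF cf(2) endo_closed[OF JE[OF cf(3)] x]] by (simp add: cf(1))
  qed
  then obtain n0 where n0: "\<And>i. n0 \<le> i \<Longrightarrow> P i = P n0"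
    using stabilizes_if_minimum_condition[OF min, of P] sP by auto
  \<comment> \<open>The stable exponent is taken positive so that each product of n factors has a
    rightmost factor in J.\<close>
  define n where "n = Suc n0"
  have PP: "P (n + n) = P n" using n0[of "n + n"] n0[of n] by (simp add: n_def)
  have "P n = {\<zero>}"
  proof (rule ccontr)
    assume P0: "P n \<noteq> {\<zero>}"
    let ?\<G> = "{f ` carrier G | f. f \<in> E \<and> \<not> f ` P n \<subseteq> {\<zero>}}"
    have "\<not> (\<lambda>x. x) ` P n \<subseteq> {\<zero>}" using P0 stable_zero[OF sP] by auto
    then have ne: "(\<lambda>x. x) ` carrier G \<in> ?\<G>" using endo_id by blast
    have "?\<G> \<subseteq> {X. stable X}" using stable_image[OF _ stable_carrierI] by auto
    from minimum_conditionD[OF min this ne]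
    obtain X where X: "X \<in> ?\<G>" "\<forall>Y\<in>?\<G>. Y \<subseteq> X \<longrightarrow> Y = X" by (elim bexE)
    from X(1) obtain f where f: "X = f ` carrier G" "f \<in> E" "\<not> f ` P n \<subseteq> {\<zero>}" by auto
    \<comment> \<open>Since J^(2n) G = J^n G, some b (b' x) with b and b' in J^n is not killed by f.
      So f b does not kill J^n G, minimality gives f b G = f G, and projectivity divides f by f
      b.\<close>
    have "\<exists>c\<in>comp_power ?J (n + n). \<exists>x\<in>carrier G. f (c x) \<noteq> \<zero>"
    proof (rule ccontr)
      assume "\<not> ?thesis"
      then have "P (n + n) \<subseteq> {x \<in> carrier G. f x = \<zero>}"
        unfolding P_def by (intro hull_subset stable_ker f) (auto intro: endo_closed JE)
      then have "P n \<subseteq> {x \<in> carrier G. f x = \<zero>}" by (simp only: PP)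
      then show False using f(3) by auto
    qed
    then obtain c x where c: "c \<in> comp_power ?J (n + n)" "x \<in> carrier G" "f (c x) \<noteq> \<zero>" by blast
    then obtain b b' where b: "b \<in> comp_power ?J n" "b' \<in> comp_power ?J n" "c = b \<circ> b'"
      using comp_power_add[OF c(1)] by auto
    have fb: "f \<circ> b \<in> E" using f(2) JE[OF b(1)] by (rule endo_comp)
    have "(f \<circ> b) (b' x) \<noteq> \<zero>" using c(3) by (simp add: b(3))
    then have "\<not> (f \<circ> b) ` P n \<subseteq> {\<zero>}" using imP[OF b(2) c(2)] by blast
    then have "(f \<circ> b) ` carrier G \<in> ?\<G>" using fb by blast
    moreover have "(f \<circ> b) ` carrier G \<subseteq> X" using f(1) JE[OF b(1)] endo_closed by auto
    ultimately have "(f \<circ> b) ` carrier G = X" by (rule X(2)[rule_format])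
    then obtain g where g: "g \<in> E" "\<And>x. x \<in> carrier G \<Longrightarrow> f x = f (b (g x))"
      using proj[OF f(2) fb] f(1) by auto
    define u where "u = (\<lambda>x. x \<ominus> (b \<circ> g) x)"
    have bg: "b \<circ> g \<in> E" using JE[OF b(1)] g(1) by (rule endo_comp)
    have u: "u \<in> E" unfolding u_def by (rule endo_diff[OF endo_id bg])
    obtain a j where j: "b = a \<circ> j" "j \<in> ?J" "a \<in> E"
    proof -
      obtain a f where af: "b = a \<circ> f" "a \<in> comp_power ?J n0" "f \<in> comp_power ?J 1"
        using comp_power_add[of b ?J n0 1] b(1) by (auto simp: n_def simp del: comp_power.simps)
      then obtain j where "j \<in> ?J" "f = j" by (auto simp: comp_def)
      then show thesis using that[of a j] af JE[OF af(2)] by simp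
    qed
    \<comment> \<open>On S the map u is the identity, because g maps S into S and the factor j of b
      kills S. So the kernel of u meets the essential S only in zero.\<close>
    have inj0: "x = \<zero>" if "x \<in> carrier G" "u x = \<zero>" for x
    proof (rule ccontr)
      assume "x \<noteq> \<zero>"
      then have "{x \<in> carrier G. u x = \<zero>} \<noteq> {\<zero>}" using that by blast
      from essential_meets[OF S(1) stable_ker[OF u] this]
      obtain s where s: "s \<in> carrier G" "u s = \<zero>" "s \<in> S" "s \<noteq> \<zero>" by auto
      have "b (g s) = \<zero>"
        using j s(3) S(2) g(1) endo_zero[OF j(3)] by (auto simp: fully_inv_def annihilator_def)
      then show False using s by (simp add: u_def minus_zero)
    qed
    have inj: "x = y" if "x \<in> carrier G" "y \<in> carrier G" "u x = u y" for x y
    proof -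
      have "u (x \<ominus> y) = \<zero>"
        using that endo_closed[OF u] by (simp add: endo_minus[OF u] minus_self)
      then have "x \<ominus> y = \<zero>" using inj0 that by simp
      then show ?thesis using that minus_eq_zeroD by simp
    qed
    have pow: "u ^^ i \<in> E" for i
    proof (induction i)
      case 0
      show ?case using endo_id by (simp add: id_def)
    next
      case (Suc i)
      show ?case unfolding funpow.simps(2) by (rule endo_comp[OF u Suc.IH])
    qed
    \<comment> \<open>An injective endomorphism is onto under the minimum condition: once u^(i+1) G
      = u^i G, the injective u^i can be cancelled.\<close>
    have "(u ^^ Suc i) ` carrier G \<subseteq> (u ^^ i) ` carrier G" for i
      using endo_closed[OF u] by (auto simp: funpow_Suc_right simp del: funpow.simps)
    then obtain i where "\<forall>k\<ge>i. (u ^^ k) ` carrier G = (u ^^ i) ` carrier G"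
      using stabilizes_if_minimum_condition[OF min, of "\<lambda>i. (u ^^ i) ` carrier G"]
        stable_image[OF pow stable_carrierI] by auto
    then have i: "(u ^^ Suc i) ` carrier G = (u ^^ i) ` carrier G" using le_SucI[OF order_refl] by blast
    have injpow: "x = y" if "x \<in> carrier G" "y \<in> carrier G" "(u ^^ i) x = (u ^^ i) y" for x y i
      using that by (induction i) (use inj endo_closed[OF pow] in auto)
    have surj: "\<exists>y\<in>carrier G. x = u y" if x: "x \<in> carrier G" for x
    proof -
      have "(u ^^ i) x \<in> (u ^^ Suc i) ` carrier G" unfolding i using x by simp
      then obtain y where y: "y \<in> carrier G" "(u ^^ i) x = (u ^^ Suc i) y" by auto
      then have "(u ^^ i) x = (u ^^ i) (u y)" by (simp add: funpow_swap1)
      then show ?thesis using injpow[OF x endo_closed[OF u y(1)]] y(1) by auto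
    qed
    \<comment> \<open>f u = f - f b g = 0 and u is onto; this contradicts the choice of f.\<close>
    have "f x = \<zero>" if x: "x \<in> carrier G" for x
    proof -
      obtain y where y: "y \<in> carrier G" "x = u y" using surj[OF x] by auto
      have "f x = f y \<ominus> f (b (g y))"
        using y endo_closed[OF bg y(1)] by (simp add: u_def endo_minus[OF f(2)])
      then show ?thesis using g(2)[OF y(1)] minus_self[OF endo_closed[OF f(2) y(1)]] by simp
    qed
    then show False using f(3) stable_carrier[OF sP] by auto
  qed
  then have "null (comp_power ?J n)" unfolding null_def using imP[of _ n] by auto
  then show thesis by (rule that)
qed

end

section \<open>Coprime groups with operators\<close>

locale coprime_operator_group = operator_group_endo +
  assumes cogen: "stable W \<Longrightarrow> x \<in> carrier G \<Longrightarrow> x \<notin> W \<Longrightarrow>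
      \<exists>h\<in>E. (\<forall>w\<in>W. h w = \<zero>) \<and> h x \<noteq> \<zero>"
    and inject: "f \<in> E \<Longrightarrow> stable W \<Longrightarrow> (\<And>w. w \<in> W \<Longrightarrow> f w = \<zero> \<Longrightarrow> w = \<zero>) \<Longrightarrow>
      \<exists>k\<in>E. \<forall>w\<in>W. k (f w) = w"
    and coprime: "stable X \<Longrightarrow> fully_inv X \<Longrightarrow> stable Y \<Longrightarrow> fully_inv Y \<Longrightarrow>
      (\<And>f x. f \<in> annihilator X \<Longrightarrow> x \<in> carrier G \<Longrightarrow> f x \<in> Y) \<Longrightarrow>
      X = carrier G \<or> Y = carrier G"
begin

definition common_ker :: "('a \<Rightarrow> 'a) set \<Rightarrow> 'a set" where
  "common_ker F = {x \<in> carrier G. \<forall>f\<in>F. f x = \<zero>}"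

lemma common_kerI: "x \<in> carrier G \<Longrightarrow> (\<And>f. f \<in> F \<Longrightarrow> f x = \<zero>) \<Longrightarrow> x \<in> common_ker F"
  by (simp add: common_ker_def)

lemma common_kerD: "x \<in> common_ker F \<Longrightarrow> f \<in> F \<Longrightarrow> f x = \<zero>"
  by (simp add: common_ker_def)

lemma common_ker_carrier: "x \<in> common_ker F \<Longrightarrow> x \<in> carrier G"
  by (simp add: common_ker_def)

lemma stable_common_ker:
  assumes "F \<subseteq> E" shows "stable (common_ker F)"
proof (rule stableI)
  note FE = subsetD[OF assms]
  show "x \<ominus> y \<in> common_ker F" if "x \<in> common_ker F" "y \<in> common_ker F" for x y
    using that by (intro common_kerI)
      (auto simp: endo_minus[OF FE] minus_self common_kerD common_ker_carrier)
  show "\<omega> x \<in> common_ker F" if "\<omega> \<in> \<Omega>" "x \<in> common_ker F" for x \<omega>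
  proof (rule common_kerI)
    note x = common_ker_carrier[OF that(2)]
    show "\<omega> x \<in> carrier G" by (rule op_closed[OF that(1) x])
    show "f (\<omega> x) = \<zero>" if "f \<in> F" for f
      using endo_op[OF FE[OF that] \<open>\<omega> \<in> \<Omega>\<close> x] common_kerD[OF \<open>x \<in> common_ker F\<close> that]
      by (simp add: op_zero \<open>\<omega> \<in> \<Omega>\<close>)
  qed
qed (use assms endo_zero in \<open>auto simp: common_ker_def\<close>)

text \<open>f (e x) is the value at x of f e, again a member of F. This is why the sets F below
  consist of maps \<open>b \<circ> e\<close> with a free right factor e.\<close>

lemma fully_inv_common_ker:
  assumes "\<And>f e. f \<in> F \<Longrightarrow> e \<in> E \<Longrightarrow> f \<circ> e \<in> F"
  shows "fully_inv (common_ker F)"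
  unfolding fully_inv_def
proof (intro ballI)
  fix e x assume ex: "e \<in> E" "x \<in> common_ker F"
  show "e x \<in> common_ker F"
  proof (rule common_kerI)
    show "e x \<in> carrier G" using ex endo_closed by (simp add: common_ker_def)
    show "f (e x) = \<zero>" if "f \<in> F" for f using common_kerD[OF ex(2) assms[OF that ex(1)]] by simp
  qed
qed

lemma annihilator_comp: "fully_inv X \<Longrightarrow> e \<in> E \<Longrightarrow> f \<in> annihilator X \<Longrightarrow> e \<circ> f \<in> annihilator X"
  by (auto simp: annihilator_def endo_comp endo_zero)

text \<open>Induction on n replaces the choice of a least exponent. Let Y be the common kernel of
  all b e with b in J^n and e in E. An f in J maps G into Y, because e f is again in J and b (e f)
  is then a product of n + 1 factors. Coprimeness leaves S = G or Y = G, and the latter says that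
  the products of n factors vanish already.\<close>

lemma eq_carrier_if_nilpotent:
  assumes S: "stable S" "fully_inv S" and nil: "null (comp_power (annihilator S) n)"
  shows "S = carrier G"
  using nil
proof (induction n)
  case 0
  \<comment> \<open>J^0 holds only the identity, so its vanishing leaves G = 0.\<close>
  then have "carrier G \<subseteq> {\<zero>}" by (auto simp: null_def)
  then show ?case using S(1) stable_subset stable_zero by blast
next
  case (Suc n)
  let ?J = "annihilator S"
  let ?F = "{b \<circ> e | b e. b \<in> comp_power ?J n \<and> e \<in> E}"
  let ?Y = "common_ker ?F"
  have FE: "?F \<subseteq> E" using comp_power_endo[OF annihilator_endo] endo_comp by blast
  have "fully_inv ?Y"
    by (rule fully_inv_common_ker) (use endo_comp in \<open>auto simp: comp_assoc, blast\<close>)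
  moreover have "f x \<in> ?Y" if f: "f \<in> ?J" "x \<in> carrier G" for f x
  proof (rule common_kerI)
    show "f x \<in> carrier G" using f endo_closed by (simp add: annihilator_def)
    fix g assume "g \<in> ?F"
    then obtain b e where g: "g = b \<circ> e" "b \<in> comp_power ?J n" "e \<in> E" by blast
    have "b \<circ> (e \<circ> f) \<in> comp_power ?J (Suc n)"
      by (rule comp_power_snoc[OF g(2) annihilator_comp[OF S(2) g(3) f(1)]])
    then have "(b \<circ> (e \<circ> f)) x = \<zero>" using Suc.prems f(2) unfolding null_def by blast
    then show "g (f x) = \<zero>" by (simp add: g(1))
  qed
  ultimately consider "S = carrier G" | "?Y = carrier G"
    using coprime[OF S stable_common_ker[OF FE]] by blast
  then show ?case
  proof cases
    case 2
    have "b x = \<zero>" if "b \<in> comp_power ?J n" "x \<in> carrier G" for b x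
    proof -
      have "b \<circ> (\<lambda>x. x) \<in> ?F" using that(1) endo_id by blast
      then show ?thesis using common_kerD[of x ?F "b \<circ> (\<lambda>x. x)"] 2 that(2) by simp
    qed
    then show ?thesis using Suc.IH by (auto simp: null_def)
  qed
qed

text \<open>If W is maximal among the stable subgroups meeting N in zero, then N + W is essential: a
  nonzero X missing N + W could be added to W, as n = w + x in N forces x = n - w into X \<inter> (N
  + W) = 0.\<close>

lemma complement_if_no_essential:
  assumes no: "\<And>W. essential W \<Longrightarrow> W = carrier G" and N: "stable N"
  obtains W where "stable W" "W \<inter> N = {\<zero>}" "N <+> W = carrier G"
proof -
  let ?\<A> = "{W. stable W \<and> W \<inter> N = {\<zero>}}"
  have "\<exists>W\<in>?\<A>. \<forall>X\<in>?\<A>. W \<subseteq> X \<longrightarrow> X = W"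
  proof (rule subset_Zorn_nonempty)
    show "?\<A> \<noteq> {}" using stable_zeroI stable_zero[OF N] by blast
    fix \<C> assume C: "\<C> \<noteq> {}" "subset.chain ?\<A> \<C>"
    then have "stable (\<Union>\<C>)" by (intro stable_Union_chain) (auto simp: subset_chain_def)
    then show "\<Union>\<C> \<in> ?\<A>" using C by (auto simp: subset_chain_def)
  qed
  then obtain W where W: "stable W" "W \<inter> N = {\<zero>}"
    and max: "\<And>X. stable X \<Longrightarrow> X \<inter> N = {\<zero>} \<Longrightarrow> W \<subseteq> X \<Longrightarrow> X = W" by auto
  have "essential (N <+> W)"
    unfolding essential_def
  proof (intro conjI allI impI notI)
    show sNW: "stable (N <+> W)" by (rule stable_set_add[OF N W(1)])
    fix X assume X': "stable X \<and> X \<noteq> {\<zero>}" and 0: "X \<inter> (N <+> W) = {\<zero>}"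
    then have X: "stable X" "X \<noteq> {\<zero>}" by auto
    have sWX: "stable (W <+> X)" by (rule stable_set_add[OF W(1) X(1)])
    have "(W <+> X) \<inter> N \<subseteq> {\<zero>}"
    proof clarify
      fix n assume n: "n \<in> W <+> X" "n \<in> N"
      then obtain w x where wx: "w \<in> W" "x \<in> X" "n = w \<oplus> x" by (auto elim: set_addE)
      have c: "w \<in> carrier G" "x \<in> carrier G"
        using stable_carrier[OF W(1) wx(1)] stable_carrier[OF X(1) wx(2)] .
      have "x = \<ominus> w \<oplus> n" using wx(3) c by (simp add: r_neg1)
      also have "\<dots> = n \<oplus> \<ominus> w" using c wx(3) by (simp add: a_comm)
      also have "\<dots> \<in> N <+> W" by (rule set_addI[OF n(2) stable_inv[OF W(1) wx(1)]])
      finally have "x \<in> X \<inter> (N <+> W)" using wx(2) by simp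
      then have "x = \<zero>" by (simp add: 0)
      then have "n \<in> W \<inter> N" using wx(1,3) c(1) n(2) by simp
      then show "n = \<zero>" by (simp add: W(2))
    qed
    then have "(W <+> X) \<inter> N = {\<zero>}" using stable_zero[OF sWX] stable_zero[OF N] by auto
    then have "W <+> X = W" by (rule max[OF sWX _ subset_set_add(1)[OF W(1) X(1)]])
    then have "X \<subseteq> N <+> W"
      using subset_set_add(2)[OF W(1) X(1)] subset_set_add(2)[OF N W(1)] by simp
    then show False using 0 X(2) by (simp add: Int_absorb2)
  qed
  then have "N <+> W = carrier G" by (rule no)
  then show thesis by (rule that[OF W])
qed

lemma no_proper_fully_inv:
  assumes no: "\<And>W. essential W \<Longrightarrow> W = carrier G"
    and N: "stable N" "fully_inv N" "N \<noteq> {\<zero>}"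
  shows "N = carrier G"
proof -
  obtain W where W: "stable W" "W \<inter> N = {\<zero>}" "N <+> W = carrier G"
    by (rule complement_if_no_essential[OF no N(1)])
  \<comment> \<open>N is nonzero and meets W in zero, so there is a point outside W for
    \<open>cogen\<close> to separate.\<close>
  have "W \<noteq> carrier G" using W(2) N(3) stable_subset[OF N(1)] by (auto simp: Int_absorb1)
  then obtain x0 where x0: "x0 \<in> carrier G" "x0 \<notin> W" using stable_subset[OF W(1)] by auto
  from cogen[OF W(1) x0]
  obtain h where h: "h \<in> E" "\<And>w. w \<in> W \<Longrightarrow> h w = \<zero>" "h x0 \<noteq> \<zero>" by auto
  have hN: "h x \<in> N" if "x \<in> carrier G" for x
  proof -
    have "x \<in> N <+> W" using that W(3) by simp
    then obtain n w where nw: "n \<in> N" "w \<in> W" "x = n \<oplus> w" by (auto elim: set_addE)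
    then have "h x = h n"
      using h stable_carrier[OF N(1)] stable_carrier[OF W(1)] by (simp add: endo_add endo_closed)
    then show ?thesis using N(2) h(1) nw(1) by (simp add: fully_inv_def)
  qed
  \<comment> \<open>Suppose \<open>?\<phi>\<close> = h f is not zero. Its kernel is proper, hence
    not essential, so \<open>?\<phi>\<close> is injective on some nonzero W' and has a left inverse
    k there. But \<open>?\<phi>\<close> takes values in the fully invariant N, so W' = k (h f W')
    lies in N, and f kills N.\<close>
  have hf0: "h (f x) = \<zero>" if f: "f \<in> annihilator N" and x: "x \<in> carrier G" for f x
  proof (rule ccontr)
    assume ne: "h (f x) \<noteq> \<zero>"
    let ?\<phi> = "h \<circ> f"
    have fE: "f \<in> E" using f by (simp add: annihilator_def)
    have \<phi>: "?\<phi> \<in> E" by (rule endo_comp[OF h(1) fE])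
    have "{x \<in> carrier G. ?\<phi> x = \<zero>} \<noteq> carrier G" using ne x by auto
    then have "\<not> essential {x \<in> carrier G. ?\<phi> x = \<zero>}" using no by metis
    then obtain W' where W': "stable W'" "W' \<noteq> {\<zero>}" "W' \<inter> {x \<in> carrier G. ?\<phi> x = \<zero>} = {\<zero>}"
      using stable_ker[OF \<phi>] unfolding essential_def by auto
    have "w = \<zero>" if "w \<in> W'" "?\<phi> w = \<zero>" for w
    proof -
      have "w \<in> W' \<inter> {x \<in> carrier G. ?\<phi> x = \<zero>}" using that stable_carrier[OF W'(1)] by simp
      then show ?thesis by (simp only: W'(3) singleton_iff)
    qed
    from inject[OF \<phi> W'(1) this]
    obtain k where k: "k \<in> E" "\<And>w. w \<in> W' \<Longrightarrow> k (?\<phi> w) = w" by auto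
    have "w \<in> N" if w: "w \<in> W'" for w
    proof -
      have "?\<phi> w \<in> N" using hN endo_closed[OF fE stable_carrier[OF W'(1) w]] by simp
      then have "k (?\<phi> w) \<in> N" using k(1) N(2) unfolding fully_inv_def by blast
      then show ?thesis by (simp only: k(2)[OF w])
    qed
    then have "?\<phi> w = \<zero>" if "w \<in> W'" for w
      using that f endo_zero[OF h(1)] by (simp add: annihilator_def)
    then have "W' \<subseteq> {x \<in> carrier G. ?\<phi> x = \<zero>}" using stable_subset[OF W'(1)] by auto
    then show False using W'(2,3) by (simp add: Int_absorb2)
  qed
  \<comment> \<open>Were the common kernel of hE all of G, taking the identity for e would give h =
    0.\<close>
  let ?F = "{h \<circ> e | e. e \<in> E}"
  let ?Y = "common_ker ?F"
  have FE: "?F \<subseteq> E" using h(1) endo_comp by blast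
  have "fully_inv ?Y"
    by (rule fully_inv_common_ker) (use endo_comp in \<open>auto simp: comp_assoc\<close>)
  moreover have "f x \<in> ?Y" if f: "f \<in> annihilator N" "x \<in> carrier G" for f x
  proof (rule common_kerI)
    show "f x \<in> carrier G" using f endo_closed by (simp add: annihilator_def)
    fix g assume "g \<in> ?F"
    then obtain e where g: "g = h \<circ> e" "e \<in> E" by blast
    show "g (f x) = \<zero>" using hf0[OF annihilator_comp[OF N(2) g(2) f(1)] f(2)] by (simp add: g(1))
  qed
  ultimately consider "N = carrier G" | "?Y = carrier G"
    using coprime[OF N(1,2) stable_common_ker[OF FE]] by blast
  then show ?thesis
  proof cases
    case 2
    have "h \<circ> (\<lambda>x. x) \<in> ?F" using endo_id by blast
    then have "h x0 = \<zero>" using common_kerD[of x0 ?F "h \<circ> (\<lambda>x. x)"] 2 x0(1) by simp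
    then show ?thesis using h(3) by simp
  qed
qed

lemma simple_if_bounded:
  fixes \<l> :: "'a set \<Rightarrow> nat"
  assumes "\<And>X Y. stable X \<Longrightarrow> stable Y \<Longrightarrow> X \<subset> Y \<Longrightarrow> \<l> X < \<l> Y" "\<And>X. stable X \<Longrightarrow> \<l> X \<le> n"
    and "stable N" "fully_inv N" "N \<noteq> {\<zero>}"
  shows "N = carrier G"
proof -
  have "minimum_condition {X. stable X}"
    by (rule minimum_condition_if_rank[where \<l> = \<l>]) (use assms in auto)
  from least_essential[OF this]
  obtain S where S: "essential S" "\<And>W. essential W \<Longrightarrow> S \<subseteq> W" "fully_inv S" by auto
  have sS: "stable S" using S(1) by (simp add: essential_def)
  have "S = carrier G"
    by (rule eq_carrier_if_nilpotent[OF sS S(3) annihilator_nilpotent_if_bounded[OF S(1) assms(1,2)]])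
  then have "W = carrier G" if "essential W" for W
    using S(2)[OF that] that stable_subset[of W] by (auto simp: essential_def)
  then show ?thesis by (rule no_proper_fully_inv[OF _ assms(3-5)])
qed

lemma simple_if_projective:
  assumes min: "minimum_condition {X. stable X}"
    and proj: "\<And>f b. f \<in> E \<Longrightarrow> b \<in> E \<Longrightarrow> f ` carrier G \<subseteq> b ` carrier G \<Longrightarrow>
      \<exists>g\<in>E. \<forall>x\<in>carrier G. f x = b (g x)"
    and "stable N" "fully_inv N" "N \<noteq> {\<zero>}"
  shows "N = carrier G"
proof -
  obtain S where S: "essential S" "\<And>W. essential W \<Longrightarrow> S \<subseteq> W" "fully_inv S"
    using least_essential[OF min] by auto
  have sS: "stable S" using S(1) by (simp add: essential_def)
  obtain n where "null (comp_power (annihilator S) n)"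
    by (rule annihilator_nilpotent_if_projective[OF S(1,3) min proj])
  then have "S = carrier G" by (rule eq_carrier_if_nilpotent[OF sS S(3)])
  then have "W = carrier G" if "essential W" for W
    using S(2)[OF that] that stable_subset[of W] by (auto simp: essential_def)
  then show ?thesis by (rule no_proper_fully_inv[OF _ assms(3-5)])
qed

end

section \<open>Composition series\<close>

context operator_group
begin

text \<open>Says that Y/X is a simple factor, without forming the quotient.\<close>

definition covered :: "'g set \<Rightarrow> 'g set \<Rightarrow> bool" where
  "covered X Y \<longleftrightarrow> stable X \<and> stable Y \<and> X \<subset> Y \<and> (\<forall>Z. stable Z \<and> X \<subseteq> Z \<and> Z \<subseteq> Y \<longrightarrow> Z = X \<or> Z = Y)"

text \<open>The rank of \<open>X\<close> counts the factors of the series on which \<open>X\<close> is nontrivial.\<close>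

lemma rank_if_composition_series:
  assumes K: "K 0 = {\<zero>}" "K n = carrier G" "\<And>i. i < n \<Longrightarrow> covered (K i) (K (Suc i))"
  shows "\<exists>\<l> :: 'g set \<Rightarrow> nat. (\<forall>X Y. stable X \<and> stable Y \<and> X \<subset> Y \<longrightarrow> \<l> X < \<l> Y) \<and> (\<forall>X. \<l> X \<le> n)"
proof -
  define s where "s X = {i. i < n \<and> \<not> X \<inter> K (Suc i) \<subseteq> K i}" for X
  have fin: "finite (s X)" for X by (simp add: s_def)
  have mono: "s X \<subset> s Y" if X: "stable X" and Y: "stable Y" and XY: "X \<subset> Y" for X Y
  proof (rule ccontr)
    assume "\<not> s X \<subset> s Y"
    moreover have "s X \<subseteq> s Y" using XY by (auto simp: s_def)
    ultimately have eq: "s X = s Y" by simp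
    \<comment> \<open>If X and Y are nontrivial on the same factors, then Y is recovered inside X
      along the series. Where Y is nontrivial so is X, and simplicity of the factor gives K i + (X
      \<inter> K (i+1)) = K (i+1). Hence y = k + x, and k = y - x lies in Y \<inter> K i, so in X by
      induction.\<close>
    have "Y \<inter> K i \<subseteq> X" if "i \<le> n" for i
      using that
    proof (induction i)
      case 0
      then show ?case using K(1) stable_zero[OF X] by auto
    next
      case (Suc i)
      then have i: "i < n" and IH: "Y \<inter> K i \<subseteq> X" by simp_all
      note cov = K(3)[OF i, unfolded covered_def]
      show ?case
      proof (cases "i \<in> s Y")
        case False
        then have "Y \<inter> K (Suc i) \<subseteq> K i" using i by (simp add: s_def)
        then show ?thesis using IH by auto
      next
        case True
        then have nX: "\<not> X \<inter> K (Suc i) \<subseteq> K i" using eq by (auto simp: s_def)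
        have sXK: "stable (X \<inter> K (Suc i))" using X cov by (simp add: stable_Int)
        have sub: "K i <+> (X \<inter> K (Suc i)) \<subseteq> K (Suc i)" using cov by (intro set_add_subset) auto
        have "K i <+> (X \<inter> K (Suc i)) \<noteq> K i" using nX subset_set_add(2)[OF _ sXK, of "K i"] cov by auto
        moreover have "K i \<subseteq> K i <+> (X \<inter> K (Suc i))" using subset_set_add(1)[OF _ sXK, of "K i"] cov by simp
        moreover have "stable (K i <+> (X \<inter> K (Suc i)))" using stable_set_add[OF _ sXK] cov by simp
        ultimately have full: "K i <+> (X \<inter> K (Suc i)) = K (Suc i)" using cov sub by metis
        show ?thesis
        proof
          fix y assume y: "y \<in> Y \<inter> K (Suc i)"
          then have "y \<in> K i <+> (X \<inter> K (Suc i))" by (simp add: full)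
          then obtain k x where kx: "k \<in> K i" "x \<in> X" "y = k \<oplus> x" by (auto elim: set_addE)
          have c: "k \<in> carrier G" "x \<in> carrier G"
            using kx stable_carrier[OF X] cov stable_carrier[of "K i"] by auto
          have "k = y \<ominus> x" using kx(3) c by (simp add: a_minus_def a_assoc r_neg)
          moreover have "y \<ominus> x \<in> Y" using y kx(2) XY by (intro stable_minus[OF Y]) auto
          ultimately have "k \<in> X" using IH kx(1) by auto
          then show "y \<in> X" using kx stable_add[OF X] by simp
        qed
      qed
    qed
    from this[of n] have "Y \<subseteq> X" using K(2) stable_subset[OF Y] by (simp add: Int_absorb2)
    then show False using XY by simp
  qed
  have "card (s X) \<le> n" for X
    using card_mono[of "{..<n}" "s X"] by (auto simp: s_def)
  moreover have "card (s X) < card (s Y)" if "stable X" "stable Y" "X \<subset> Y" for X Y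
    by (rule psubset_card_mono[OF fin mono[OF that]])
  ultimately show ?thesis by (intro exI[of _ "\<lambda>X. card (s X)"]) simp
qed

end

section \<open>Right artinian rings\<close>

context ring
begin

interpretation RI: operator_group R "(\<lambda>a x. x \<otimes> a) ` carrier R"
  by unfold_locales (auto simp: l_distr)

text \<open>Read as stable subgroups under right multiplications, right ideals inherit the sums and
  intersections of \<open>operator_group\<close>; the next lemma links them with the definitions of
  the theorem.\<close>

definition right_ideal :: "'a set \<Rightarrow> bool" where
  "right_ideal I \<longleftrightarrow> operator_group.stable R ((\<lambda>a x. x \<otimes> a) ` carrier R) I"

lemma right_ideal_iff_right_submodule: "right_ideal I \<longleftrightarrow> right_submodule R (regular_bimodule R) I"
  by (auto simp: right_ideal_def RI.stable_def right_submodule_def regular_bimodule_def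
      subgroup_def m_inv_def)

lemma right_idealI:
  assumes "I \<subseteq> carrier R" "\<zero> \<in> I" "\<And>x y. x \<in> I \<Longrightarrow> y \<in> I \<Longrightarrow> x \<ominus> y \<in> I"
    and "\<And>a x. x \<in> I \<Longrightarrow> a \<in> carrier R \<Longrightarrow> x \<otimes> a \<in> I"
  shows "right_ideal I"
  unfolding right_ideal_def by (rule RI.stableI) (use assms in auto)

lemma right_ideal_mult: "right_ideal I \<Longrightarrow> x \<in> I \<Longrightarrow> a \<in> carrier R \<Longrightarrow> x \<otimes> a \<in> I"
  unfolding right_ideal_def by (rule RI.stable_op[of _ "\<lambda>x. x \<otimes> a", simplified]) auto

lemmas right_ideal_subset = RI.stable_subset[folded right_ideal_def]
  and right_ideal_carrier = RI.stable_carrier[folded right_ideal_def]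
  and right_ideal_zero = RI.stable_zero[folded right_ideal_def]
  and right_ideal_add = RI.stable_add[folded right_ideal_def]
  and right_ideal_minus = RI.stable_minus[folded right_ideal_def]
  and right_ideal_set_add = RI.stable_set_add[folded right_ideal_def]
  and right_ideal_subset_set_add = RI.subset_set_add[folded right_ideal_def]
  and right_ideal_set_add_subset = RI.set_add_subset[folded right_ideal_def]
  and right_ideal_whole = RI.stable_carrierI[folded right_ideal_def]
  and set_add_obtain = RI.set_addE
  and set_add_intro = RI.set_addI

lemma right_ideal_one: "right_ideal I \<Longrightarrow> \<one> \<in> I \<Longrightarrow> I = carrier R"
  using right_ideal_mult[of I \<one>] right_ideal_subset[of I] by auto

lemma right_ideal_lmult:
  assumes "right_ideal I" "a \<in> carrier R" shows "right_ideal ((\<otimes>) a ` I)"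
proof (rule right_idealI)
  note c = right_ideal_carrier[OF assms(1)]
  show "(\<otimes>) a ` I \<subseteq> carrier R" using c assms(2) by auto
  show "\<zero> \<in> (\<otimes>) a ` I" using right_ideal_zero[OF assms(1)] assms(2) by (auto intro!: image_eqI[of _ _ \<zero>])
  show "x \<ominus> y \<in> (\<otimes>) a ` I" if "x \<in> (\<otimes>) a ` I" "y \<in> (\<otimes>) a ` I" for x y
  proof -
    obtain u v where uv: "u \<in> I" "v \<in> I" "x = a \<otimes> u" "y = a \<otimes> v"
      using \<open>x \<in> _\<close> \<open>y \<in> _\<close> by (elim imageE) simp
    then have "x \<ominus> y = a \<otimes> (u \<ominus> v)" using c assms(2) by (simp add: a_minus_def r_distr r_minus)
    then show ?thesis using right_ideal_minus[OF assms(1) uv(1,2)] by simp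
  qed
  show "x \<otimes> b \<in> (\<otimes>) a ` I" if "x \<in> (\<otimes>) a ` I" "b \<in> carrier R" for x b
  proof -
    obtain u where u: "u \<in> I" "x = a \<otimes> u" using \<open>x \<in> _\<close> by (elim imageE) simp
    then have "x \<otimes> b = a \<otimes> (u \<otimes> b)" using c assms(2) that(2) by (simp add: m_assoc)
    then show ?thesis using right_ideal_mult[OF assms(1) u(1) that(2)] by simp
  qed
qed

lemma right_ideal_colon:
  assumes "right_ideal I" "a \<in> carrier R" shows "right_ideal {b \<in> carrier R. a \<otimes> b \<in> I}"
proof (rule right_idealI)
  show "x \<ominus> y \<in> {b \<in> carrier R. a \<otimes> b \<in> I}"
    if "x \<in> {b \<in> carrier R. a \<otimes> b \<in> I}" "y \<in> {b \<in> carrier R. a \<otimes> b \<in> I}" for x y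
  proof -
    have "a \<otimes> (x \<ominus> y) = a \<otimes> x \<ominus> a \<otimes> y" using that assms(2) by (simp add: a_minus_def r_distr r_minus)
    then show ?thesis using that right_ideal_minus[OF assms(1)] by simp
  qed
qed (use assms right_ideal_zero right_ideal_mult in \<open>auto simp flip: m_assoc\<close>)

definition maximal_right_ideal :: "'a set \<Rightarrow> bool" where
  "maximal_right_ideal n \<longleftrightarrow> right_ideal n \<and> n \<noteq> carrier R \<and>
     (\<forall>J. right_ideal J \<and> n \<subseteq> J \<longrightarrow> J = n \<or> J = carrier R)"

lemma maximal_right_ideal_add:
  assumes "maximal_right_ideal n" "right_ideal J" "x \<in> J" "x \<notin> n"
  shows "n <+> J = carrier R"
proof -
  have n: "right_ideal n" using assms(1) by (simp add: maximal_right_ideal_def)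
  have "n <+> J \<noteq> n" using assms(3,4) right_ideal_subset_set_add(2)[OF n assms(2)] by auto
  then show ?thesis
    using assms(1) right_ideal_set_add[OF n assms(2)] right_ideal_subset_set_add(1)[OF n assms(2)]
    unfolding maximal_right_ideal_def by metis
qed

text \<open>Left multiplication by a embeds R/(n : a) into the simple module R/n, so a proper (n :
  a) is again maximal. This is what makes the radical closed under left multiplication.\<close>

lemma maximal_right_ideal_colon:
  assumes n: "maximal_right_ideal n" and a: "a \<in> carrier R" and ne: "{b \<in> carrier R. a \<otimes> b \<in> n} \<noteq> carrier R"
  shows "maximal_right_ideal {b \<in> carrier R. a \<otimes> b \<in> n}" (is "maximal_right_ideal ?P")
  unfolding maximal_right_ideal_def
proof (intro conjI allI impI ne)
  have rn: "right_ideal n" using n by (simp add: maximal_right_ideal_def)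
  show "right_ideal ?P" by (rule right_ideal_colon[OF rn a])
  fix J assume J': "right_ideal J \<and> ?P \<subseteq> J"
  then have J: "right_ideal J" "?P \<subseteq> J" by auto
  show "J = ?P \<or> J = carrier R"
  proof (cases "J \<subseteq> ?P")
    case False
    then obtain j where j: "j \<in> J" "a \<otimes> j \<notin> n" using right_ideal_carrier[OF J(1)] by auto
    have full: "n <+> ((\<otimes>) a ` J) = carrier R"
      by (rule maximal_right_ideal_add[OF n right_ideal_lmult[OF J(1) a], of "a \<otimes> j"]) (use j in auto)
    have "c \<in> J" if c: "c \<in> carrier R" for c
    proof -
      have "a \<otimes> c \<in> n <+> ((\<otimes>) a ` J)" using full a c by simp
      then obtain x y where xy: "x \<in> n" "y \<in> J" "a \<otimes> c = x \<oplus> a \<otimes> y" by (auto elim!: set_add_obtain)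
      have yc: "y \<in> carrier R" "x \<in> carrier R"
        using right_ideal_carrier[OF J(1) xy(2)] right_ideal_carrier[OF rn xy(1)] .
      have "a \<otimes> (c \<ominus> y) = x"
        using a c yc xy(3) by (simp add: a_minus_def r_distr r_minus a_assoc r_neg)
      then have "c \<ominus> y \<in> J" using J(2) xy(1) c yc by (auto simp: minus_closed)
      then have "(c \<ominus> y) \<oplus> y \<in> J" by (rule right_ideal_add[OF J(1) _ xy(2)])
      then show ?thesis using c yc by (simp add: a_minus_def a_assoc l_neg)
    qed
    then show ?thesis using right_ideal_subset[OF J(1)] by auto
  qed (use J in auto)
qed

text \<open>The carrier is intersected in to give the empty family the value R.\<close>

definition finite_Int :: "'a set set \<Rightarrow> 'a set" where
  "finite_Int F = carrier R \<inter> \<Inter>F"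

lemma right_ideal_finite_Int: "(\<And>n. n \<in> F \<Longrightarrow> right_ideal n) \<Longrightarrow> right_ideal (finite_Int F)"
  using RI.stable_Inter[folded right_ideal_def, of "insert (carrier R) F"] right_ideal_whole
  by (auto simp: finite_Int_def)

text \<open>Modulo the intersection of F the ring is semisimple, and Q complements I there. Q is the
  intersection of a subfamily T of F that is maximal subject to I + Q = R.\<close>

lemma right_ideal_complement:
  assumes F: "finite F" "\<And>n. n \<in> F \<Longrightarrow> maximal_right_ideal n" and I: "right_ideal I"
  shows "\<exists>Q. right_ideal Q \<and> I <+> Q = carrier R \<and> I \<inter> Q \<subseteq> finite_Int F"
proof -
  have rF: "right_ideal n" if "n \<in> F" for n using F(2)[OF that] by (simp add: maximal_right_ideal_def)
  let ?\<T> = "{T. T \<subseteq> F \<and> I <+> finite_Int T = carrier R}"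
  have "I <+> carrier R = carrier R"
    using right_ideal_subset_set_add(2)[OF I right_ideal_whole]
      right_ideal_subset[OF right_ideal_set_add[OF I right_ideal_whole]] by auto
  then have "{} \<in> ?\<T>" by (simp add: finite_Int_def)
  then have "?\<T> \<noteq> {}" by (rule ex_in_conv[THEN iffD1, OF exI])
  moreover have "finite ?\<T>" using F(1) by simp
  ultimately obtain T where T: "T \<in> ?\<T>" "\<forall>T'\<in>?\<T>. T \<subseteq> T' \<longrightarrow> T = T'"
    using finite_has_maximal[of ?\<T>] by (elim meta_impE bexE) simp_all
  have rT: "right_ideal (finite_Int T)" using T(1) rF by (intro right_ideal_finite_Int) auto
  \<comment> \<open>If x in I \<inter> Q were outside n, then n + xR = R, and each q in Q would be y
    + xr with xr in I \<inter> Q and y in n \<inter> Q. So n could be added to T; by maximality n is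
    in T already, which puts x in n.\<close>
  have "x \<in> n" if x: "x \<in> I" "x \<in> finite_Int T" and n: "n \<in> F" for x n
  proof (rule ccontr)
    assume xn: "x \<notin> n"
    have xc: "x \<in> carrier R" by (rule right_ideal_carrier[OF I x(1)])
    have full: "n <+> ((\<otimes>) x ` carrier R) = carrier R"
      by (rule maximal_right_ideal_add[OF F(2)[OF n] right_ideal_lmult[OF right_ideal_whole xc], of x])
        (use xc xn in \<open>auto intro!: image_eqI[of _ _ \<one>]\<close>)
    have r': "right_ideal (finite_Int (insert n T))"
      using T(1) n rF by (intro right_ideal_finite_Int) auto
    have "c \<in> I <+> finite_Int (insert n T)" if "c \<in> carrier R" for c
    proof -
      have "c \<in> I <+> finite_Int T" using T(1) that by simp
      then obtain i q where iq: "i \<in> I" "q \<in> finite_Int T" "c = i \<oplus> q" by (auto elim: set_add_obtain)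
      have qc: "q \<in> carrier R" "i \<in> carrier R"
        using right_ideal_carrier[OF rT iq(2)] right_ideal_carrier[OF I iq(1)] .
      then have "q \<in> n <+> ((\<otimes>) x ` carrier R)" by (simp add: full)
      then obtain y r where yr: "y \<in> n" "r \<in> carrier R" "q = y \<oplus> x \<otimes> r" by (auto elim!: set_add_obtain)
      have yc: "y \<in> carrier R" by (rule right_ideal_carrier[OF rF[OF n] yr(1)])
      have "y = q \<ominus> x \<otimes> r" using yr(2,3) yc xc by (simp add: a_minus_def a_assoc r_neg)
      also have "\<dots> \<in> finite_Int T" by (rule right_ideal_minus[OF rT iq(2) right_ideal_mult[OF rT x(2) yr(2)]])
      finally have "y \<in> finite_Int (insert n T)" using yr(1) by (simp add: finite_Int_def)
      moreover have "i \<oplus> x \<otimes> r \<in> I"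
        by (rule right_ideal_add[OF I iq(1) right_ideal_mult[OF I x(1) yr(2)]])
      moreover have "c = (i \<oplus> x \<otimes> r) \<oplus> y" using iq(3) yr(2,3) qc yc xc by (simp add: a_ac)
      ultimately show ?thesis using set_add_intro by blast
    qed
    then have "insert n T \<in> ?\<T>"
      using T(1) n right_ideal_subset[OF right_ideal_set_add[OF I r']] by auto
    then have "n \<in> T" using T(2)[rule_format, of "insert n T"] by auto
    then show False using x(2) xn by (simp add: finite_Int_def)
  qed
  then have "I \<inter> finite_Int T \<subseteq> finite_Int F" using right_ideal_carrier[OF I] by (auto simp: finite_Int_def)
  then show ?thesis using rT T(1) by auto
qed

end

section \<open>Finiteness and nilpotence of the Jacobson radical\<close>

locale right_artinian_ring = ring R for R (structure) +
  assumes min_right_ideals: "minimum_condition {I. right_ideal I}"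
begin

text \<open>A minimal member among the finite intersections of maximal right ideals does not shrink
  when one more is added, hence lies in every maximal right ideal.\<close>

lemma finite_radical:
  "\<exists>F. finite F \<and> (\<forall>n\<in>F. maximal_right_ideal n) \<and> (\<forall>n. maximal_right_ideal n \<longrightarrow> finite_Int F \<subseteq> n)"
proof -
  let ?\<G> = "finite_Int ` {F. finite F \<and> (\<forall>n\<in>F. maximal_right_ideal n)}"
  have sub: "?\<G> \<subseteq> {I. right_ideal I}"
    using right_ideal_finite_Int by (auto simp: maximal_right_ideal_def)
  have ne: "finite_Int {} \<in> ?\<G>" by simp
  obtain X where X: "X \<in> ?\<G>" "\<forall>Y\<in>?\<G>. Y \<subseteq> X \<longrightarrow> Y = X"
    using minimum_conditionD[OF min_right_ideals sub ne] by (elim bexE)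
  from X(1) obtain F where F: "finite F" "\<forall>n\<in>F. maximal_right_ideal n" "X = finite_Int F" by auto
  have "finite_Int F \<subseteq> n" if n: "maximal_right_ideal n" for n
  proof -
    have "finite_Int (insert n F) \<in> ?\<G>" using F n by auto
    moreover have "finite_Int (insert n F) \<subseteq> X" using F(3) by (auto simp: finite_Int_def)
    ultimately have "finite_Int (insert n F) = X" by (rule X(2)[rule_format])
    then have "finite_Int (insert n F) = finite_Int F" by (simp only: F(3))
    then show ?thesis by (auto simp: finite_Int_def)
  qed
  then show ?thesis using F by auto
qed

text \<open>a k lies in n because (n : a) is the whole ring or a maximal right ideal, and contains
  the radical in both cases.\<close>

lemma radical_ideal:
  assumes F: "\<forall>n\<in>F. maximal_right_ideal n" "\<forall>n. maximal_right_ideal n \<longrightarrow> finite_Int F \<subseteq> n"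
  shows "ideal (finite_Int F) R"
proof -
  have K: "right_ideal (finite_Int F)"
    using F(1) by (intro right_ideal_finite_Int) (auto simp: maximal_right_ideal_def)
  have l: "a \<otimes> k \<in> finite_Int F" if k: "k \<in> finite_Int F" and a: "a \<in> carrier R" for a k
  proof -
    have kc: "k \<in> carrier R" by (rule right_ideal_carrier[OF K k])
    have "a \<otimes> k \<in> n" if n: "n \<in> F" for n
    proof (cases "{b \<in> carrier R. a \<otimes> b \<in> n} = carrier R")
      case True
      then show ?thesis using kc by auto
    next
      case False
      have "maximal_right_ideal n" using n F(1) by simp
      from maximal_right_ideal_colon[OF this a False] show ?thesis using F(2) k by auto
    qed
    then show ?thesis using a kc by (simp add: finite_Int_def)
  qed
  show ?thesis
    by (rule idealI[OF ring_axioms _ l])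
      (use K right_ideal_mult[OF K] in \<open>auto simp: right_ideal_iff_right_submodule right_submodule_def
        regular_bimodule_def subgroup_def m_inv_def\<close>)
qed

primrec ideal_pow :: "'a set \<Rightarrow> nat \<Rightarrow> 'a set" where
  "ideal_pow K 0 = carrier R"
| "ideal_pow K (Suc n) = ideal_prod R K (ideal_pow K n)"

lemma ideal_ideal_pow: "ideal K R \<Longrightarrow> ideal (ideal_pow K n) R"
  by (induction n) (auto intro: oneideal ideal_prod_is_ideal)

lemma right_ideal_if_ideal:
  assumes "ideal I R" shows "right_ideal I"
proof -
  interpret ideal I R by fact
  show ?thesis by (rule right_idealI) (auto simp: I_r_closed a_minus_def)
qed

text \<open>Let B be the stable power, so K B = B, and suppose B is not zero. Take a minimal right
  ideal I with I B not zero and x in I with x B not zero. The annihilator \<open>?n\<close> of the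
  image of x modulo the annihilator of B is a maximal right ideal: if J is a right ideal strictly
  above it, then x J B is not zero, so x J = I, x = x j' with j' in J, and 1 - j' in
  \<open>?n\<close> puts 1 into J. Hence K \<subseteq> \<open>?n\<close>, that is x K B = 0,
  contradicting x B \<noteq> 0.\<close>

lemma radical_nilpotent:
  assumes F: "\<forall>n\<in>F. maximal_right_ideal n" "\<forall>n. maximal_right_ideal n \<longrightarrow> finite_Int F \<subseteq> n"
  shows "\<exists>n. ideal_pow (finite_Int F) n = {\<zero>}"
proof -
  let ?K = "finite_Int F"
  have K: "ideal ?K R" by (rule radical_ideal[OF F])
  note pow = ideal_ideal_pow[OF K]
  have "ideal_pow ?K (Suc i) \<subseteq> ideal_pow ?K i" for i using ideal_prod_inter[OF K pow] by auto
  then obtain n where n: "\<forall>i\<ge>n. ideal_pow ?K i = ideal_pow ?K n"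
    using stabilizes_if_minimum_condition[OF min_right_ideals, of "ideal_pow ?K"] right_ideal_if_ideal[OF pow]
    by auto
  define B where "B = ideal_pow ?K n"
  have KB: "ideal_prod R ?K B = B" using n[rule_format, of "Suc n"] by (simp add: B_def)
  interpret B: ideal B R unfolding B_def by (rule pow)
  have rK: "right_ideal ?K" by (rule right_ideal_if_ideal[OF K])
  have "B = {\<zero>}"
  proof (rule ccontr)
    assume "B \<noteq> {\<zero>}"
    then obtain b0 where b0: "b0 \<in> B" "b0 \<noteq> \<zero>" using B.zero_closed by auto
    let ?\<G> = "{I. right_ideal I \<and> (\<exists>x\<in>I. \<exists>b\<in>B. x \<otimes> b \<noteq> \<zero>)}"
    have "\<one> \<otimes> b0 \<noteq> \<zero>" using b0 by simp
    then have ne: "carrier R \<in> ?\<G>" using b0(1) right_ideal_whole one_closed by blast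
    have sub: "?\<G> \<subseteq> {I. right_ideal I}" by auto
    obtain I where IG: "I \<in> ?\<G>" and min: "\<forall>J\<in>?\<G>. J \<subseteq> I \<longrightarrow> J = I"
      using minimum_conditionD[OF min_right_ideals sub ne] by (elim bexE)
    from IG obtain x b where I: "right_ideal I" and x: "x \<in> I" "b \<in> B" "x \<otimes> b \<noteq> \<zero>" by auto
    have xc: "x \<in> carrier R" by (rule right_ideal_carrier[OF I x(1)])
    let ?n = "{a \<in> carrier R. \<forall>b\<in>B. x \<otimes> a \<otimes> b = \<zero>}"
    have rn: "right_ideal ?n"
    proof (rule right_idealI)
      show "a \<ominus> a' \<in> ?n" if "a \<in> ?n" "a' \<in> ?n" for a a'
        using that xc by (auto simp: a_minus_def r_distr l_distr r_minus l_minus)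
      show "a \<otimes> c \<in> ?n" if "a \<in> ?n" "c \<in> carrier R" for a c
      proof -
        have "x \<otimes> (a \<otimes> c) \<otimes> b = \<zero>" if "b \<in> B" for b
        proof -
          have "x \<otimes> (a \<otimes> c) \<otimes> b = x \<otimes> a \<otimes> (c \<otimes> b)"
            using \<open>a \<in> ?n\<close> \<open>c \<in> carrier R\<close> xc that by (simp add: m_assoc)
          then show ?thesis using \<open>a \<in> ?n\<close> B.I_l_closed[OF that \<open>c \<in> carrier R\<close>] by simp
        qed
        then show ?thesis using that by simp
      qed
    qed (use xc in auto)
    have "maximal_right_ideal ?n"
      unfolding maximal_right_ideal_def
    proof (intro conjI allI impI rn)
      have "\<one> \<notin> ?n" using x xc by auto
      then show "?n \<noteq> carrier R" by (metis one_closed)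
      fix J assume J': "right_ideal J \<and> ?n \<subseteq> J"
      then have J: "right_ideal J" "?n \<subseteq> J" by auto
      show "J = ?n \<or> J = carrier R"
      proof (cases "J \<subseteq> ?n")
        case False
        then obtain j b where j: "j \<in> J" "b \<in> B" "x \<otimes> j \<otimes> b \<noteq> \<zero>" using right_ideal_carrier[OF J(1)] by auto
        have "(\<otimes>) x ` J \<in> ?\<G>" using j right_ideal_lmult[OF J(1) xc] by auto
        moreover have "(\<otimes>) x ` J \<subseteq> I"
          using right_ideal_mult[OF I x(1)] right_ideal_carrier[OF J(1)] by auto
        ultimately have "(\<otimes>) x ` J = I" using min by simp
        then obtain j' where j': "j' \<in> J" "x = x \<otimes> j'" using x(1) by auto
        have j'c: "j' \<in> carrier R" by (rule right_ideal_carrier[OF J(1) j'(1)])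
        have "x \<otimes> (\<one> \<ominus> j') = \<zero>" using xc j'c j'(2) by (simp add: a_minus_def r_distr r_minus r_neg)
        then have "\<one> \<ominus> j' \<in> ?n" using j'c by (simp add: minus_closed)
        then have "(\<one> \<ominus> j') \<oplus> j' \<in> J" using J(2) j'(1) by (intro right_ideal_add[OF J(1)]) auto
        then have "\<one> \<in> J" using j'c by (simp add: a_minus_def a_assoc l_neg)
        then show ?thesis using right_ideal_one[OF J(1)] by simp
      qed (use J in auto)
    qed
    then have Kn: "?K \<subseteq> ?n" using F(2) by simp
    have "y \<in> carrier R \<and> x \<otimes> y = \<zero>" if "y \<in> ideal_prod R ?K B" for y
      using that
    proof (induction rule: ideal_prod.induct)
      case (prod k b)
      then have "k \<in> ?n" using Kn by auto
      then show ?case using prod xc by (simp flip: m_assoc)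
    next
      case (sum y z)
      then show ?case using xc by (simp add: r_distr)
    qed
    then show False using x(2,3) KB by simp
  qed
  then show ?thesis unfolding B_def by auto
qed

end


section \<open>Modules over right artinian rings\<close>

definition ract_ops :: "('a, 'z) ring_scheme \<Rightarrow> ('l, 'a, 'm, 'x) bimodule_scheme \<Rightarrow> ('m \<Rightarrow> 'm) set" where
  "ract_ops A M = (\<lambda>a x. x \<triangleleft>\<^bsub>M\<^esub> a) ` carrier A"

lemma (in right_module) operator_group_ract_ops: "operator_group M (ract_ops A M)"
  by (intro operator_group.intro operator_group_axioms.intro M.abelian_group_axioms)
    (auto simp: ract_ops_def ract_closed ract_l_distr)

lemma (in right_module) stable_iff_right_submodule:
  "operator_group.stable M (ract_ops A M) X \<longleftrightarrow> right_submodule A M X"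
  unfolding operator_group.stable_def[OF operator_group_ract_ops] right_submodule_def
  by (auto simp: ract_ops_def)

text \<open>The intersection of \<open>F\<close> is the Jacobson radical.\<close>

locale right_module_right_artinian = right_module A M + A': right_artinian_ring A
  for A :: "('a, 'z) ring_scheme" and M :: "('l, 'a, 'm, 'x) bimodule_scheme" +
  fixes F :: "'a set set"
  assumes finite_F: "finite F" and maximal_F: "\<And>n. n \<in> F \<Longrightarrow> A.maximal_right_ideal n"
    and radical_F: "\<And>n. A.maximal_right_ideal n \<Longrightarrow> A.finite_Int F \<subseteq> n"
begin

interpretation Sub: operator_group M "ract_ops A M" by (rule operator_group_ract_ops)

abbreviation "rad \<equiv> A.finite_Int F"

lemma stable_ract: "Sub.stable X \<Longrightarrow> x \<in> X \<Longrightarrow> a \<in> carrier A \<Longrightarrow> x \<triangleleft>\<^bsub>M\<^esub> a \<in> X"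
  using Sub.stable_op[of X "\<lambda>x. x \<triangleleft>\<^bsub>M\<^esub> a" x] by (simp add: ract_ops_def)

lemma stableI':
  assumes "X \<subseteq> carrier M" "\<zero>\<^bsub>M\<^esub> \<in> X" "\<And>x y. x \<in> X \<Longrightarrow> y \<in> X \<Longrightarrow> x \<ominus>\<^bsub>M\<^esub> y \<in> X"
    and "\<And>a x. x \<in> X \<Longrightarrow> a \<in> carrier A \<Longrightarrow> x \<triangleleft>\<^bsub>M\<^esub> a \<in> X"
  shows "Sub.stable X"
  by (rule Sub.stableI) (use assms in \<open>auto simp: ract_ops_def\<close>)

lemma ract_zero: "x \<in> carrier M \<Longrightarrow> x \<triangleleft>\<^bsub>M\<^esub> \<zero>\<^bsub>A\<^esub> = \<zero>\<^bsub>M\<^esub>"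
  using ract_r_distr[of x "\<zero>\<^bsub>A\<^esub>" "\<zero>\<^bsub>A\<^esub>"] ract_closed[of x "\<zero>\<^bsub>A\<^esub>"]
  by (simp add: M.add.l_cancel_one')

lemma ract_minus:
  assumes "x \<in> carrier M" "a \<in> carrier A" "b \<in> carrier A"
  shows "x \<triangleleft>\<^bsub>M\<^esub> (a \<ominus>\<^bsub>A\<^esub> b) = x \<triangleleft>\<^bsub>M\<^esub> a \<ominus>\<^bsub>M\<^esub> x \<triangleleft>\<^bsub>M\<^esub> b"
proof -
  have "x \<triangleleft>\<^bsub>M\<^esub> (a \<ominus>\<^bsub>A\<^esub> b) \<oplus>\<^bsub>M\<^esub> x \<triangleleft>\<^bsub>M\<^esub> b = x \<triangleleft>\<^bsub>M\<^esub> (a \<ominus>\<^bsub>A\<^esub> b \<oplus>\<^bsub>A\<^esub> b)"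
    using assms by (simp add: ract_r_distr)
  also have "a \<ominus>\<^bsub>A\<^esub> b \<oplus>\<^bsub>A\<^esub> b = a" using assms by (simp add: a_minus_def A.a_assoc A.l_neg)
  finally have "x \<triangleleft>\<^bsub>M\<^esub> a = x \<triangleleft>\<^bsub>M\<^esub> (a \<ominus>\<^bsub>A\<^esub> b) \<oplus>\<^bsub>M\<^esub> x \<triangleleft>\<^bsub>M\<^esub> b" by simp
  then show ?thesis using assms ract_closed by (simp add: a_minus_def M.a_assoc M.r_neg)
qed

lemma stable_cyclic:
  assumes "y \<in> carrier M" "A.right_ideal Q"
  shows "Sub.stable ((\<lambda>q. y \<triangleleft>\<^bsub>M\<^esub> q) ` Q)"
proof (rule stableI')
  note c = A.right_ideal_carrier[OF assms(2)]
  let ?X = "(\<lambda>q. y \<triangleleft>\<^bsub>M\<^esub> q) ` Q"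
  show "?X \<subseteq> carrier M" using c assms(1) ract_closed by auto
  show "\<zero>\<^bsub>M\<^esub> \<in> ?X"
    using A.right_ideal_zero[OF assms(2)] ract_zero[OF assms(1)] by (intro image_eqI[of _ _ "\<zero>\<^bsub>A\<^esub>"]) auto
  show "x \<ominus>\<^bsub>M\<^esub> x' \<in> ?X" if xx: "x \<in> ?X" "x' \<in> ?X" for x x'
  proof -
    obtain q q' where q: "q \<in> Q" "q' \<in> Q" "x = y \<triangleleft>\<^bsub>M\<^esub> q" "x' = y \<triangleleft>\<^bsub>M\<^esub> q'"
      using xx by (elim imageE) simp
    then have "x \<ominus>\<^bsub>M\<^esub> x' = y \<triangleleft>\<^bsub>M\<^esub> (q \<ominus>\<^bsub>A\<^esub> q')" using c assms(1) by (simp add: ract_minus)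
    then show ?thesis using A.right_ideal_minus[OF assms(2) q(1,2)] by simp
  qed
  show "x \<triangleleft>\<^bsub>M\<^esub> a \<in> ?X" if xa: "x \<in> ?X" "a \<in> carrier A" for x a
  proof -
    obtain q where q: "q \<in> Q" "x = y \<triangleleft>\<^bsub>M\<^esub> q" using xa(1) by (elim imageE) simp
    then have "x \<triangleleft>\<^bsub>M\<^esub> a = y \<triangleleft>\<^bsub>M\<^esub> (q \<otimes>\<^bsub>A\<^esub> a)" using c assms(1) xa(2) by (simp add: ract_assoc)
    then show ?thesis using A.right_ideal_mult[OF assms(2) q(1) xa(2)] by simp
  qed
qed

lemma right_ideal_transporter:
  assumes "y \<in> carrier M" "Sub.stable D"
  shows "A.right_ideal {a \<in> carrier A. y \<triangleleft>\<^bsub>M\<^esub> a \<in> D}"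
  by (rule A.right_idealI)
    (use assms Sub.stable_zero Sub.stable_minus stable_ract
      in \<open>auto simp: ract_zero ract_minus A.minus_closed ract_assoc\<close>)

text \<open>Choose \<open>W'\<close> maximal without \<open>w\<close>; then \<open>D = W' + w A\<close> is the least submodule above \<open>W'\<close>. For \<open>y\<close> in \<open>W\<close>
  and a complement \<open>Q\<close> of the right ideal \<open>(D : y)\<close>, the submodule \<open>W' + y Q\<close> omits \<open>w\<close>, so it equals \<open>W'\<close>;
  hence \<open>y\<close> lies in \<open>D\<close>, and \<open>W = D\<close> covers \<open>W'\<close>.\<close>

lemma maximal_submodule:
  assumes P: "Sub.stable P" and W: "Sub.stable W" and PW: "P \<subseteq> W" "w \<in> W" "w \<notin> P"
    and kill: "\<And>x k. x \<in> W \<Longrightarrow> k \<in> rad \<Longrightarrow> x \<triangleleft>\<^bsub>M\<^esub> k \<in> P"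
  shows "\<exists>W'. P \<subseteq> W' \<and> Sub.covered W' W"
proof -
  let ?\<A> = "{X. Sub.stable X \<and> P \<subseteq> X \<and> X \<subseteq> W \<and> w \<notin> X}"
  have "\<exists>X\<in>?\<A>. \<forall>Y\<in>?\<A>. X \<subseteq> Y \<longrightarrow> Y = X"
  proof (rule subset_Zorn_nonempty)
    have "P \<in> ?\<A>" using P PW by simp
    then show "?\<A> \<noteq> {}" by (rule ex_in_conv[THEN iffD1, OF exI])
    fix \<C> assume C: "\<C> \<noteq> {}" "subset.chain ?\<A> \<C>"
    then have "Sub.stable (\<Union>\<C>)" by (intro Sub.stable_Union_chain) (auto simp: subset_chain_def)
    then show "\<Union>\<C> \<in> ?\<A>" using C by (auto simp: subset_chain_def)
  qed
  then obtain W' where W': "Sub.stable W'" "P \<subseteq> W'" "W' \<subseteq> W" "w \<notin> W'"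
    and max: "\<And>X. Sub.stable X \<Longrightarrow> W' \<subseteq> X \<Longrightarrow> X \<subseteq> W \<Longrightarrow> w \<notin> X \<Longrightarrow> X = W'" by auto
  have wc: "w \<in> carrier M" by (rule Sub.stable_carrier[OF W PW(2)])
  let ?wA = "(\<lambda>a. w \<triangleleft>\<^bsub>M\<^esub> a) ` carrier A"
  define D where "D = W' <+>\<^bsub>M\<^esub> ?wA"
  have swA: "Sub.stable ?wA" by (rule stable_cyclic[OF wc A.right_ideal_whole])
  have D: "Sub.stable D" unfolding D_def by (rule Sub.stable_set_add[OF W'(1) swA])
  have W'D: "W' \<subseteq> D" unfolding D_def by (rule Sub.subset_set_add(1)[OF W'(1) swA])
  have D_least: "D \<subseteq> X" if X: "Sub.stable X" "W' \<subseteq> X" "w \<in> X" for X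
    unfolding D_def using X stable_ract by (intro Sub.set_add_subset) auto
  have "?wA \<subseteq> D" unfolding D_def by (rule Sub.subset_set_add(2)[OF W'(1) swA])
  moreover have "w \<in> ?wA" using ract_one[OF wc] by (intro image_eqI[of _ _ "\<one>\<^bsub>A\<^esub>"]) auto
  ultimately have wD: "w \<in> D" by auto
  have "y \<in> D" if y: "y \<in> W" for y
  proof -
    have yc: "y \<in> carrier M" by (rule Sub.stable_carrier[OF W y])
    let ?I = "{a \<in> carrier A. y \<triangleleft>\<^bsub>M\<^esub> a \<in> D}"
    have I: "A.right_ideal ?I" by (rule right_ideal_transporter[OF yc D])
    obtain Q where Q: "A.right_ideal Q" "?I <+>\<^bsub>A\<^esub> Q = carrier A" "?I \<inter> Q \<subseteq> rad"
      using A.right_ideal_complement[OF finite_F maximal_F I] by auto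
    let ?yQ = "(\<lambda>q. y \<triangleleft>\<^bsub>M\<^esub> q) ` Q"
    have syQ: "Sub.stable ?yQ" by (rule stable_cyclic[OF yc Q(1)])
    have yQW: "?yQ \<subseteq> W" using stable_ract[OF W y] A.right_ideal_carrier[OF Q(1)] by auto
    \<comment> \<open>Otherwise y q = w - w' lies in D, so q is in I \<inter> Q and therefore in the
      radical, which carries y into P \<subseteq> W'; then w would be in W'.\<close>
    have "w \<notin> W' <+>\<^bsub>M\<^esub> ?yQ"
    proof
      assume "w \<in> W' <+>\<^bsub>M\<^esub> ?yQ"
      then obtain w' q where wq: "w' \<in> W'" "q \<in> Q" "w = w' \<oplus>\<^bsub>M\<^esub> y \<triangleleft>\<^bsub>M\<^esub> q" by (auto elim!: Sub.set_addE)
      have c: "w' \<in> carrier M" "q \<in> carrier A" "y \<triangleleft>\<^bsub>M\<^esub> q \<in> carrier M"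
        using Sub.stable_carrier[OF W'(1) wq(1)] A.right_ideal_carrier[OF Q(1) wq(2)] ract_closed[OF yc] by auto
      have "y \<triangleleft>\<^bsub>M\<^esub> q = \<ominus>\<^bsub>M\<^esub> w' \<oplus>\<^bsub>M\<^esub> w" using wq(3) c by (simp add: M.r_neg1)
      also have "\<dots> \<in> D" using Sub.stable_add[OF D Sub.stable_inv[OF D] wD] W'D wq(1) by auto
      finally have "q \<in> ?I \<inter> Q" using c wq(2) by simp
      then have "q \<in> rad" using Q(3) by auto
      then have "y \<triangleleft>\<^bsub>M\<^esub> q \<in> W'" using kill[OF y] W'(2) by auto
      then have "w \<in> W'" using wq Sub.stable_add[OF W'(1)] by simp
      then show False using W'(4) by simp
    qed
    then have "W' <+>\<^bsub>M\<^esub> ?yQ = W'"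
      using max[OF Sub.stable_set_add[OF W'(1) syQ] Sub.subset_set_add(1)[OF W'(1) syQ]]
        Sub.set_add_subset[OF W W'(3) yQW] by simp
    then have "?yQ \<subseteq> D" using Sub.subset_set_add(2)[OF W'(1) syQ] W'D by auto
    \<comment> \<open>Now y Q lies in W', so Q \<subseteq> I; with I + Q = A this leaves I = A, and
      y = y 1 is in D.\<close>
    then have "Q \<subseteq> ?I" using A.right_ideal_subset[OF Q(1)] by auto
    then have "?I = carrier A"
      using A.right_ideal_set_add_subset[OF I, of ?I Q] Q(2) by auto
    then have "y \<triangleleft>\<^bsub>M\<^esub> \<one>\<^bsub>A\<^esub> \<in> D" by auto
    then show ?thesis by (simp add: ract_one[OF yc])
  qed
  then have WD: "W \<subseteq> D" by auto
  have "Sub.covered W' W"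
    unfolding Sub.covered_def
  proof (intro conjI allI impI W'(1) W)
    show "W' \<subset> W" using W' PW(2) by auto
    fix Z assume Z: "Sub.stable Z \<and> W' \<subseteq> Z \<and> Z \<subseteq> W"
    show "Z = W' \<or> Z = W"
    proof (cases "w \<in> Z")
      case True
      then have "D \<subseteq> Z" using Z by (intro D_least) auto
      then show ?thesis using WD Z by auto
    qed (use max Z in auto)
  qed
  then show ?thesis using W'(2) by auto
qed

text \<open>The hypothesis \<open>kill\<close> makes Q/P a module over the semisimple ring A/rad. A
  minimal W from which Q is reached by covers must be P, since \<open>maximal_submodule\<close>
  would otherwise supply one more cover below W.\<close>

lemma covered_interval:
  assumes min: "minimum_condition {X. Sub.stable X}"
    and P: "Sub.stable P" and Q: "Sub.stable Q" "P \<subseteq> Q"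
    and kill: "\<And>x k. x \<in> Q \<Longrightarrow> k \<in> rad \<Longrightarrow> x \<triangleleft>\<^bsub>M\<^esub> k \<in> P"
  shows "Sub.covered\<^sup>*\<^sup>* P Q"
proof -
  let ?\<G> = "{W. Sub.stable W \<and> P \<subseteq> W \<and> W \<subseteq> Q \<and> Sub.covered\<^sup>*\<^sup>* W Q}"
  have sub: "?\<G> \<subseteq> {X. Sub.stable X}" by auto
  have ne: "Q \<in> ?\<G>" using Q by simp
  obtain W where W: "W \<in> ?\<G>" and least: "\<forall>Y\<in>?\<G>. Y \<subseteq> W \<longrightarrow> Y = W"
    using minimum_conditionD[OF min sub ne] by (elim bexE)
  have "W \<subseteq> P"
  proof (rule ccontr)
    assume "\<not> W \<subseteq> P"
    then obtain w where w: "w \<in> W" "w \<notin> P" by auto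
    have "x \<triangleleft>\<^bsub>M\<^esub> k \<in> P" if "x \<in> W" "k \<in> rad" for x k using W kill that by auto
    then obtain W' where W': "P \<subseteq> W'" "Sub.covered W' W"
      using maximal_submodule[OF P _ _ w] W by auto
    then have "Sub.covered\<^sup>*\<^sup>* W' Q" using W by (auto intro: converse_rtranclp_into_rtranclp)
    then have "W' \<in> ?\<G>" using W W' by (auto simp: Sub.covered_def)
    then show False using least W'(2) by (auto simp: Sub.covered_def)
  qed
  then show ?thesis using W by auto
qed

text \<open>The elements killed by rad^i, defined by recursion so that each factor of the series is
  killed by the radical by construction.\<close>

primrec annihilated :: "nat \<Rightarrow> 'm set" where
  "annihilated 0 = {\<zero>\<^bsub>M\<^esub>}"
| "annihilated (Suc i) = {m \<in> carrier M. \<forall>k\<in>rad. m \<triangleleft>\<^bsub>M\<^esub> k \<in> annihilated i}"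

lemma ideal_rad: "ideal rad A"
  using A'.radical_ideal maximal_F radical_F by auto

lemma rad_carrier: "k \<in> rad \<Longrightarrow> k \<in> carrier A"
  by (simp add: A.finite_Int_def)

lemma stable_annihilated: "Sub.stable (annihilated i)"
proof (induction i)
  case 0
  then show ?case using Sub.stable_zeroI by simp
next
  case (Suc i)
  note z = Sub.stable_zero[OF Suc] and mi = Sub.stable_minus[OF Suc]
  have l: "\<zero>\<^bsub>M\<^esub> \<triangleleft>\<^bsub>M\<^esub> k = \<zero>\<^bsub>M\<^esub>" if "k \<in> carrier A" for k
    using Sub.op_zero[of "\<lambda>x. x \<triangleleft>\<^bsub>M\<^esub> k"] that by (simp add: ract_ops_def)
  have d: "(x \<ominus>\<^bsub>M\<^esub> y) \<triangleleft>\<^bsub>M\<^esub> k = x \<triangleleft>\<^bsub>M\<^esub> k \<ominus>\<^bsub>M\<^esub> y \<triangleleft>\<^bsub>M\<^esub> k"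
    if "x \<in> carrier M" "y \<in> carrier M" "k \<in> carrier A" for x y k
    using Sub.op_minus[of "\<lambda>x. x \<triangleleft>\<^bsub>M\<^esub> k" x y] that by (simp add: ract_ops_def)
  \<comment> \<open>Stability under A uses that the radical is also a left ideal: (x a) k = x (a
    k).\<close>
  have a: "(x \<triangleleft>\<^bsub>M\<^esub> a) \<triangleleft>\<^bsub>M\<^esub> k \<in> annihilated i"
    if "x \<in> annihilated (Suc i)" "a \<in> carrier A" "k \<in> rad" for x a k
  proof -
    have "(x \<triangleleft>\<^bsub>M\<^esub> a) \<triangleleft>\<^bsub>M\<^esub> k = x \<triangleleft>\<^bsub>M\<^esub> (a \<otimes>\<^bsub>A\<^esub> k)" using that rad_carrier by (simp add: ract_assoc)
    then show ?thesis using that ideal.I_l_closed[OF ideal_rad, of k a] by simp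
  qed
  show ?case
    by (rule stableI') (use z mi l d a ract_closed rad_carrier in \<open>auto simp: M.minus_closed\<close>)
qed

lemma annihilatedI:
  assumes "m \<in> carrier M" "\<And>b. b \<in> A'.ideal_pow rad i \<Longrightarrow> m \<triangleleft>\<^bsub>M\<^esub> b = \<zero>\<^bsub>M\<^esub>"
  shows "m \<in> annihilated i"
  using assms
proof (induction i arbitrary: m)
  case 0
  then show ?case using ract_one[of m] by auto
next
  case (Suc i)
  have "m \<triangleleft>\<^bsub>M\<^esub> k \<in> annihilated i" if k: "k \<in> rad" for k
  proof (rule Suc.IH)
    have kc: "k \<in> carrier A" by (rule rad_carrier[OF k])
    show "m \<triangleleft>\<^bsub>M\<^esub> k \<in> carrier M" by (rule ract_closed[OF Suc.prems(1) kc])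
    fix b assume b: "b \<in> A'.ideal_pow rad i"
    have bc: "b \<in> carrier A" by (rule ideal.Icarr[OF A'.ideal_ideal_pow[OF ideal_rad] b])
    have "k \<otimes>\<^bsub>A\<^esub> b \<in> A'.ideal_pow rad (Suc i)" using k b by (simp add: ideal_prod.prod)
    then have "m \<triangleleft>\<^bsub>M\<^esub> (k \<otimes>\<^bsub>A\<^esub> b) = \<zero>\<^bsub>M\<^esub>" by (rule Suc.prems(2))
    then show "(m \<triangleleft>\<^bsub>M\<^esub> k) \<triangleleft>\<^bsub>M\<^esub> b = \<zero>\<^bsub>M\<^esub>" using ract_assoc[OF Suc.prems(1) kc bc] by simp
  qed
  then show ?case using Suc.prems(1) by simp
qed

text \<open>The covers of the consecutive factors of the series \<open>annihilated\<close> are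
  concatenated; nilpotence of the radical makes the series reach M.\<close>

lemma composition_series_if_artinian:
  assumes min: "minimum_condition {X. Sub.stable X}"
  shows "Sub.covered\<^sup>*\<^sup>* {\<zero>\<^bsub>M\<^esub>} (carrier M)"
proof -
  have "\<exists>n. A'.ideal_pow rad n = {\<zero>\<^bsub>A\<^esub>}"
    using A'.radical_nilpotent maximal_F radical_F by auto
  then obtain n where n: "A'.ideal_pow rad n = {\<zero>\<^bsub>A\<^esub>}" ..
  have "Sub.covered\<^sup>*\<^sup>* {\<zero>\<^bsub>M\<^esub>} (annihilated i)" for i
  proof (induction i)
    case (Suc i)
    have "annihilated i \<subseteq> annihilated (Suc i)"
      using stable_ract[OF stable_annihilated] Sub.stable_carrier[OF stable_annihilated] rad_carrier by auto
    then have "Sub.covered\<^sup>*\<^sup>* (annihilated i) (annihilated (Suc i))"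
      by (rule covered_interval[OF min stable_annihilated stable_annihilated]) simp
    then show ?case using Suc.IH by (rule rtranclp_trans[rotated])
  qed simp
  moreover have "annihilated n = carrier M"
    using annihilatedI[of _ n] n ract_zero Sub.stable_subset[OF stable_annihilated, of n] by auto
  ultimately show ?thesis by metis
qed

text \<open>Induction on the generators. A submodule L of Y + xA is controlled by its trace on Y and
  by the right ideal \<open>I L\<close> of its coefficients at x, so a minimal L is found by
  minimising \<open>I L\<close> and, among those L, the trace L \<inter> Y.\<close>

lemma artinian_if_fin_gen:
  assumes fg: "fin_gen_right_module A M"
  shows "minimum_condition {X. Sub.stable X}"
proof -
  obtain S where S: "finite S" "S \<subseteq> carrier M"
    and gen: "\<And>X. Sub.stable X \<Longrightarrow> S \<subseteq> X \<Longrightarrow> X = carrier M"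
    using fg unfolding fin_gen_right_module_def stable_iff_right_submodule by auto
  have "\<exists>Y. Sub.stable Y \<and> T \<subseteq> Y \<and> minimum_condition {X. Sub.stable X \<and> X \<subseteq> Y}"
    if "finite T" "T \<subseteq> carrier M" for T
    using that
  proof (induction T rule: finite_induct)
    case empty
    \<comment> \<open>Only zero lies below zero, so no strict inclusion occurs and a constant rank
      will do.\<close>
    have "minimum_condition {X. Sub.stable X \<and> X \<subseteq> {\<zero>\<^bsub>M\<^esub>}}"
      by (rule minimum_condition_if_rank[where \<l> = "\<lambda>_. 0"]) (use Sub.stable_zero in auto)
    then show ?case using Sub.stable_zeroI by auto
  next
    case (insert x T)
    then obtain Y where Y: "Sub.stable Y" "T \<subseteq> Y"
      and minY: "minimum_condition {X. Sub.stable X \<and> X \<subseteq> Y}" by auto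
    have xc: "x \<in> carrier M" using insert.prems by simp
    let ?xA = "(\<lambda>a. x \<triangleleft>\<^bsub>M\<^esub> a) ` carrier A"
    have sx: "Sub.stable ?xA" by (rule stable_cyclic[OF xc A.right_ideal_whole])
    let ?Z = "Y <+>\<^bsub>M\<^esub> ?xA"
    have xx: "x \<in> ?xA" using ract_one[OF xc] by (intro image_eqI[of _ _ "\<one>\<^bsub>A\<^esub>"]) auto
    have TZ: "insert x T \<subseteq> ?Z"
      using xx Y(2) Sub.subset_set_add[OF Y(1) sx] by auto
    \<comment> \<open>\<open>I L\<close> is the image of L in (Y + xA)/Y, pulled back to A along a
      -> x a.\<close>
    define I where "I L = {a \<in> carrier A. \<exists>y\<in>Y. y \<oplus>\<^bsub>M\<^esub> x \<triangleleft>\<^bsub>M\<^esub> a \<in> L}" for L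
    have rI: "A.right_ideal (I L)" if L: "Sub.stable L" for L
    proof (rule A.right_idealI)
      show "I L \<subseteq> carrier A" by (auto simp: I_def)
      show "\<zero>\<^bsub>A\<^esub> \<in> I L"
        using Sub.stable_zero[OF Y(1)] Sub.stable_zero[OF L] ract_zero[OF xc]
        by (auto simp: I_def intro!: bexI[of _ "\<zero>\<^bsub>M\<^esub>"])
      show "a \<ominus>\<^bsub>A\<^esub> b \<in> I L" if ab: "a \<in> I L" "b \<in> I L" for a b
      proof -
        obtain y z where y: "y \<in> Y" "y \<oplus>\<^bsub>M\<^esub> x \<triangleleft>\<^bsub>M\<^esub> a \<in> L" "a \<in> carrier A"
          and z: "z \<in> Y" "z \<oplus>\<^bsub>M\<^esub> x \<triangleleft>\<^bsub>M\<^esub> b \<in> L" "b \<in> carrier A"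
          using ab unfolding I_def by auto
        have "(y \<ominus>\<^bsub>M\<^esub> z) \<oplus>\<^bsub>M\<^esub> x \<triangleleft>\<^bsub>M\<^esub> (a \<ominus>\<^bsub>A\<^esub> b) = (y \<oplus>\<^bsub>M\<^esub> x \<triangleleft>\<^bsub>M\<^esub> a) \<ominus>\<^bsub>M\<^esub> (z \<oplus>\<^bsub>M\<^esub> x \<triangleleft>\<^bsub>M\<^esub> b)"
          using y z xc Sub.stable_carrier[OF Y(1)] by (simp add: ract_minus Sub.minus_add_minus ract_closed)
        then have "(y \<ominus>\<^bsub>M\<^esub> z) \<oplus>\<^bsub>M\<^esub> x \<triangleleft>\<^bsub>M\<^esub> (a \<ominus>\<^bsub>A\<^esub> b) \<in> L"
          using Sub.stable_minus[OF L y(2) z(2)] by simp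
        then show ?thesis
          using Sub.stable_minus[OF Y(1) y(1) z(1)] y(3) z(3) unfolding I_def by (auto simp: A.minus_closed)
      qed
      show "a \<otimes>\<^bsub>A\<^esub> b \<in> I L" if ab: "a \<in> I L" "b \<in> carrier A" for a b
      proof -
        obtain y where y: "y \<in> Y" "y \<oplus>\<^bsub>M\<^esub> x \<triangleleft>\<^bsub>M\<^esub> a \<in> L" "a \<in> carrier A" using ab(1) unfolding I_def by auto
        have "(y \<oplus>\<^bsub>M\<^esub> x \<triangleleft>\<^bsub>M\<^esub> a) \<triangleleft>\<^bsub>M\<^esub> b = y \<triangleleft>\<^bsub>M\<^esub> b \<oplus>\<^bsub>M\<^esub> x \<triangleleft>\<^bsub>M\<^esub> (a \<otimes>\<^bsub>A\<^esub> b)"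
          using y ab(2) xc Sub.stable_carrier[OF Y(1)] by (simp add: ract_l_distr ract_closed ract_assoc)
        then show ?thesis
          using stable_ract[OF L y(2) ab(2)] stable_ract[OF Y(1) y(1) ab(2)] y(3) ab(2)
          by (auto simp: I_def)
      qed
    qed
    have "minimum_condition {X. Sub.stable X \<and> X \<subseteq> ?Z}"
      unfolding minimum_condition_def
    proof (intro allI impI)
      fix \<G> assume G: "\<G> \<subseteq> {X. Sub.stable X \<and> X \<subseteq> ?Z}" "\<G> \<noteq> {}"
      then obtain L0 where L0: "L0 \<in> \<G>" by auto
      have sub: "I ` \<G> \<subseteq> {J. A.right_ideal J}" using G(1) rI by auto
      obtain I0 where I0: "I0 \<in> I ` \<G>" "\<forall>J\<in>I ` \<G>. J \<subseteq> I0 \<longrightarrow> J = I0"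
        using minimum_conditionD[OF A'.min_right_ideals sub imageI[OF L0]] by (elim bexE)
      from I0(1) obtain L1 where L1: "L1 \<in> \<G>" "I0 = I L1" by auto
      let ?\<H> = "(\<lambda>L. L \<inter> Y) ` {L \<in> \<G>. I L = I0}"
      have sub: "?\<H> \<subseteq> {X. Sub.stable X \<and> X \<subseteq> Y}" using G(1) Y(1) Sub.stable_Int by auto
      have ne: "L1 \<inter> Y \<in> ?\<H>" using L1 by auto
      obtain X where X: "X \<in> ?\<H>" "\<forall>V\<in>?\<H>. V \<subseteq> X \<longrightarrow> V = X"
        using minimum_conditionD[OF minY sub ne] by (elim bexE)
      from X(1) obtain L where L: "L \<in> \<G>" "I L = I0" "X = L \<inter> Y" by auto
      have sL: "Sub.stable L" "L \<subseteq> ?Z" using L(1) G(1) by auto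
      \<comment> \<open>L' has the same coefficient ideal and the same trace on Y as L. So for l = y
        + x a in L there is some y' + x a in L', and the difference y - y' lies in L \<inter> Y = L'
        \<inter> Y.\<close>
      have "L' = L" if L': "L' \<in> \<G>" "L' \<subseteq> L" for L'
      proof -
        have sL': "Sub.stable L'" using L'(1) G(1) by auto
        have "I L' \<subseteq> I0" using L(2) L'(2) by (auto simp: I_def)
        then have IL': "I L' = I0" using I0(2) L'(1) by simp
        then have eq: "L' \<inter> Y = L \<inter> Y" using X(2) L(3) L' by auto
        have "l \<in> L'" if l: "l \<in> L" for l
        proof -
          have "l \<in> ?Z" using l sL(2) by auto
          then obtain y a where ya: "y \<in> Y" "a \<in> carrier A" "l = y \<oplus>\<^bsub>M\<^esub> x \<triangleleft>\<^bsub>M\<^esub> a" by (auto elim!: Sub.set_addE)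
          then have "a \<in> I L'" using l L(2) IL' unfolding I_def by auto
          then obtain y' where y': "y' \<in> Y" "y' \<oplus>\<^bsub>M\<^esub> x \<triangleleft>\<^bsub>M\<^esub> a \<in> L'" unfolding I_def by auto
          have c: "y \<in> carrier M" "y' \<in> carrier M" "x \<triangleleft>\<^bsub>M\<^esub> a \<in> carrier M"
            using Sub.stable_carrier[OF Y(1)] ya y' ract_closed[OF xc] by auto
          have "l \<ominus>\<^bsub>M\<^esub> (y' \<oplus>\<^bsub>M\<^esub> x \<triangleleft>\<^bsub>M\<^esub> a) = y \<ominus>\<^bsub>M\<^esub> y'"
            using c ya(3) by (simp add: Sub.minus_add_minus Sub.minus_self M.minus_closed)
          moreover have "l \<ominus>\<^bsub>M\<^esub> (y' \<oplus>\<^bsub>M\<^esub> x \<triangleleft>\<^bsub>M\<^esub> a) \<in> L" using l y'(2) L'(2) by (intro Sub.stable_minus[OF sL(1)]) auto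
          moreover have "y \<ominus>\<^bsub>M\<^esub> y' \<in> Y" by (rule Sub.stable_minus[OF Y(1) ya(1) y'(1)])
          ultimately have "y \<ominus>\<^bsub>M\<^esub> y' \<in> L'" using eq by auto
          then have "(y \<ominus>\<^bsub>M\<^esub> y') \<oplus>\<^bsub>M\<^esub> (y' \<oplus>\<^bsub>M\<^esub> x \<triangleleft>\<^bsub>M\<^esub> a) \<in> L'" using y'(2) by (rule Sub.stable_add[OF sL'])
          then show ?thesis using c ya(3) by (simp add: a_minus_def M.a_assoc M.r_neg1)
        qed
        then show ?thesis using L'(2) by auto
      qed
      then show "\<exists>X\<in>\<G>. \<forall>Y\<in>\<G>. Y \<subseteq> X \<longrightarrow> Y = X" using L(1) by auto
    qed
    then show ?case using TZ Sub.stable_set_add[OF Y(1) sx] by auto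
  qed
  from this[OF S]
  obtain Y where "Sub.stable Y" "S \<subseteq> Y" "minimum_condition {X. Sub.stable X \<and> X \<subseteq> Y}" by auto
  moreover from this gen have "Y = carrier M" by simp
  ultimately show ?thesis
    by (elim minimum_condition_subset) (use Sub.stable_subset in auto)
qed

end

text \<open>A form of the Hopkins--Levitzki theorem.\<close>

lemma rank_if_fin_gen_right_artinian:
  fixes M :: "('l, 'a, 'm, 'x) bimodule_scheme"
  assumes M: "right_module A M" and art: "right_artinian A" and fg: "fin_gen_right_module A M"
  shows "\<exists>(\<l> :: 'm set \<Rightarrow> nat) n.
    (\<forall>X Y. right_submodule A M X \<and> right_submodule A M Y \<and> X \<subset> Y \<longrightarrow> \<l> X < \<l> Y) \<and> (\<forall>X. \<l> X \<le> n)"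
proof -
  interpret M: right_module A M by fact
  have min: "minimum_condition {I. M.A.right_ideal I}"
    by (rule minimum_condition_if_dcc)
      (use art in \<open>simp add: right_artinian_def M.A.right_ideal_iff_right_submodule\<close>)
  interpret A: right_artinian_ring A by (unfold_locales) (rule min)
  obtain F where F: "finite F" "\<forall>n\<in>F. M.A.maximal_right_ideal n"
    "\<forall>n. M.A.maximal_right_ideal n \<longrightarrow> M.A.finite_Int F \<subseteq> n"
    using A.finite_radical by auto
  interpret M: right_module_right_artinian A M F
    by unfold_locales (use F in auto)
  interpret Sub: operator_group M "ract_ops A M" by (rule M.operator_group_ract_ops)
  have "Sub.covered\<^sup>*\<^sup>* {\<zero>\<^bsub>M\<^esub>} (carrier M)"
    by (rule M.composition_series_if_artinian[OF M.artinian_if_fin_gen[OF fg]])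
  then obtain n K where K: "K 0 = {\<zero>\<^bsub>M\<^esub>}" "K n = carrier M" "\<forall>i<n. Sub.covered (K i) (K (Suc i))"
    by (auto dest!: rtranclp_imp_relpowp simp: relpowp_fun_conv)
  have "\<exists>\<l> :: 'm set \<Rightarrow> nat. (\<forall>X Y. Sub.stable X \<and> Sub.stable Y \<and> X \<subset> Y \<longrightarrow> \<l> X < \<l> Y) \<and> (\<forall>X. \<l> X \<le> n)"
    by (rule Sub.rank_if_composition_series[OF K(1,2)]) (use K(3) in simp)
  then show ?thesis unfolding M.stable_iff_right_submodule by auto
qed

section \<open>Tensor products\<close>

abbreviation add_hom :: "('a, 'x) ring_scheme \<Rightarrow> ('b, 'y) ring_scheme \<Rightarrow> ('a \<Rightarrow> 'b) set" where
  "add_hom P Q \<equiv> hom (add_monoid P) (add_monoid Q)"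

lemma add_hom_iff:
  "f \<in> add_hom P Q \<longleftrightarrow> f \<in> carrier P \<rightarrow> carrier Q \<and>
     (\<forall>x\<in>carrier P. \<forall>y\<in>carrier P. f (x \<oplus>\<^bsub>P\<^esub> y) = f x \<oplus>\<^bsub>Q\<^esub> f y)"
  by (auto simp: hom_def)

lemma
  assumes "f \<in> add_hom P Q"
  shows add_hom_closed: "x \<in> carrier P \<Longrightarrow> f x \<in> carrier Q"
    and add_hom_add: "x \<in> carrier P \<Longrightarrow> y \<in> carrier P \<Longrightarrow> f (x \<oplus>\<^bsub>P\<^esub> y) = f x \<oplus>\<^bsub>Q\<^esub> f y"
  using assms by (auto simp: add_hom_iff)

lemma
  assumes P: "abelian_group P" and Q: "abelian_group Q" and f: "f \<in> add_hom P Q"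
  shows add_hom_zero: "f \<zero>\<^bsub>P\<^esub> = \<zero>\<^bsub>Q\<^esub>"
    and add_hom_inv: "x \<in> carrier P \<Longrightarrow> f (\<ominus>\<^bsub>P\<^esub> x) = \<ominus>\<^bsub>Q\<^esub> f x"
    and add_hom_minus: "x \<in> carrier P \<Longrightarrow> y \<in> carrier P \<Longrightarrow> f (x \<ominus>\<^bsub>P\<^esub> y) = f x \<ominus>\<^bsub>Q\<^esub> f y"
proof -
  interpret abelian_group_hom P Q f
    by (intro abelian_group_homI P Q group_hom.intro group_hom_axioms.intro f abelian_group.a_group)
  show "f \<zero>\<^bsub>P\<^esub> = \<zero>\<^bsub>Q\<^esub>" "x \<in> carrier P \<Longrightarrow> f (\<ominus>\<^bsub>P\<^esub> x) = \<ominus>\<^bsub>Q\<^esub> f x"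
    "x \<in> carrier P \<Longrightarrow> y \<in> carrier P \<Longrightarrow> f (x \<ominus>\<^bsub>P\<^esub> y) = f x \<ominus>\<^bsub>Q\<^esub> f y"
    by (simp_all add: a_minus_def)
qed

lemma add_hom_comp: "f \<in> add_hom P Q \<Longrightarrow> g \<in> add_hom Q S \<Longrightarrow> (\<lambda>x. g (f x)) \<in> add_hom P S"
  by (auto simp: add_hom_iff Pi_iff)

lemma add_hom_sum:
  assumes Q: "abelian_group Q" and "f \<in> add_hom P Q" "g \<in> add_hom P Q"
  shows "(\<lambda>x. f x \<oplus>\<^bsub>Q\<^esub> g x) \<in> add_hom P Q"
proof -
  interpret Q: abelian_group Q by fact
  show ?thesis using assms(2,3) by (auto simp: add_hom_iff Pi_iff Q.a_ac)
qed

lemma add_hom_id: "(\<lambda>x. x) \<in> add_hom P P"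
  by (auto simp: add_hom_iff)

lemma left_hom_add_hom: "f \<in> left_hom A M N \<Longrightarrow> f \<in> add_hom M N"
  by (simp add: left_hom_def add_hom_iff)

lemma right_hom_add_hom: "f \<in> right_hom A M N \<Longrightarrow> f \<in> add_hom M N"
  by (simp add: right_hom_def add_hom_iff)

lemma (in right_module) ract_add_hom: "a \<in> carrier A \<Longrightarrow> (\<lambda>x. x \<triangleleft>\<^bsub>M\<^esub> a) \<in> add_hom M M"
  by (simp add: add_hom_iff ract_closed ract_l_distr)

lemma (in left_module) lact_add_hom: "a \<in> carrier A \<Longrightarrow> (\<lambda>x. a \<odot>\<^bsub>M\<^esub> x) \<in> add_hom M M"
  by (simp add: add_hom_iff lact_closed lact_r_distr)

lemma tensor_quotient_hom:
  assumes MN: "right_module A M" "left_module A N"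
  shows "(\<lambda>u. tensor_null A M N #>\<^bsub>free_Abelian_group (carrier M \<times> carrier N)\<^esub> u)
    \<in> hom (free_Abelian_group (carrier M \<times> carrier N)) (add_monoid (tensor A M N))"
  using normal.r_coset_hom_Mod[OF tensor_null_normal[OF MN]]
  by (simp add: tensor_def tensor_group_def hom_def)

lemma abelian_group_tensor:
  assumes MN: "right_module A M" "left_module A N"
  shows "abelian_group (tensor A M N)"
proof -
  interpret G: comm_group "tensor_group A M N"
    unfolding tensor_group_def
    by (rule comm_group.abelian_FactGroup[OF abelian_free_Abelian_group tensor_null_subgroup[OF MN]])
  show ?thesis
  proof (rule abelian_groupI)
    show "\<exists>y\<in>carrier (tensor A M N). y \<oplus>\<^bsub>tensor A M N\<^esub> x = \<zero>\<^bsub>tensor A M N\<^esub>"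
      if "x \<in> carrier (tensor A M N)" for x
      using that G.l_inv_ex by (simp add: tensor_def)
    show "x \<oplus>\<^bsub>tensor A M N\<^esub> y = y \<oplus>\<^bsub>tensor A M N\<^esub> x"
      if "x \<in> carrier (tensor A M N)" "y \<in> carrier (tensor A M N)" for x y
      using that G.m_comm by (simp add: tensor_def)
  qed (simp_all add: tensor_def G.m_assoc)
qed

lemma tensor_carrierE:
  assumes "t \<in> carrier (tensor A M N)"
  obtains u where "u \<in> carrier (free_Abelian_group (carrier M \<times> carrier N))"
    "t = tensor_null A M N #>\<^bsub>free_Abelian_group (carrier M \<times> carrier N)\<^esub> u"
  using assms by (auto simp: tensor_def tensor_group_def FactGroup_def RCOSETS_def)

lemma pure_tensor_closed:
  assumes MN: "right_module A M" "left_module A N" and "m \<in> carrier M" "n \<in> carrier N"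
  shows "pure_tensor A M N m n \<in> carrier (tensor A M N)"
  unfolding pure_tensor_def using hom_in_carrier[OF tensor_quotient_hom[OF MN], of "frag_of (m, n)"] assms
  by simp

lemma tensor_quotient_diff:
  assumes MN: "right_module A M" "left_module A N"
    and ab: "a \<in> carrier (free_Abelian_group (carrier M \<times> carrier N))"
      "b \<in> carrier (free_Abelian_group (carrier M \<times> carrier N))"
  shows "tensor_null A M N #>\<^bsub>free_Abelian_group (carrier M \<times> carrier N)\<^esub> (a - b)
    = (tensor_null A M N #>\<^bsub>free_Abelian_group (carrier M \<times> carrier N)\<^esub> a)
      \<ominus>\<^bsub>tensor A M N\<^esub> (tensor_null A M N #>\<^bsub>free_Abelian_group (carrier M \<times> carrier N)\<^esub> b)"
proof -
  let ?G = "free_Abelian_group (carrier M \<times> carrier N)"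
  let ?q = "\<lambda>u. tensor_null A M N #>\<^bsub>?G\<^esub> u"
  interpret T: abelian_group "tensor A M N" by (rule abelian_group_tensor[OF MN])
  interpret q: group_hom ?G "add_monoid (tensor A M N)" ?q
    by (intro group_hom.intro group_hom_axioms.intro tensor_quotient_hom[OF MN]
        group_free_Abelian_group T.a_group)
  have "?q (a - b) = ?q (a \<otimes>\<^bsub>?G\<^esub> inv\<^bsub>?G\<^esub> b)" using ab by simp
  also have "\<dots> = ?q a \<oplus>\<^bsub>tensor A M N\<^esub> (inv\<^bsub>add_monoid (tensor A M N)\<^esub> ?q b)"
    using q.hom_mult[OF ab(1) group.inv_closed[OF group_free_Abelian_group ab(2)]]
    by (simp only: q.hom_inv[OF ab(2)] monoid.simps)
  finally show ?thesis unfolding a_minus_def a_inv_def .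
qed

text \<open>Elements are integer combinations of pure tensors; the step for differences, unlike one
  for sums, also reaches negative coefficients.\<close>

lemma tensor_induct [consumes 3, case_names zero pure minus]:
  assumes MN: "right_module A M" "left_module A N" and t: "t \<in> carrier (tensor A M N)"
    and zero: "P \<zero>\<^bsub>tensor A M N\<^esub>"
    and pure: "\<And>m n. m \<in> carrier M \<Longrightarrow> n \<in> carrier N \<Longrightarrow> P (pure_tensor A M N m n)"
    and minus: "\<And>s t. s \<in> carrier (tensor A M N) \<Longrightarrow> t \<in> carrier (tensor A M N) \<Longrightarrow> P s \<Longrightarrow> P t
      \<Longrightarrow> P (s \<ominus>\<^bsub>tensor A M N\<^esub> t)"
  shows "P t"
proof -
  let ?G = "free_Abelian_group (carrier M \<times> carrier N)"
  let ?q = "\<lambda>u. tensor_null A M N #>\<^bsub>?G\<^esub> u"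
  interpret T: abelian_group "tensor A M N" by (rule abelian_group_tensor[OF MN])
  interpret q: group_hom ?G "add_monoid (tensor A M N)" ?q
    by (intro group_hom.intro group_hom_axioms.intro tensor_quotient_hom[OF MN]
        group_free_Abelian_group T.a_group)
  obtain u where u: "u \<in> carrier ?G" "t = ?q u" using t by (rule tensor_carrierE)
  have "Poly_Mapping.keys u \<subseteq> carrier M \<times> carrier N" using u(1) by simp
  then have "Poly_Mapping.keys u \<subseteq> carrier M \<times> carrier N \<and> P (?q u)"
  proof (induction u rule: frag_induction)
    case zero
    then show ?case using q.hom_one assms(4) by simp
  next
    case (one x)
    then show ?case using pure[of "fst x" "snd x"] by (auto simp: pure_tensor_def)
  next
    case (diff a b)
    then have ab: "a \<in> carrier ?G" "b \<in> carrier ?G" by auto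
    note tensor_quotient_diff[OF MN ab]
    moreover have "?q a \<in> carrier (tensor A M N)" "?q b \<in> carrier (tensor A M N)"
      using q.hom_closed[OF ab(1)] q.hom_closed[OF ab(2)] by simp_all
    ultimately have "P (?q (a - b))" using minus[of "?q a" "?q b"] diff by simp
    then show ?case using free_Abelian_group_diff[OF ab] by simp
  qed
  then show ?thesis using u(2) by simp
qed

text \<open>The uniqueness half of the universal property. Below, identities between maps out of a
  tensor product are reduced to pure tensors by this rule, with both sides exhibited as additive
  maps by \<open>add_hom_comp\<close> and \<open>add_hom_sum\<close>.\<close>

lemma tensor_hom_eq:
  assumes MN: "right_module A M" "left_module A N" and P: "abelian_group P"
    and fg: "f \<in> add_hom (tensor A M N) P" "g \<in> add_hom (tensor A M N) P"
    and eq: "\<And>m n. m \<in> carrier M \<Longrightarrow> n \<in> carrier N \<Longrightarrow>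
      f (pure_tensor A M N m n) = g (pure_tensor A M N m n)"
    and t: "t \<in> carrier (tensor A M N)"
  shows "f t = g t"
  using MN t
proof (induction rule: tensor_induct)
  case (minus s t)
  then show ?case using fg by (simp add: add_hom_minus[OF abelian_group_tensor[OF MN] P])
qed (use eq fg in \<open>simp_all add: add_hom_zero[OF abelian_group_tensor[OF MN] P]\<close>)

lemma balancedI:
  assumes "\<And>m n. m \<in> carrier M \<Longrightarrow> n \<in> carrier N \<Longrightarrow> \<phi> m n \<in> carrier P"
    and "\<And>x y n. x \<in> carrier M \<Longrightarrow> y \<in> carrier M \<Longrightarrow> n \<in> carrier N \<Longrightarrow> \<phi> (x \<oplus>\<^bsub>M\<^esub> y) n = \<phi> x n \<oplus>\<^bsub>P\<^esub> \<phi> y n"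
    and "\<And>m x y. m \<in> carrier M \<Longrightarrow> x \<in> carrier N \<Longrightarrow> y \<in> carrier N \<Longrightarrow> \<phi> m (x \<oplus>\<^bsub>N\<^esub> y) = \<phi> m x \<oplus>\<^bsub>P\<^esub> \<phi> m y"
    and "\<And>m a n. m \<in> carrier M \<Longrightarrow> a \<in> carrier A \<Longrightarrow> n \<in> carrier N \<Longrightarrow> \<phi> (m \<triangleleft>\<^bsub>M\<^esub> a) n = \<phi> m (a \<odot>\<^bsub>N\<^esub> n)"
  shows "balanced A M N P \<phi>"
  using assms unfolding balanced_def by auto

lemma balanced_pure_tensor:
  assumes MN: "right_module A M" "left_module A N"
  shows "balanced A M N (tensor A M N) (pure_tensor A M N)"
proof -
  let ?G = "free_Abelian_group (carrier M \<times> carrier N)"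
  let ?q = "\<lambda>u. tensor_null A M N #>\<^bsub>?G\<^esub> u"
  interpret M: right_module A M by (rule MN)
  interpret N: left_module A N by (rule MN)
  interpret T: abelian_group "tensor A M N" by (rule abelian_group_tensor[OF MN])
  interpret q: group_hom ?G "add_monoid (tensor A M N)" ?q
    by (intro group_hom.intro group_hom_axioms.intro tensor_quotient_hom[OF MN]
        group_free_Abelian_group T.a_group)
  have null: "?q u = \<zero>\<^bsub>tensor A M N\<^esub>" if "u \<in> tensor_relations A M N" for u
  proof -
    have "u \<in> tensor_null A M N" unfolding tensor_null_def using that by (rule generate.incl)
    then have "?q u = tensor_null A M N"
      using group.coset_join2[OF group_free_Abelian_group _ tensor_null_subgroup[OF MN]]
        subgroup.mem_carrier[OF tensor_null_subgroup[OF MN]] by blast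
    then show ?thesis by (simp add: tensor_def tensor_group_def FactGroup_def)
  qed
  note diff = tensor_quotient_diff[OF MN]
  have fr: "frag_of (m, n) \<in> carrier ?G" if "m \<in> carrier M" "n \<in> carrier N" for m n using that by simp
  have cl: "?q (frag_of (m, n)) \<in> carrier (tensor A M N)" if "m \<in> carrier M" "n \<in> carrier N" for m n
    using q.hom_closed[OF fr[OF that]] by simp
  have eq: "a = b \<oplus>\<^bsub>tensor A M N\<^esub> c"
    if "a \<ominus>\<^bsub>tensor A M N\<^esub> b \<ominus>\<^bsub>tensor A M N\<^esub> c = \<zero>\<^bsub>tensor A M N\<^esub>"
      "a \<in> carrier (tensor A M N)" "b \<in> carrier (tensor A M N)" "c \<in> carrier (tensor A M N)" for a b c
  proof -
    have "a \<ominus>\<^bsub>tensor A M N\<^esub> b = c"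
      using that T.minus_equality[of "a \<ominus>\<^bsub>tensor A M N\<^esub> b" "\<ominus>\<^bsub>tensor A M N\<^esub> c"] T.minus_minus[of c]
      by (simp add: a_minus_def)
    then have "c \<oplus>\<^bsub>tensor A M N\<^esub> b = a" using that by (auto simp: a_minus_def T.a_assoc T.l_neg)
    then show ?thesis using that T.a_comm[of b c] by simp
  qed
  have eq2: "a = b"
    if "a \<ominus>\<^bsub>tensor A M N\<^esub> b = \<zero>\<^bsub>tensor A M N\<^esub>" "a \<in> carrier (tensor A M N)" "b \<in> carrier (tensor A M N)" for a b
    using that T.minus_equality[of a "\<ominus>\<^bsub>tensor A M N\<^esub> b"] T.minus_minus[of b] by (simp add: a_minus_def)
  have "pure_tensor A M N (x \<oplus>\<^bsub>M\<^esub> y) n = pure_tensor A M N x n \<oplus>\<^bsub>tensor A M N\<^esub> pure_tensor A M N y n"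
    if xyn: "x \<in> carrier M" "y \<in> carrier M" "n \<in> carrier N" for x y n
  proof -
    have "frag_of (x \<oplus>\<^bsub>M\<^esub> y, n) - frag_of (x, n) - frag_of (y, n) \<in> tensor_relations A M N"
      unfolding tensor_relations_def
      by (intro UnI1 CollectI exI[of _ x] exI[of _ y] exI[of _ n] conjI refl xyn)
    from null[OF this] show ?thesis
      unfolding pure_tensor_def using xyn fr
      by (intro eq cl) (simp_all add: diff free_Abelian_group_diff del: carrier_free_Abelian_group_iff)
  qed
  moreover have "pure_tensor A M N m (x \<oplus>\<^bsub>N\<^esub> y) = pure_tensor A M N m x \<oplus>\<^bsub>tensor A M N\<^esub> pure_tensor A M N m y"
    if xym: "x \<in> carrier N" "y \<in> carrier N" "m \<in> carrier M" for x y m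
  proof -
    have "frag_of (m, x \<oplus>\<^bsub>N\<^esub> y) - frag_of (m, x) - frag_of (m, y) \<in> tensor_relations A M N"
      unfolding tensor_relations_def
      by (rule UnI1, intro UnI2 CollectI exI[of _ m] exI[of _ x] exI[of _ y] conjI refl xym)
    from null[OF this] show ?thesis
      unfolding pure_tensor_def using xym fr
      by (intro eq cl) (simp_all add: diff free_Abelian_group_diff del: carrier_free_Abelian_group_iff)
  qed
  moreover have "pure_tensor A M N (m \<triangleleft>\<^bsub>M\<^esub> a) n = pure_tensor A M N m (a \<odot>\<^bsub>N\<^esub> n)"
    if man: "m \<in> carrier M" "a \<in> carrier A" "n \<in> carrier N" for m a n
  proof -
    have "frag_of (m \<triangleleft>\<^bsub>M\<^esub> a, n) - frag_of (m, a \<odot>\<^bsub>N\<^esub> n) \<in> tensor_relations A M N"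
      unfolding tensor_relations_def
      by (intro UnI2 CollectI exI[of _ m] exI[of _ a] exI[of _ n] conjI refl man)
    from null[OF this]
    have "?q (frag_of (m \<triangleleft>\<^bsub>M\<^esub> a, n)) \<ominus>\<^bsub>tensor A M N\<^esub> ?q (frag_of (m, a \<odot>\<^bsub>N\<^esub> n)) = \<zero>\<^bsub>tensor A M N\<^esub>"
      unfolding diff[OF fr[OF M.ract_closed[OF man(1,2)] man(3)] fr[OF man(1) N.lact_closed[OF man(2,3)]]] .
    then show ?thesis
      unfolding pure_tensor_def
      by (rule eq2) (intro cl man M.ract_closed N.lact_closed)+
  qed
  ultimately show ?thesis
    by (intro balancedI pure_tensor_closed[OF MN]) simp_all
qed

lemma
  assumes MN: "right_module A M" "left_module A N"
  shows pure_tensor_add_left: "x \<in> carrier M \<Longrightarrow> y \<in> carrier M \<Longrightarrow> n \<in> carrier N \<Longrightarrow>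
      pure_tensor A M N (x \<oplus>\<^bsub>M\<^esub> y) n = pure_tensor A M N x n \<oplus>\<^bsub>tensor A M N\<^esub> pure_tensor A M N y n"
    and pure_tensor_add_right: "m \<in> carrier M \<Longrightarrow> u \<in> carrier N \<Longrightarrow> v \<in> carrier N \<Longrightarrow>
      pure_tensor A M N m (u \<oplus>\<^bsub>N\<^esub> v) = pure_tensor A M N m u \<oplus>\<^bsub>tensor A M N\<^esub> pure_tensor A M N m v"
    and pure_tensor_balance: "m \<in> carrier M \<Longrightarrow> a \<in> carrier A \<Longrightarrow> n \<in> carrier N \<Longrightarrow>
      pure_tensor A M N (m \<triangleleft>\<^bsub>M\<^esub> a) n = pure_tensor A M N m (a \<odot>\<^bsub>N\<^esub> n)"
  using balanced_pure_tensor[OF MN] unfolding balanced_def by auto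

lemma tensor_lift_codomain_cong:
  assumes "carrier P = carrier Q" "add P = add Q" "\<zero>\<^bsub>P\<^esub> = \<zero>\<^bsub>Q\<^esub>"
  shows "tensor_lift P \<phi> = tensor_lift Q \<phi>"
  using assms
  by (intro ext) (simp add: tensor_lift_def tensor_eval_def finsum_def finprod_def add_pow_def int_pow_def
      nat_pow_def m_inv_def Let_def cong: if_cong)

subsection \<open>Module structure and functoriality\<close>

locale tensor_pair = M?: right_module A M + N?: left_module A N
  for A :: "('a, 'z) ring_scheme" and M :: "('l, 'a, 'm, 'x) bimodule_scheme"
    and N :: "('a, 'b, 'n, 'y) bimodule_scheme"
begin

lemmas MN = M.right_module_axioms N.left_module_axioms

sublocale T: abelian_group "tensor A M N" by (rule abelian_group_tensor[OF MN])

lemmas pure_closed = pure_tensor_closed[OF MN]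
  and hom_eq = tensor_hom_eq[OF MN]
  and lift_hom = tensor_lift_hom[OF MN]
  and lift_pure = tensor_lift_pure[OF MN]
  and add_left = pure_tensor_add_left[OF MN]
  and add_right = pure_tensor_add_right[OF MN]
  and balance = pure_tensor_balance[OF MN]

lemma balanced_map:
  assumes "tensor_pair A M' N'" "f \<in> right_hom A M M'" "g \<in> left_hom A N N'"
  shows "balanced A M N (tensor A M' N') (\<lambda>m n. pure_tensor A M' N' (f m) (g n))"
proof -
  interpret T': tensor_pair A M' N' by fact
  show ?thesis
    using assms(2,3) T'.pure_closed T'.add_left T'.add_right T'.balance
    by (intro balancedI) (auto simp: right_hom_def left_hom_def Pi_iff)
qed

lemma
  assumes "tensor_pair A M' N'" "f \<in> right_hom A M M'" "g \<in> left_hom A N N'"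
  shows map_hom: "tensor_map A M' N' f g \<in> add_hom (tensor A M N) (tensor A M' N')"
    and map_pure: "m \<in> carrier M \<Longrightarrow> n \<in> carrier N \<Longrightarrow>
      tensor_map A M' N' f g (pure_tensor A M N m n) = pure_tensor A M' N' (f m) (g n)"
proof -
  interpret T': tensor_pair A M' N' by fact
  note bal = balanced_map[OF assms]
  show "tensor_map A M' N' f g \<in> add_hom (tensor A M N) (tensor A M' N')"
    unfolding tensor_map_def by (rule lift_hom[OF T'.T.abelian_group_axioms bal])
  show "m \<in> carrier M \<Longrightarrow> n \<in> carrier N \<Longrightarrow>
      tensor_map A M' N' f g (pure_tensor A M N m n) = pure_tensor A M' N' (f m) (g n)"
    unfolding tensor_map_def by (rule lift_pure[OF T'.T.abelian_group_axioms bal])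
qed

lemma map_cong:
  assumes "tensor_pair A M' N'" "f \<in> right_hom A M M'" "g \<in> left_hom A N N'"
    and "f' \<in> right_hom A M M'" "g' \<in> left_hom A N N'"
    and "\<And>x. x \<in> carrier M \<Longrightarrow> f x = f' x" "\<And>x. x \<in> carrier N \<Longrightarrow> g x = g' x"
    and "z \<in> carrier (tensor A M N)"
  shows "tensor_map A M' N' f g z = tensor_map A M' N' f' g' z"
proof -
  interpret T': tensor_pair A M' N' by fact
  show ?thesis
    by (rule hom_eq[OF T'.T.abelian_group_axioms map_hom[OF assms(1-3)] map_hom[OF assms(1,4,5)] _ assms(8)])
      (simp add: map_pure[OF assms(1-3)] map_pure[OF assms(1,4,5)] assms(6,7))
qed

lemma balanced_ract:
  assumes f: "f \<in> left_hom A N (regular_bimodule A)"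
  shows "balanced A M N M (\<lambda>x c. x \<triangleleft>\<^bsub>M\<^esub> f c)"
  using f M.ract_closed M.ract_l_distr M.ract_r_distr M.ract_assoc
  by (intro balancedI) (auto simp: left_hom_def regular_bimodule_def Pi_iff)

text \<open>id \<otimes> f followed by the identification of M \<otimes> A with M. Slices act as
  coordinates of a tensor.\<close>

abbreviation slice :: "('n \<Rightarrow> 'a) \<Rightarrow> ('m \<times> 'n \<Rightarrow>\<^sub>0 int) set \<Rightarrow> 'm" where
  "slice f \<equiv> tensor_lift M (\<lambda>x c. x \<triangleleft>\<^bsub>M\<^esub> f c)"

lemma
  assumes "f \<in> left_hom A N (regular_bimodule A)"
  shows slice_hom: "slice f \<in> add_hom (tensor A M N) M"
    and slice_pure: "m \<in> carrier M \<Longrightarrow> n \<in> carrier N \<Longrightarrow> slice f (pure_tensor A M N m n) = m \<triangleleft>\<^bsub>M\<^esub> f n"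
  by (rule lift_hom[OF M.M.abelian_group_axioms balanced_ract[OF assms]])
    (rule lift_pure[OF M.M.abelian_group_axioms balanced_ract[OF assms]])

end

lemma slice_natural:
  assumes T: "tensor_pair A M N" and T': "tensor_pair A M' N"
    and g: "g \<in> right_hom A M M'" and f: "f \<in> left_hom A N (regular_bimodule A)"
    and z: "z \<in> carrier (tensor A M N)"
  shows "tensor_lift M' (\<lambda>x c. x \<triangleleft>\<^bsub>M'\<^esub> f c) (tensor_map A M' N g (\<lambda>x. x) z)
    = g (tensor_lift M (\<lambda>x c. x \<triangleleft>\<^bsub>M\<^esub> f c) z)"
proof -
  interpret T: tensor_pair A M N by fact
  interpret T': tensor_pair A M' N by fact
  have id: "(\<lambda>x. x) \<in> left_hom A N N" by (auto simp: left_hom_def)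
  have gc: "g x \<in> carrier M'" if "x \<in> carrier M" for x using g that by (auto simp: right_hom_def)
  have fc: "f x \<in> carrier A" if "x \<in> carrier N" for x
    using f that by (auto simp: left_hom_def regular_bimodule_def)
  show ?thesis
    by (rule T.hom_eq[OF T'.M.M.abelian_group_axioms
          add_hom_comp[OF T.map_hom[OF T' g id] T'.slice_hom[OF f]]
          add_hom_comp[OF T.slice_hom[OF f] right_hom_add_hom[OF g]] _ z])
      (use g in \<open>simp add: T.map_pure[OF T' g id] T'.slice_pure[OF f] T.slice_pure[OF f] gc fc right_hom_def\<close>)
qed

text \<open>The actions stored in \<open>tensor\<close> are defined by lifts into
  \<open>tensor_ab\<close>, since \<open>tensor\<close> cannot refer to itself. A lift reads only
  the additive group of its codomain, so both may be exchanged.\<close>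

lemma tensor_ab_lift: "tensor_lift (tensor_ab A M N) \<phi> = tensor_lift (tensor A M N) \<phi>"
  by (rule tensor_lift_codomain_cong) (simp_all add: tensor_def tensor_ab_def)

locale tensor_left = M?: bimodule B A M + N?: left_module A N
  for B :: "('b, 'w) ring_scheme" and A :: "('a, 'z) ring_scheme"
    and M :: "('b, 'a, 'm, 'x) bimodule_scheme" and N :: "('a, 'c, 'n, 'y) bimodule_scheme"
begin

sublocale tensor_pair A M N ..

lemma balanced_lact:
  assumes "b \<in> carrier B"
  shows "balanced A M N (tensor A M N) (\<lambda>m n. pure_tensor A M N (b \<odot>\<^bsub>M\<^esub> m) n)"
  using assms pure_closed add_left add_right
  by (intro balancedI)
    (auto simp: M.L.lact_closed M.L.lact_r_distr M.lact_ract[symmetric] balance M.R.ract_closed N.lact_closed)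

lemma lact_eq: "b \<odot>\<^bsub>tensor A M N\<^esub> t = tensor_lift (tensor A M N) (\<lambda>m n. pure_tensor A M N (b \<odot>\<^bsub>M\<^esub> m) n) t"
  unfolding tensor_ab_lift[symmetric] by (simp add: tensor_def)

lemma
  assumes "b \<in> carrier B"
  shows lact_hom: "(\<lambda>t. b \<odot>\<^bsub>tensor A M N\<^esub> t) \<in> add_hom (tensor A M N) (tensor A M N)"
    and lact_pure: "m \<in> carrier M \<Longrightarrow> n \<in> carrier N \<Longrightarrow>
      b \<odot>\<^bsub>tensor A M N\<^esub> pure_tensor A M N m n = pure_tensor A M N (b \<odot>\<^bsub>M\<^esub> m) n"
  unfolding lact_eq
  by (rule lift_hom[OF T.abelian_group_axioms balanced_lact[OF assms]])
    (rule lift_pure[OF T.abelian_group_axioms balanced_lact[OF assms]])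

lemma left_module_tensor: "left_module B (tensor A M N)"
proof (intro left_module.intro left_module_axioms.intro T.abelian_group_axioms M.L.A.ring_axioms)
  fix a b t s
  assume a: "a \<in> carrier B" and t: "t \<in> carrier (tensor A M N)"
  show "a \<odot>\<^bsub>tensor A M N\<^esub> t \<in> carrier (tensor A M N)" by (rule add_hom_closed[OF lact_hom[OF a] t])
  show "a \<odot>\<^bsub>tensor A M N\<^esub> (t \<oplus>\<^bsub>tensor A M N\<^esub> s) = a \<odot>\<^bsub>tensor A M N\<^esub> t \<oplus>\<^bsub>tensor A M N\<^esub> a \<odot>\<^bsub>tensor A M N\<^esub> s"
    if "s \<in> carrier (tensor A M N)"
    by (rule add_hom_add[OF lact_hom[OF a] t that])
  assume b: "b \<in> carrier B"
  have ab: "a \<oplus>\<^bsub>B\<^esub> b \<in> carrier B" "a \<otimes>\<^bsub>B\<^esub> b \<in> carrier B" using a b by auto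
  show "(a \<oplus>\<^bsub>B\<^esub> b) \<odot>\<^bsub>tensor A M N\<^esub> t = a \<odot>\<^bsub>tensor A M N\<^esub> t \<oplus>\<^bsub>tensor A M N\<^esub> b \<odot>\<^bsub>tensor A M N\<^esub> t"
    by (rule hom_eq[OF T.abelian_group_axioms lact_hom[OF ab(1)]
          add_hom_sum[OF T.abelian_group_axioms lact_hom[OF a] lact_hom[OF b]] _ t])
      (simp add: lact_pure a b ab M.L.lact_l_distr M.L.lact_closed add_left)
  show "(a \<otimes>\<^bsub>B\<^esub> b) \<odot>\<^bsub>tensor A M N\<^esub> t = a \<odot>\<^bsub>tensor A M N\<^esub> (b \<odot>\<^bsub>tensor A M N\<^esub> t)"
    by (rule hom_eq[OF T.abelian_group_axioms lact_hom[OF ab(2)] add_hom_comp[OF lact_hom[OF b] lact_hom[OF a]] _ t])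
      (simp add: lact_pure a b ab M.L.lact_assoc M.L.lact_closed)
next
  fix t assume t: "t \<in> carrier (tensor A M N)"
  have 1: "\<one>\<^bsub>B\<^esub> \<in> carrier B" by simp
  show "\<one>\<^bsub>B\<^esub> \<odot>\<^bsub>tensor A M N\<^esub> t = t"
    by (rule hom_eq[OF T.abelian_group_axioms lact_hom[OF 1] add_hom_id _ t]) (simp add: lact_pure M.L.lact_one)
qed

lemma slice_left_hom:
  assumes f: "f \<in> left_hom A N (regular_bimodule A)"
  shows "slice f \<in> left_hom B (tensor A M N) M"
proof -
  have fc: "f x \<in> carrier A" if "x \<in> carrier N" for x
    using f that by (auto simp: left_hom_def regular_bimodule_def)
  have "slice f (b \<odot>\<^bsub>tensor A M N\<^esub> t) = b \<odot>\<^bsub>M\<^esub> slice f t"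
    if b: "b \<in> carrier B" and t: "t \<in> carrier (tensor A M N)" for b t
    by (rule hom_eq[OF M.L.M.abelian_group_axioms add_hom_comp[OF lact_hom[OF b] slice_hom[OF f]]
          add_hom_comp[OF slice_hom[OF f] M.L.lact_add_hom[OF b]] _ t])
      (simp add: lact_pure b slice_pure[OF f] M.L.lact_closed M.lact_ract fc)
  then show ?thesis using slice_hom[OF f] by (auto simp: left_hom_def add_hom_iff)
qed

end

locale tensor_right = M?: right_module A M + N?: bimodule A B N
  for B :: "('b, 'w) ring_scheme" and A :: "('a, 'z) ring_scheme"
    and M :: "('l, 'a, 'm, 'x) bimodule_scheme" and N :: "('a, 'b, 'n, 'y) bimodule_scheme"
begin

sublocale tensor_pair A M N ..

lemma balanced_ract_right:
  assumes "b \<in> carrier B"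
  shows "balanced A M N (tensor A M N) (\<lambda>m n. pure_tensor A M N m (n \<triangleleft>\<^bsub>N\<^esub> b))"
  using assms pure_closed add_left add_right
  by (intro balancedI)
    (auto simp: N.R.ract_closed N.R.ract_l_distr N.lact_ract balance N.L.lact_closed M.ract_closed)

lemma ract_eq: "t \<triangleleft>\<^bsub>tensor A M N\<^esub> b = tensor_lift (tensor A M N) (\<lambda>m n. pure_tensor A M N m (n \<triangleleft>\<^bsub>N\<^esub> b)) t"
  unfolding tensor_ab_lift[symmetric] by (simp add: tensor_def)

lemma
  assumes "b \<in> carrier B"
  shows ract_hom: "(\<lambda>t. t \<triangleleft>\<^bsub>tensor A M N\<^esub> b) \<in> add_hom (tensor A M N) (tensor A M N)"
    and ract_pure: "m \<in> carrier M \<Longrightarrow> n \<in> carrier N \<Longrightarrow>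
      pure_tensor A M N m n \<triangleleft>\<^bsub>tensor A M N\<^esub> b = pure_tensor A M N m (n \<triangleleft>\<^bsub>N\<^esub> b)"
  unfolding ract_eq
  by (rule lift_hom[OF T.abelian_group_axioms balanced_ract_right[OF assms]])
    (rule lift_pure[OF T.abelian_group_axioms balanced_ract_right[OF assms]])

lemma right_module_tensor: "right_module B (tensor A M N)"
proof (intro right_module.intro right_module_axioms.intro T.abelian_group_axioms N.R.A.ring_axioms)
  fix a b t s
  assume t: "t \<in> carrier (tensor A M N)" and a: "a \<in> carrier B"
  show "t \<triangleleft>\<^bsub>tensor A M N\<^esub> a \<in> carrier (tensor A M N)" by (rule add_hom_closed[OF ract_hom[OF a] t])
  assume b: "b \<in> carrier B"
  have ab: "a \<oplus>\<^bsub>B\<^esub> b \<in> carrier B" "a \<otimes>\<^bsub>B\<^esub> b \<in> carrier B" using a b by auto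
  show "t \<triangleleft>\<^bsub>tensor A M N\<^esub> (a \<oplus>\<^bsub>B\<^esub> b) = t \<triangleleft>\<^bsub>tensor A M N\<^esub> a \<oplus>\<^bsub>tensor A M N\<^esub> t \<triangleleft>\<^bsub>tensor A M N\<^esub> b"
    by (rule hom_eq[OF T.abelian_group_axioms ract_hom[OF ab(1)]
          add_hom_sum[OF T.abelian_group_axioms ract_hom[OF a] ract_hom[OF b]] _ t])
      (simp add: ract_pure a b ab N.R.ract_r_distr N.R.ract_closed add_right)
  show "t \<triangleleft>\<^bsub>tensor A M N\<^esub> (a \<otimes>\<^bsub>B\<^esub> b) = (t \<triangleleft>\<^bsub>tensor A M N\<^esub> a) \<triangleleft>\<^bsub>tensor A M N\<^esub> b"
    by (rule hom_eq[OF T.abelian_group_axioms ract_hom[OF ab(2)] add_hom_comp[OF ract_hom[OF a] ract_hom[OF b]] _ t])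
      (simp add: ract_pure a b ab N.R.ract_assoc N.R.ract_closed)
next
  fix t s a assume "t \<in> carrier (tensor A M N)" "s \<in> carrier (tensor A M N)" "a \<in> carrier B"
  then show "(t \<oplus>\<^bsub>tensor A M N\<^esub> s) \<triangleleft>\<^bsub>tensor A M N\<^esub> a = t \<triangleleft>\<^bsub>tensor A M N\<^esub> a \<oplus>\<^bsub>tensor A M N\<^esub> s \<triangleleft>\<^bsub>tensor A M N\<^esub> a"
    using add_hom_add[OF ract_hom] by blast
next
  fix t assume t: "t \<in> carrier (tensor A M N)"
  have 1: "\<one>\<^bsub>B\<^esub> \<in> carrier B" by simp
  show "t \<triangleleft>\<^bsub>tensor A M N\<^esub> \<one>\<^bsub>B\<^esub> = t"
    by (rule hom_eq[OF T.abelian_group_axioms ract_hom[OF 1] add_hom_id _ t]) (simp add: ract_pure N.R.ract_one)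
qed

end

lemma tensor_map_right_hom:
  assumes T: "tensor_right B A M N" and T': "tensor_right B A M' N" and g: "g \<in> right_hom A M M'"
  shows "tensor_map A M' N g (\<lambda>x. x) \<in> right_hom B (tensor A M N) (tensor A M' N)"
proof -
  interpret T: tensor_right B A M N by fact
  interpret T': tensor_right B A M' N by fact
  have id: "(\<lambda>x. x) \<in> left_hom A N N" by (auto simp: left_hom_def)
  have tp: "tensor_pair A M' N" ..
  note h = T.map_hom[OF tp g id]
  have gc: "g x \<in> carrier M'" if "x \<in> carrier M" for x using g that by (auto simp: right_hom_def)
  have "tensor_map A M' N g (\<lambda>x. x) (t \<triangleleft>\<^bsub>tensor A M N\<^esub> b) = tensor_map A M' N g (\<lambda>x. x) t \<triangleleft>\<^bsub>tensor A M' N\<^esub> b"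
    if b: "b \<in> carrier B" and t: "t \<in> carrier (tensor A M N)" for b t
    by (rule T.hom_eq[OF T'.T.abelian_group_axioms add_hom_comp[OF T.ract_hom[OF b] h]
          add_hom_comp[OF h T'.ract_hom[OF b]] _ t])
      (simp add: T.ract_pure T'.ract_pure b T.map_pure[OF tp g id] gc T.N.R.ract_closed)
  then show ?thesis using h by (auto simp: right_hom_def add_hom_iff)
qed

section \<open>Finite rank approximation of the identity\<close>

text \<open>The rule \<open>cong\<close> disregards values outside the carrier, so that a
  finite-rank map may be given by any formula valid on it.\<close>

inductive_set fin_rank :: "('a, 'z) ring_scheme \<Rightarrow> ('a, 'w, 'x) module_scheme \<Rightarrow> ('w \<Rightarrow> 'w) set"
  for A and W where
  rank_one: "f \<in> left_hom A W (regular_bimodule A) \<Longrightarrow> w \<in> carrier W \<Longrightarrow> (\<lambda>x. f x \<odot>\<^bsub>W\<^esub> w) \<in> fin_rank A W"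
| add: "S \<in> fin_rank A W \<Longrightarrow> T \<in> fin_rank A W \<Longrightarrow> (\<lambda>x. S x \<oplus>\<^bsub>W\<^esub> T x) \<in> fin_rank A W"
| cong: "S \<in> fin_rank A W \<Longrightarrow> (\<And>x. x \<in> carrier W \<Longrightarrow> T x = S x) \<Longrightarrow> T \<in> fin_rank A W"

text \<open>A local dual basis: x is a finite sum of terms f(x) w. It is stated for a single
  element; \<open>fin_rank_fixing_finite\<close> passes to finitely many.\<close>

definition locally_fin_rank :: "('a, 'z) ring_scheme \<Rightarrow> ('a, 'w, 'x) module_scheme \<Rightarrow> bool" where
  "locally_fin_rank A W \<longleftrightarrow> (\<forall>x\<in>carrier W. \<exists>T\<in>fin_rank A W. T x = x)"

lemma regular_bimodule_simps [simp]:
  "carrier (regular_bimodule A) = carrier A" "add (regular_bimodule A) = add A"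
  "\<zero>\<^bsub>regular_bimodule A\<^esub> = \<zero>\<^bsub>A\<^esub>" "smult (regular_bimodule A) = monoid.mult A"
  "ract (regular_bimodule A) = monoid.mult A"
  by (simp_all add: regular_bimodule_def)

lemma left_homI:
  assumes "\<And>x. x \<in> carrier M \<Longrightarrow> f x \<in> carrier N"
    and "\<And>x y. x \<in> carrier M \<Longrightarrow> y \<in> carrier M \<Longrightarrow> f (x \<oplus>\<^bsub>M\<^esub> y) = f x \<oplus>\<^bsub>N\<^esub> f y"
    and "\<And>a x. a \<in> carrier A \<Longrightarrow> x \<in> carrier M \<Longrightarrow> f (a \<odot>\<^bsub>M\<^esub> x) = a \<odot>\<^bsub>N\<^esub> f x"
  shows "f \<in> left_hom A M N"
  using assms by (simp add: left_hom_def)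

lemma
  assumes "f \<in> left_hom A M N"
  shows left_hom_closed: "x \<in> carrier M \<Longrightarrow> f x \<in> carrier N"
    and left_hom_add: "x \<in> carrier M \<Longrightarrow> y \<in> carrier M \<Longrightarrow> f (x \<oplus>\<^bsub>M\<^esub> y) = f x \<oplus>\<^bsub>N\<^esub> f y"
    and left_hom_lact: "a \<in> carrier A \<Longrightarrow> x \<in> carrier M \<Longrightarrow> f (a \<odot>\<^bsub>M\<^esub> x) = a \<odot>\<^bsub>N\<^esub> f x"
  using assms by (auto simp: left_hom_def)

lemma right_homI:
  assumes "\<And>x. x \<in> carrier M \<Longrightarrow> f x \<in> carrier N"
    and "\<And>x y. x \<in> carrier M \<Longrightarrow> y \<in> carrier M \<Longrightarrow> f (x \<oplus>\<^bsub>M\<^esub> y) = f x \<oplus>\<^bsub>N\<^esub> f y"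
    and "\<And>x a. x \<in> carrier M \<Longrightarrow> a \<in> carrier A \<Longrightarrow> f (x \<triangleleft>\<^bsub>M\<^esub> a) = f x \<triangleleft>\<^bsub>N\<^esub> a"
  shows "f \<in> right_hom A M N"
  using assms by (simp add: right_hom_def)

lemma
  assumes "f \<in> right_hom A M N"
  shows right_hom_closed: "x \<in> carrier M \<Longrightarrow> f x \<in> carrier N"
    and right_hom_add: "x \<in> carrier M \<Longrightarrow> y \<in> carrier M \<Longrightarrow> f (x \<oplus>\<^bsub>M\<^esub> y) = f x \<oplus>\<^bsub>N\<^esub> f y"
    and right_hom_ract: "x \<in> carrier M \<Longrightarrow> a \<in> carrier A \<Longrightarrow> f (x \<triangleleft>\<^bsub>M\<^esub> a) = f x \<triangleleft>\<^bsub>N\<^esub> a"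
  using assms by (auto simp: right_hom_def)

lemma left_hom_comp: "f \<in> left_hom A M N \<Longrightarrow> g \<in> left_hom A N P \<Longrightarrow> (\<lambda>x. g (f x)) \<in> left_hom A M P"
  by (auto simp: left_hom_def Pi_iff)

lemma left_hom_id: "(\<lambda>x. x) \<in> left_hom A M M"
  by (simp add: left_hom_def)

lemma right_hom_id: "(\<lambda>x. x) \<in> right_hom A M M"
  by (simp add: right_hom_def)

context left_module
begin

lemma zero_lact:
  assumes "x \<in> carrier M" shows "\<zero>\<^bsub>A\<^esub> \<odot>\<^bsub>M\<^esub> x = \<zero>\<^bsub>M\<^esub>"
proof -
  have "(\<lambda>a. a \<odot>\<^bsub>M\<^esub> x) \<in> add_hom A M" using assms by (simp add: add_hom_iff lact_closed lact_l_distr)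
  then show ?thesis by (rule add_hom_zero[OF A.abelian_group_axioms M.abelian_group_axioms])
qed

lemma lact_inv: "a \<in> carrier A \<Longrightarrow> x \<in> carrier M \<Longrightarrow> a \<odot>\<^bsub>M\<^esub> (\<ominus>\<^bsub>M\<^esub> x) = \<ominus>\<^bsub>M\<^esub> (a \<odot>\<^bsub>M\<^esub> x)"
  by (rule add_hom_inv[OF M.abelian_group_axioms M.abelian_group_axioms lact_add_hom])

lemma left_hom_uminus: "(\<lambda>x. \<ominus>\<^bsub>M\<^esub> x) \<in> left_hom A M M"
  by (rule left_homI) (simp_all add: M.minus_add lact_inv)

lemma left_hom_sum:
  assumes "f \<in> left_hom A N M" "g \<in> left_hom A N M"
  shows "(\<lambda>x. f x \<oplus>\<^bsub>M\<^esub> g x) \<in> left_hom A N M"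
  using add_hom_sum[OF M.abelian_group_axioms assms[THEN left_hom_add_hom]] assms
  by (auto simp: left_hom_def add_hom_iff Pi_iff lact_r_distr)

lemma fin_rank_left_hom: "T \<in> fin_rank A M \<Longrightarrow> T \<in> left_hom A M M"
proof (induction rule: fin_rank.induct)
  case (rank_one f w)
  then show ?case
    by (intro left_homI) (simp_all add: left_hom_def Pi_iff lact_closed lact_l_distr lact_assoc)
next
  case (cong S T)
  then show ?case by (simp add: left_hom_def Pi_iff lact_closed)
qed (rule left_hom_sum)

lemma fin_rank_comp_right:
  assumes h: "h \<in> left_hom A M M"
  shows "T \<in> fin_rank A M \<Longrightarrow> (\<lambda>x. T (h x)) \<in> fin_rank A M"
proof (induction rule: fin_rank.induct)
  case (rank_one f w)
  then show ?case using fin_rank.rank_one[OF left_hom_comp[OF h rank_one(1)]] by simp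
next
  case (add S T)
  then show ?case using fin_rank.add by blast
next
  case (cong S T)
  show ?case by (rule fin_rank.cong[OF cong.IH]) (simp add: cong left_hom_closed[OF h])
qed

lemma fin_rank_zero: "(\<lambda>x. \<zero>\<^bsub>M\<^esub>) \<in> fin_rank A M"
proof -
  have "(\<lambda>x. \<zero>\<^bsub>A\<^esub>) \<in> left_hom A M (regular_bimodule A)" by (rule left_homI) simp_all
  then have "(\<lambda>x. \<zero>\<^bsub>A\<^esub> \<odot>\<^bsub>M\<^esub> \<zero>\<^bsub>M\<^esub>) \<in> fin_rank A M" by (rule fin_rank.rank_one) simp
  then show ?thesis by (simp add: zero_lact)
qed

text \<open>If \<open>T\<close> fixes \<open>F\<close> and \<open>S\<close> fixes \<open>y - T y\<close> then \<open>T + S \<circ> (1 - T)\<close> fixes \<open>F\<close> and \<open>y\<close>.\<close>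

lemma fin_rank_fixing_finite:
  assumes lfr: "locally_fin_rank A M" and "finite F" "F \<subseteq> carrier M"
  shows "\<exists>T\<in>fin_rank A M. \<forall>x\<in>F. T x = x"
  using assms(2,3)
proof (induction F rule: finite_induct)
  case empty
  then show ?case using fin_rank_zero by auto
next
  case (insert y F)
  then obtain T where T: "T \<in> fin_rank A M" "\<And>x. x \<in> F \<Longrightarrow> T x = x" by auto
  note Tc = left_hom_closed[OF fin_rank_left_hom[OF T(1)]]
  have y: "y \<in> carrier M" using insert.prems by simp
  let ?h = "\<lambda>x. x \<oplus>\<^bsub>M\<^esub> (\<ominus>\<^bsub>M\<^esub> T x)"
  have h: "?h \<in> left_hom A M M"
    by (rule left_hom_sum[OF left_hom_id left_hom_comp[OF fin_rank_left_hom[OF T(1)] left_hom_uminus]])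
  obtain S where S: "S \<in> fin_rank A M" "S (?h y) = ?h y"
    using lfr left_hom_closed[OF h y] by (auto simp: locally_fin_rank_def)
  have S0: "S \<zero>\<^bsub>M\<^esub> = \<zero>\<^bsub>M\<^esub>"
    by (rule add_hom_zero[OF M.abelian_group_axioms M.abelian_group_axioms
          left_hom_add_hom[OF fin_rank_left_hom[OF S(1)]]])
  let ?U = "\<lambda>x. T x \<oplus>\<^bsub>M\<^esub> S (?h x)"
  have U: "?U \<in> fin_rank A M" by (rule fin_rank.add[OF T(1) fin_rank_comp_right[OF h S(1)]])
  have "?U x = x" if x: "x \<in> insert y F" for x
  proof (cases "x = y")
    case True
    then have "?U x = T y \<oplus>\<^bsub>M\<^esub> (y \<oplus>\<^bsub>M\<^esub> \<ominus>\<^bsub>M\<^esub> T y)" using S(2) by simp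
    also have "\<dots> = y" using y Tc[OF y] by (simp add: M.a_lcomm M.r_neg)
    finally show ?thesis using True by simp
  next
    case False
    then have "x \<in> F" "x \<in> carrier M" using x insert.prems by auto
    then show ?thesis by (simp add: T(2) M.r_neg S0)
  qed
  then show ?case using U by (intro bexI[of _ ?U]) auto
qed

text \<open>Local projectivity applied to the canonical map of the free module on \<open>C\<close> onto \<open>C\<close>.\<close>

lemma locally_fin_rank_if_locally_projective:
  assumes lp: "locally_projective A M"
  shows "locally_fin_rank A M"
  unfolding locally_fin_rank_def
proof
  fix c assume c: "c \<in> carrier M"
  let ?F = "free_module A (carrier M)" and ?q = "free_module_ext A M (\<lambda>w. w)"
  have M: "left_module A M" by (rule left_module_axioms)
  have q: "?q \<in> left_hom A ?F M" by (rule free_module_ext_hom[OF M]) simp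
  have "?q ` carrier ?F = carrier M"
  proof
    show "?q ` carrier ?F \<subseteq> carrier M" using left_hom_closed[OF q] by auto
    show "carrier M \<subseteq> ?q ` carrier ?F"
    proof
      fix x assume x: "x \<in> carrier M"
      let ?u = "\<lambda>v. if v = x then \<one>\<^bsub>A\<^esub> else \<zero>\<^bsub>A\<^esub>"
      have "?q ?u = (\<Oplus>\<^bsub>M\<^esub>w\<in>{x}. ?u w \<odot>\<^bsub>M\<^esub> w)"
        by (rule free_module_ext_superset[OF M, where S = "carrier M"]) (use x in auto)
      also have "\<dots> = x" using x lact_one[OF x] by simp
      finally have "?q ?u = x" .
      moreover have "?u \<in> carrier ?F" using x by (auto simp: free_module_def)
      ultimately show "x \<in> ?q ` carrier ?F" by (metis imageI)
    qed
  qed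
  note surj = this
  have fg: "fin_gen_left_submodule A M {a \<odot>\<^bsub>M\<^esub> c | a. a \<in> carrier A}" (is "fin_gen_left_submodule A M ?cyc")
    unfolding fin_gen_left_submodule_def
  proof (intro conjI exI[of _ "{c}"] allI impI)
    have cl: "?cyc \<subseteq> carrier M" using c lact_closed by auto
    have ne: "?cyc \<noteq> {}" by auto
    have inv: "\<ominus>\<^bsub>M\<^esub> x \<in> ?cyc" if x: "x \<in> ?cyc" for x
    proof -
      obtain a where a: "a \<in> carrier A" "x = a \<odot>\<^bsub>M\<^esub> c" using x by auto
      have "(\<lambda>a. a \<odot>\<^bsub>M\<^esub> c) \<in> add_hom A M" using c by (simp add: add_hom_iff lact_closed lact_l_distr)
      from add_hom_inv[OF A.abelian_group_axioms M.abelian_group_axioms this a(1)]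
      have "\<ominus>\<^bsub>M\<^esub> x = (\<ominus>\<^bsub>A\<^esub> a) \<odot>\<^bsub>M\<^esub> c" by (simp add: a(2))
      then show ?thesis using a(1) by auto
    qed
    have add: "x \<oplus>\<^bsub>M\<^esub> y \<in> ?cyc" if xy: "x \<in> ?cyc" "y \<in> ?cyc" for x y
    proof -
      obtain a b where ab: "a \<in> carrier A" "x = a \<odot>\<^bsub>M\<^esub> c" "b \<in> carrier A" "y = b \<odot>\<^bsub>M\<^esub> c" using xy by auto
      then have "x \<oplus>\<^bsub>M\<^esub> y = (a \<oplus>\<^bsub>A\<^esub> b) \<odot>\<^bsub>M\<^esub> c" using c by (simp add: lact_l_distr)
      then show ?thesis using ab by auto
    qed
    have "subgroup ?cyc (add_monoid M)"
      by (rule M.add.subgroupI) (simp_all only: monoid.simps partial_object.simps cl ne inv add not_False_eq_True flip: a_inv_def)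
    moreover have "b \<odot>\<^bsub>M\<^esub> x \<in> ?cyc" if bx: "b \<in> carrier A" "x \<in> ?cyc" for b x
    proof -
      obtain a where a: "a \<in> carrier A" "x = a \<odot>\<^bsub>M\<^esub> c" using bx by auto
      then have "b \<odot>\<^bsub>M\<^esub> x = (b \<otimes>\<^bsub>A\<^esub> a) \<odot>\<^bsub>M\<^esub> c" using c bx(1) by (simp add: lact_assoc)
      then show ?thesis using a bx(1) by auto
    qed
    ultimately show "left_submodule A M ?cyc" by (simp only: left_submodule_def) blast
    show "{c} \<subseteq> ?cyc" using lact_one[OF c] by (auto intro!: exI[of _ "\<one>\<^bsub>A\<^esub>"])
    show "?cyc \<subseteq> F'" if "left_submodule A M F' \<and> {c} \<subseteq> F'" for F'
      using that by (auto simp: left_submodule_def)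
  qed simp
  obtain s where s: "s \<in> left_hom A M ?F" "\<And>x. x \<in> ?cyc \<Longrightarrow> ?q (s x) = x"
    using locally_projective_lifts[OF M lp fg left_module_free_module[OF A.ring_axioms] M q surj left_hom_id]
    by auto
  have "c \<in> ?cyc" using lact_one[OF c] by (auto intro!: exI[of _ "\<one>\<^bsub>A\<^esub>"])
  then have qs: "?q (s c) = c" by (rule s(2))
  \<comment> \<open>The support of \<open>s c\<close> is kept as summation range for every x. The
    resulting T has the functionals x -> s x w as coefficients and agrees with \<open>?q\<close>
    after s at the point c, which is all that is required.\<close>
  let ?B = "{w. s c w \<noteq> \<zero>\<^bsub>A\<^esub>}"
  have B: "finite ?B" "?B \<subseteq> carrier M" using left_hom_closed[OF s(1) c] by (auto simp: free_module_def)
  have sw: "(\<lambda>x. s x w) \<in> left_hom A M (regular_bimodule A)" for w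
  proof (rule left_homI)
    show "s x w \<in> carrier (regular_bimodule A)" if "x \<in> carrier M" for x
      using left_hom_closed[OF s(1) that] by (simp add: free_module_def)
    show "s (x \<oplus>\<^bsub>M\<^esub> y) w = s x w \<oplus>\<^bsub>regular_bimodule A\<^esub> s y w" if "x \<in> carrier M" "y \<in> carrier M" for x y
      using left_hom_add[OF s(1) that] by (simp add: free_module_def)
    show "s (a \<odot>\<^bsub>M\<^esub> x) w = a \<odot>\<^bsub>regular_bimodule A\<^esub> s x w" if "a \<in> carrier A" "x \<in> carrier M" for a x
      using left_hom_lact[OF s(1) that] by (simp add: free_module_def)
  qed
  have "\<exists>T\<in>fin_rank A M. \<forall>x\<in>carrier M. T x = (\<Oplus>\<^bsub>M\<^esub>w\<in>B. s x w \<odot>\<^bsub>M\<^esub> w)"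
    if "finite B" "B \<subseteq> carrier M" for B
    using that
  proof (induction B rule: finite_induct)
    case empty
    then show ?case using fin_rank_zero by auto
  next
    case (insert v B)
    then obtain T where T: "T \<in> fin_rank A M" "\<And>x. x \<in> carrier M \<Longrightarrow> T x = (\<Oplus>\<^bsub>M\<^esub>w\<in>B. s x w \<odot>\<^bsub>M\<^esub> w)" by auto
    have "(\<Oplus>\<^bsub>M\<^esub>w\<in>insert v B. s x w \<odot>\<^bsub>M\<^esub> w) = s x v \<odot>\<^bsub>M\<^esub> v \<oplus>\<^bsub>M\<^esub> T x" if x: "x \<in> carrier M" for x
      unfolding T(2)[OF x]
      by (rule M.finsum_insert)
        (use insert left_hom_closed[OF sw x] in \<open>auto intro!: lact_closed\<close>)
    then show ?case
      using fin_rank.add[OF fin_rank.rank_one[OF sw] T(1), of v v] insert.prems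
      by (intro bexI[of _ "\<lambda>x. s x v \<odot>\<^bsub>M\<^esub> v \<oplus>\<^bsub>M\<^esub> T x"]) auto
  qed
  from this[OF B] obtain T where T: "T \<in> fin_rank A M" "T c = (\<Oplus>\<^bsub>M\<^esub>w\<in>?B. s c w \<odot>\<^bsub>M\<^esub> w)"
    using c by auto
  then show "\<exists>T\<in>fin_rank A M. T c = c"
    using qs by (auto simp: free_module_ext_def)
qed

end

context tensor_pair
begin

lemma tp: "tensor_pair A M N" ..

text \<open>z is a combination of finitely many pure tensors, and F collects their right
  entries.\<close>

lemma fixing_finite:
  assumes z: "z \<in> carrier (tensor A M N)"
  shows "\<exists>F. finite F \<and> F \<subseteq> carrier N \<and>
    (\<forall>T\<in>left_hom A N N. (\<forall>x\<in>F. T x = x) \<longrightarrow> tensor_map A M N (\<lambda>x. x) T z = z)"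
  using MN z
proof (induction rule: tensor_induct)
  case zero
  show ?case
    using add_hom_zero[OF T.abelian_group_axioms T.abelian_group_axioms map_hom[OF tp right_hom_id]]
    by (intro exI[of _ "{}"]) auto
next
  case (pure m n)
  then show ?case by (intro exI[of _ "{n}"]) (auto simp: map_pure[OF tp right_hom_id])
next
  case (minus s t)
  then obtain F G where "finite F" "F \<subseteq> carrier N" "finite G" "G \<subseteq> carrier N"
    "\<forall>T\<in>left_hom A N N. (\<forall>x\<in>F. T x = x) \<longrightarrow> tensor_map A M N (\<lambda>x. x) T s = s"
    "\<forall>T\<in>left_hom A N N. (\<forall>x\<in>G. T x = x) \<longrightarrow> tensor_map A M N (\<lambda>x. x) T t = t" by metis
  then show ?case
    using minus.hyps
    by (intro exI[of _ "F \<union> G"])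
      (auto simp: add_hom_minus[OF T.abelian_group_axioms T.abelian_group_axioms map_hom[OF tp right_hom_id]])
qed

text \<open>Balancing moves the scalar across, m \<otimes> f(n) w = m f(n) \<otimes> w. So a
  rank-one map sees a tensor only through one slice.\<close>

lemma map_rank_one:
  assumes f: "f \<in> left_hom A N (regular_bimodule A)" and w: "w \<in> carrier N" and z: "z \<in> carrier (tensor A M N)"
  shows "tensor_map A M N (\<lambda>x. x) (\<lambda>x. f x \<odot>\<^bsub>N\<^esub> w) z = pure_tensor A M N (slice f z) w"
proof -
  have g: "(\<lambda>x. f x \<odot>\<^bsub>N\<^esub> w) \<in> left_hom A N N"
    by (rule N.fin_rank_left_hom[OF fin_rank.rank_one[OF f w]])
  have p: "(\<lambda>m. pure_tensor A M N m w) \<in> add_hom M (tensor A M N)"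
    using w by (simp add: add_hom_iff pure_closed add_left)
  show ?thesis
    by (rule hom_eq[OF T.abelian_group_axioms map_hom[OF tp right_hom_id g] add_hom_comp[OF slice_hom[OF f] p] _ z])
      (use w left_hom_closed[OF f] in \<open>simp add: map_pure[OF tp right_hom_id g] slice_pure[OF f] balance\<close>)
qed

lemma map_sum:
  assumes S: "S \<in> left_hom A N N" and U: "U \<in> left_hom A N N" and z: "z \<in> carrier (tensor A M N)"
  shows "tensor_map A M N (\<lambda>x. x) (\<lambda>x. S x \<oplus>\<^bsub>N\<^esub> U x) z
    = tensor_map A M N (\<lambda>x. x) S z \<oplus>\<^bsub>tensor A M N\<^esub> tensor_map A M N (\<lambda>x. x) U z"
proof -
  note SU = N.left_hom_sum[OF S U]
  show ?thesis
    by (rule hom_eq[OF T.abelian_group_axioms map_hom[OF tp right_hom_id SU]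
          add_hom_sum[OF T.abelian_group_axioms map_hom[OF tp right_hom_id S] map_hom[OF tp right_hom_id U]] _ z])
      (simp add: map_pure[OF tp right_hom_id] S U SU left_hom_closed[OF S] left_hom_closed[OF U] add_right)
qed

lemma map_fin_rank_cong:
  assumes "S \<in> fin_rank A N" "\<And>x. x \<in> carrier N \<Longrightarrow> U x = S x" and z: "z \<in> carrier (tensor A M N)"
  shows "tensor_map A M N (\<lambda>x. x) U z = tensor_map A M N (\<lambda>x. x) S z"
  by (rule map_cong[OF tp right_hom_id _ right_hom_id _ _ _ z])
    (use assms fin_rank.cong[OF assms(1,2)] N.fin_rank_left_hom in auto)

text \<open>Some finite-rank T fixes all entries of z and z', hence id \<otimes> T fixes both
  tensors; by \<open>map_rank_one\<close> the values of id \<otimes> T depend on slices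
  alone.\<close>

lemma slices_separate:
  assumes lfr: "locally_fin_rank A N" and z: "z \<in> carrier (tensor A M N)" "z' \<in> carrier (tensor A M N)"
    and eq: "\<And>f. f \<in> left_hom A N (regular_bimodule A) \<Longrightarrow> slice f z = slice f z'"
  shows "z = z'"
proof -
  obtain F F' where F: "finite (F \<union> F')" "F \<union> F' \<subseteq> carrier N"
    "\<And>T. T \<in> left_hom A N N \<Longrightarrow> (\<forall>x\<in>F. T x = x) \<Longrightarrow> tensor_map A M N (\<lambda>x. x) T z = z"
    "\<And>T. T \<in> left_hom A N N \<Longrightarrow> (\<forall>x\<in>F'. T x = x) \<Longrightarrow> tensor_map A M N (\<lambda>x. x) T z' = z'"
    using fixing_finite[OF z(1)] fixing_finite[OF z(2)] by auto
  obtain T where T: "T \<in> fin_rank A N" "\<forall>x\<in>F \<union> F'. T x = x"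
    using N.fin_rank_fixing_finite[OF lfr F(1,2)] by auto
  from T(1) have "tensor_map A M N (\<lambda>x. x) T z = tensor_map A M N (\<lambda>x. x) T z'"
  proof (induction rule: fin_rank.induct)
    case (rank_one f w)
    then show ?case by (simp add: map_rank_one z eq)
  next
    case (add S T)
    then show ?case by (simp add: map_sum z N.fin_rank_left_hom)
  next
    case (cong S T)
    then show ?case by (simp add: map_fin_rank_cong[OF cong(1,2)] z)
  qed
  then show ?thesis using F(3)[OF N.fin_rank_left_hom[OF T(1)]] F(4)[OF N.fin_rank_left_hom[OF T(1)]] T(2) by simp
qed

lemma fin_rank_fixing:
  assumes lfr: "locally_fin_rank A N" and z: "z \<in> carrier (tensor A M N)"
  shows "\<exists>T\<in>fin_rank A N. tensor_map A M N (\<lambda>x. x) T z = z"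
proof -
  obtain F where F: "finite F" "F \<subseteq> carrier N"
    "\<And>T. T \<in> left_hom A N N \<Longrightarrow> (\<forall>x\<in>F. T x = x) \<Longrightarrow> tensor_map A M N (\<lambda>x. x) T z = z"
    using fixing_finite[OF z] by auto
  then show ?thesis using N.fin_rank_fixing_finite[OF lfr F(1,2)] N.fin_rank_left_hom by metis
qed

end

text \<open>Approximation on the side of N writes t as a sum of m \<otimes> e, where each m is a
  slice of t; a finite-rank map of M that fixes m completes the approximation. The case C \<otimes>
  C serves coassociativity.\<close>

lemma locally_fin_rank_tensor:
  assumes M: "bimodule A A M" and N: "left_module A N"
    and lfr: "locally_fin_rank A M" "locally_fin_rank A N"
  shows "locally_fin_rank A (tensor A M N)"
  unfolding locally_fin_rank_def
proof
  interpret M: bimodule A A M by fact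
  interpret N: left_module A N by fact
  interpret T: tensor_left A A M N ..
  interpret TM: left_module A "tensor A M N" by (rule T.left_module_tensor)
  fix t assume t: "t \<in> carrier (tensor A M N)"
  have "\<exists>U\<in>fin_rank A (tensor A M N). U t = tensor_map A M N (\<lambda>x. x) T t" if "T \<in> fin_rank A N" for T
    using that
  proof (induction rule: fin_rank.induct)
    case (rank_one g e)
    note sl = T.slice_left_hom[OF rank_one(1)]
    obtain V where V: "V \<in> fin_rank A M" "V (T.slice g t) = T.slice g t"
      using lfr(1) left_hom_closed[OF sl t] by (auto simp: locally_fin_rank_def)
    \<comment> \<open>\<open>slice g\<close> is left A-linear, so a functional of M composed with it
      is a functional of M \<otimes> N.\<close>
    have "(\<lambda>y. pure_tensor A M N (V (T.slice g y)) e) \<in> fin_rank A (tensor A M N)"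
      using V(1)
    proof (induction rule: fin_rank.induct)
      case (rank_one f b)
      have "(\<lambda>y. f (T.slice g y) \<odot>\<^bsub>tensor A M N\<^esub> pure_tensor A M N b e) \<in> fin_rank A (tensor A M N)"
        by (rule fin_rank.rank_one[OF left_hom_comp[OF sl rank_one(1)] T.pure_closed[OF rank_one(2) \<open>e \<in> carrier N\<close>]])
      then show ?case
        by (rule fin_rank.cong)
          (use rank_one \<open>e \<in> carrier N\<close> left_hom_closed[OF sl] left_hom_closed[OF rank_one(1)] in
            \<open>simp add: T.lact_pure\<close>)
    next
      case (add S U)
      show ?case
        by (rule fin_rank.cong[OF fin_rank.add[OF add.IH]])
          (use \<open>e \<in> carrier N\<close> left_hom_closed[OF sl]
            add.hyps[THEN M.L.fin_rank_left_hom, THEN left_hom_closed] in \<open>simp add: T.add_left\<close>)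
    next
      case (cong S U)
      show ?case by (rule fin_rank.cong[OF cong.IH]) (use cong left_hom_closed[OF sl] in simp)
    qed
    then show ?case using V(2) t rank_one by (intro bexI) (auto simp: T.map_rank_one)
  next
    case (add S U)
    then obtain S' U' where "S' \<in> fin_rank A (tensor A M N)" "U' \<in> fin_rank A (tensor A M N)"
      "S' t = tensor_map A M N (\<lambda>x. x) S t" "U' t = tensor_map A M N (\<lambda>x. x) U t" by auto
    then show ?case using add.hyps t fin_rank.add[of S' A "tensor A M N" U']
      by (intro bexI[of _ "\<lambda>x. S' x \<oplus>\<^bsub>tensor A M N\<^esub> U' x"]) (auto simp: T.map_sum N.fin_rank_left_hom)
  next
    case (cong S U)
    then show ?case using T.map_fin_rank_cong[OF cong(1,2) t] by simp
  qed
  moreover obtain T where "T \<in> fin_rank A N" "tensor_map A M N (\<lambda>x. x) T t = t"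
    using T.fin_rank_fixing[OF lfr(2) t] by auto
  ultimately show "\<exists>T\<in>fin_rank A (tensor A M N). T t = t" by metis
qed

section \<open>The associativity map\<close>

locale tensor_triple = P?: right_module A P + C?: bimodule A A C + D?: left_module A D
  for A :: "('a, 'z) ring_scheme" and P :: "('l, 'a, 'p, 'x) bimodule_scheme"
    and C :: "('a, 'a, 'c, 'y) bimodule_scheme" and D :: "('a, 'b, 'd, 'w) bimodule_scheme"
begin

interpretation PC: tensor_right A A P C ..
interpretation CD: tensor_left A A C D ..
interpretation CDm: left_module A "tensor A C D" by (rule CD.left_module_tensor)
interpretation PCm: right_module A "tensor A P C" by (rule PC.right_module_tensor)
interpretation R: tensor_pair A P "tensor A C D" ..
interpretation L: tensor_pair A "tensor A P C" D ..

abbreviation inner :: "'d \<Rightarrow> ('p \<times> 'c \<Rightarrow>\<^sub>0 int) set \<Rightarrow> ('p \<times> ('c \<times> 'd \<Rightarrow>\<^sub>0 int) set \<Rightarrow>\<^sub>0 int) set" where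
  "inner d \<equiv> tensor_lift (tensor A P (tensor A C D))
     (\<lambda>m n. pure_tensor A P (tensor A C D) m (pure_tensor A C D n d))"

lemma balanced_inner:
  assumes d: "d \<in> carrier D"
  shows "balanced A P C (tensor A P (tensor A C D))
    (\<lambda>m n. pure_tensor A P (tensor A C D) m (pure_tensor A C D n d))"
  using d by (intro balancedI)
    (simp_all add: R.pure_closed CD.pure_closed R.add_left CD.add_left R.add_right R.balance CD.lact_pure)

lemma
  assumes d: "d \<in> carrier D"
  shows inner_hom: "inner d \<in> add_hom (tensor A P C) (tensor A P (tensor A C D))"
    and inner_pure: "p \<in> carrier P \<Longrightarrow> c \<in> carrier C \<Longrightarrow>
      inner d (pure_tensor A P C p c) = pure_tensor A P (tensor A C D) p (pure_tensor A C D c d)"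
  by (rule PC.lift_hom[OF R.T.abelian_group_axioms balanced_inner[OF d]])
    (rule PC.lift_pure[OF R.T.abelian_group_axioms balanced_inner[OF d]])

lemma balanced_outer:
  "balanced A (tensor A P C) D (tensor A P (tensor A C D)) (\<lambda>t d. inner d t)"
proof (rule balancedI)
  fix t d assume t: "t \<in> carrier (tensor A P C)" and d: "d \<in> carrier D"
  show "inner d t \<in> carrier (tensor A P (tensor A C D))" by (rule add_hom_closed[OF inner_hom[OF d] t])
next
  fix s t d assume "s \<in> carrier (tensor A P C)" "t \<in> carrier (tensor A P C)" and d: "d \<in> carrier D"
  then show "inner d (s \<oplus>\<^bsub>tensor A P C\<^esub> t) = inner d s \<oplus>\<^bsub>tensor A P (tensor A C D)\<^esub> inner d t"
    by (intro add_hom_add[OF inner_hom[OF d]])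
next
  fix t d e assume t: "t \<in> carrier (tensor A P C)" and d: "d \<in> carrier D" "e \<in> carrier D"
  then have de: "d \<oplus>\<^bsub>D\<^esub> e \<in> carrier D" by simp
  show "inner (d \<oplus>\<^bsub>D\<^esub> e) t = inner d t \<oplus>\<^bsub>tensor A P (tensor A C D)\<^esub> inner e t"
    by (rule PC.hom_eq[OF R.T.abelian_group_axioms inner_hom[OF de]
          add_hom_sum[OF R.T.abelian_group_axioms inner_hom[OF d(1)] inner_hom[OF d(2)]] _ t])
      (simp add: inner_pure d de CD.add_right R.add_right CD.pure_closed)
next
  fix t a d assume t: "t \<in> carrier (tensor A P C)" and a: "a \<in> carrier A" and d: "d \<in> carrier D"
  have ad: "a \<odot>\<^bsub>D\<^esub> d \<in> carrier D" by (rule D.lact_closed[OF a d])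
  show "inner d (t \<triangleleft>\<^bsub>tensor A P C\<^esub> a) = inner (a \<odot>\<^bsub>D\<^esub> d) t"
    by (rule PC.hom_eq[OF R.T.abelian_group_axioms add_hom_comp[OF PC.ract_hom[OF a] inner_hom[OF d]] inner_hom[OF ad] _ t])
      (simp add: inner_pure PC.ract_pure a d ad C.R.ract_closed CD.balance)
qed

lemma assoc_eq: "tensor_assoc A P C D = tensor_lift (tensor A P (tensor A C D)) (\<lambda>t d. inner d t)"
  by (simp add: tensor_assoc_def Let_def)

lemma assoc_hom: "tensor_assoc A P C D \<in> add_hom (tensor A (tensor A P C) D) (tensor A P (tensor A C D))"
  unfolding assoc_eq by (rule L.lift_hom[OF R.T.abelian_group_axioms balanced_outer])

lemma assoc_pure:
  "p \<in> carrier P \<Longrightarrow> c \<in> carrier C \<Longrightarrow> d \<in> carrier D \<Longrightarrow>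
    tensor_assoc A P C D (pure_tensor A (tensor A P C) D (pure_tensor A P C p c) d)
      = pure_tensor A P (tensor A C D) p (pure_tensor A C D c d)"
  unfolding assoc_eq
  using L.lift_pure[OF R.T.abelian_group_axioms balanced_outer PC.pure_closed[of p c], of d]
  by (simp add: inner_pure)

end

section \<open>Subcomodules and colinear maps over the left dual ring\<close>

text \<open>The tensor product does not see the coaction field of a comodule record. This identifies
  the tensor products over \<open>sub\<close> and over M cut down to X, and those over
  \<open>quotient_module\<close> and \<open>quotient_comodule\<close>.\<close>

lemma tensor_cong:
  assumes "carrier M = carrier M'" "add M = add M'" "smult M = smult M'" "ract M = ract M'"
  shows "tensor A M N = tensor A M' N" "pure_tensor A M N = pure_tensor A M' N"
proof -
  have "tensor_null A M N = tensor_null A M' N"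
    using assms by (simp add: tensor_null_def tensor_relations_def)
  then show p: "pure_tensor A M N = pure_tensor A M' N"
    using assms by (intro ext) (simp add: pure_tensor_def)
  have "tensor_group A M N = tensor_group A M' N"
    using assms \<open>tensor_null A M N = _\<close> by (simp add: tensor_group_def)
  then have "tensor_ab A M N = tensor_ab A M' N" by (simp add: tensor_ab_def)
  then show "tensor A M N = tensor A M' N"
    using assms p \<open>tensor_group A M N = _\<close> by (simp add: tensor_def)
qed

text \<open>The colinearity equation lives in L \<otimes> C, where slices separate, and
  \<open>slice_natural\<close> computes the slices of g \<otimes> id. It is stated for right modules
  with a map into the tensor product so that it applies directly to M/W.\<close>

lemma comod_hom_iff:
  assumes lfr: "locally_fin_rank A C" and K: "tensor_pair A K C" and L: "tensor_pair A L C"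
    and coK: "\<And>m. m \<in> carrier K \<Longrightarrow> coact K m \<in> carrier (tensor A K C)"
    and coL: "\<And>m. m \<in> carrier L \<Longrightarrow> coact L m \<in> carrier (tensor A L C)"
  shows "g \<in> comod_hom A C K L \<longleftrightarrow> g \<in> right_hom A K L \<and>
    (\<forall>f\<in>left_hom A C (regular_bimodule A). \<forall>m\<in>carrier K.
      g (tensor_lift K (\<lambda>x c. x \<triangleleft>\<^bsub>K\<^esub> f c) (coact K m)) = tensor_lift L (\<lambda>x c. x \<triangleleft>\<^bsub>L\<^esub> f c) (coact L (g m)))"
proof (cases "g \<in> right_hom A K L")
  case g: True
  interpret K: tensor_pair A K C by fact
  interpret L: tensor_pair A L C by fact
  have gc: "g m \<in> carrier L" if "m \<in> carrier K" for m by (rule right_hom_closed[OF g that])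
  have h: "tensor_map A L C g (\<lambda>x. x) \<in> add_hom (tensor A K C) (tensor A L C)"
    by (rule K.map_hom[OF L g left_hom_id])
  have "coact L (g m) = tensor_map A L C g (\<lambda>x. x) (coact K m) \<longleftrightarrow>
      (\<forall>f\<in>left_hom A C (regular_bimodule A). g (K.slice f (coact K m)) = L.slice f (coact L (g m)))"
    if m: "m \<in> carrier K" for m
  proof
    assume "coact L (g m) = tensor_map A L C g (\<lambda>x. x) (coact K m)"
    then show "\<forall>f\<in>left_hom A C (regular_bimodule A). g (K.slice f (coact K m)) = L.slice f (coact L (g m))"
      using slice_natural[OF K L g _ coK[OF m]] by simp
  next
    assume "\<forall>f\<in>left_hom A C (regular_bimodule A). g (K.slice f (coact K m)) = L.slice f (coact L (g m))"
    then show "coact L (g m) = tensor_map A L C g (\<lambda>x. x) (coact K m)"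
      using slice_natural[OF K L g _ coK[OF m]]
      by (intro L.slices_separate[OF lfr coL[OF gc[OF m]] add_hom_closed[OF h coK[OF m]]]) simp
  qed
  then show ?thesis using g by (auto simp: comod_hom_def id_def)
qed (simp add: comod_hom_def)

locale locally_projective_comodule = comodule A C M
  for A :: "('a, 'z) ring_scheme" and C :: "('a, 'c) coring" and M :: "('l, 'a, 'm, 'c) comodule" +
  assumes locally_projective: "locally_projective A C"
begin

lemma lfr: "locally_fin_rank A C"
  by (rule C.L.locally_fin_rank_if_locally_projective[OF locally_projective])

lemma bimodule_C: "bimodule A A C" ..

sublocale T: tensor_right A A M C
  by (intro tensor_right.intro M.right_module_axioms bimodule_C)

abbreviation functionals :: "('c \<Rightarrow> 'a) set" where
  "functionals \<equiv> left_hom A C (regular_bimodule A)"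

definition act :: "('c \<Rightarrow> 'a) \<Rightarrow> 'm \<Rightarrow> 'm" where
  "act f m = tensor_lift M (\<lambda>x c. x \<triangleleft>\<^bsub>M\<^esub> f c) (coact M m)"

lemma coact_closed: "m \<in> carrier M \<Longrightarrow> coact M m \<in> carrier (tensor A M C)"
  by (rule right_hom_closed[OF coact_hom])

lemma act_hom: "f \<in> functionals \<Longrightarrow> act f \<in> add_hom M M"
  unfolding act_def by (rule add_hom_comp[OF right_hom_add_hom[OF coact_hom] T.slice_hom])

lemma act_closed: "f \<in> functionals \<Longrightarrow> m \<in> carrier M \<Longrightarrow> act f m \<in> carrier M"
  by (rule add_hom_closed[OF act_hom])

text \<open>Counitality with a scalar carried along: right multiplication by a is one of the
  operators, so stable subgroups are right A-submodules.\<close>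

lemma act_counit:
  assumes a: "a \<in> carrier A"
  shows "(\<lambda>c. counit C c \<otimes>\<^bsub>A\<^esub> a) \<in> functionals"
    and "m \<in> carrier M \<Longrightarrow> act (\<lambda>c. counit C c \<otimes>\<^bsub>A\<^esub> a) m = m \<triangleleft>\<^bsub>M\<^esub> a"
proof -
  have e: "counit C \<in> functionals" using C.counit_hom by simp
  have ec: "counit C c \<in> carrier A" if "c \<in> carrier C" for c
    using left_hom_closed[OF e that] by simp
  show f: "(\<lambda>c. counit C c \<otimes>\<^bsub>A\<^esub> a) \<in> functionals"
    by (rule left_homI)
      (use a ec in \<open>simp_all add: left_hom_add[OF e] left_hom_lact[OF e] C.L.A.l_distr C.L.A.m_assoc\<close>)
  assume m: "m \<in> carrier M"
  have "T.slice (\<lambda>c. counit C c \<otimes>\<^bsub>A\<^esub> a) (coact M m) = T.slice (counit C) (coact M m) \<triangleleft>\<^bsub>M\<^esub> a"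
    by (rule T.hom_eq[OF M.M.abelian_group_axioms T.slice_hom[OF f]
          add_hom_comp[OF T.slice_hom[OF e] M.ract_add_hom[OF a]] _ coact_closed[OF m]])
      (simp add: T.slice_pure[OF f] T.slice_pure[OF e] M.ract_assoc ec a)
  then show "act (\<lambda>c. counit C c \<otimes>\<^bsub>A\<^esub> a) m = m \<triangleleft>\<^bsub>M\<^esub> a"
    by (simp add: act_def coact_counit[OF m])
qed

sublocale op: operator_group M "act ` functionals"
  by unfold_locales (auto simp: act_closed add_hom_add[OF act_hom])

lemma stable_act: "op.stable X \<Longrightarrow> f \<in> functionals \<Longrightarrow> x \<in> X \<Longrightarrow> act f x \<in> X"
  using op.stable_op[of X "act f" x] by simp

lemma stable_ract: "op.stable X \<Longrightarrow> x \<in> X \<Longrightarrow> a \<in> carrier A \<Longrightarrow> x \<triangleleft>\<^bsub>M\<^esub> a \<in> X"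
  using stable_act[OF _ act_counit(1)] act_counit(2) op.stable_carrier by metis

lemma stable_right_submodule: "op.stable X \<Longrightarrow> right_submodule A M X"
  using stable_ract by (auto simp: right_submodule_def op.stable_def)

text \<open>Since the inclusion is colinear, naturality identifies a slice taken in K with the one
  taken in M; hence subcomodules are stable.\<close>

lemma slice_subcomodule:
  assumes K: "is_subcomodule A C K M" and f: "f \<in> functionals" and x: "x \<in> carrier K"
  shows "tensor_lift K (\<lambda>x c. x \<triangleleft>\<^bsub>K\<^esub> f c) (coact K x) = act f x"
    and "act f x \<in> carrier K"
proof -
  interpret K: comodule A C K using K by (simp add: is_subcomodule_def)
  interpret KC: tensor_pair A K C
    by (intro tensor_pair.intro K.M.right_module_axioms C.L.left_module_axioms)
  have i: "(\<lambda>x. x) \<in> right_hom A K M" "coact M x = tensor_map A M C (\<lambda>x. x) (\<lambda>x. x) (coact K x)"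
    using K x by (auto simp: is_subcomodule_def comod_hom_def id_def)
  have co: "coact K x \<in> carrier (tensor A K C)" by (rule right_hom_closed[OF K.coact_hom x])
  show eq: "KC.slice f (coact K x) = act f x"
    using slice_natural[OF KC.tp T.tp i(1) f co] by (simp add: act_def i(2))
  show "act f x \<in> carrier K" using add_hom_closed[OF KC.slice_hom[OF f] co] by (simp add: eq)
qed

lemma stable_if_subcomodule:
  assumes K: "is_subcomodule A C K M"
  shows "op.stable (carrier K)"
proof -
  interpret K: comodule A C K using K by (simp add: is_subcomodule_def)
  have i: "(\<lambda>x. x) \<in> right_hom A K M" and sub: "carrier K \<subseteq> carrier M"
    using K by (auto simp: is_subcomodule_def comod_hom_def)
  note h = right_hom_add_hom[OF i]
  show ?thesis
  proof (rule op.stableI[OF sub])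
    show "\<zero>\<^bsub>M\<^esub> \<in> carrier K"
      using add_hom_zero[OF K.M.M.abelian_group_axioms M.M.abelian_group_axioms h] K.M.M.zero_closed by simp
    show "x \<ominus>\<^bsub>M\<^esub> y \<in> carrier K" if "x \<in> carrier K" "y \<in> carrier K" for x y
      using add_hom_minus[OF K.M.M.abelian_group_axioms M.M.abelian_group_axioms h that]
        K.M.M.minus_closed[OF that] by simp
    show "\<omega> x \<in> carrier K" if "\<omega> \<in> act ` functionals" "x \<in> carrier K" for \<omega> x
      using slice_subcomodule(2)[OF K _ that(2)] that(1) by auto
  qed
qed

end

section \<open>The comodule structure on a stable subgroup\<close>

locale stable_subgroup = locally_projective_comodule A C M
  for A :: "('a, 'z) ring_scheme" and C :: "('a, 'c) coring" and M :: "('l, 'a, 'm, 'c) comodule" +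
  fixes X :: "'m set"
  assumes stable_X: "op.stable X"
begin

text \<open>The coaction of M pulled back along X \<otimes> C -> M \<otimes> C; existence is
  \<open>coact_lift\<close> and uniqueness \<open>incl_inj\<close>. The tensor product is formed
  over M cut down to X because \<open>sub\<close> is built from \<open>coact_sub\<close>.\<close>

definition coact_sub :: "'m \<Rightarrow> ('m \<times> 'c \<Rightarrow>\<^sub>0 int) set" where
  "coact_sub x = (SOME z. z \<in> carrier (tensor A (M\<lparr>carrier := X\<rparr>) C) \<and>
     tensor_map A M C (\<lambda>x. x) (\<lambda>x. x) z = coact M x)"

definition sub :: "('l, 'a, 'm, 'c) comodule" where
  "sub = M\<lparr>carrier := X, coact := coact_sub\<rparr>"

lemma sub_simps [simp]:
  "carrier sub = X" "add sub = add M" "\<zero>\<^bsub>sub\<^esub> = \<zero>\<^bsub>M\<^esub>" "smult sub = smult M" "ract sub = ract M"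
  "coact sub = coact_sub"
  by (simp_all add: sub_def)

lemma tensor_sub: "tensor A (M\<lparr>carrier := X\<rparr>) C = tensor A sub C"
  by (rule tensor_cong) simp_all

lemmas X_carrier = op.stable_carrier[OF stable_X]

lemma right_module_sub: "right_module A sub"
proof (intro right_module.intro right_module_axioms.intro abelian_groupI C.L.A.ring_axioms)
  show "\<exists>y\<in>carrier sub. y \<oplus>\<^bsub>sub\<^esub> x = \<zero>\<^bsub>sub\<^esub>" if "x \<in> carrier sub" for x
    using that op.stable_inv[OF stable_X] X_carrier by (intro bexI[of _ "\<ominus>\<^bsub>M\<^esub> x"]) (auto simp: M.M.l_neg)
qed (use X_carrier op.stable_zero[OF stable_X] op.stable_add[OF stable_X] stable_ract[OF stable_X] in
    \<open>auto simp: M.M.a_ac M.ract_r_distr M.ract_l_distr M.ract_assoc M.ract_one\<close>)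

sublocale K: tensor_right A A sub C
  by (intro tensor_right.intro right_module_sub bimodule_C)

lemma inclusion_hom: "(\<lambda>x. x) \<in> right_hom A sub M"
  by (rule right_homI) (simp_all add: X_carrier)

abbreviation "incl \<equiv> tensor_map A M C (\<lambda>x. x) (\<lambda>x. x)"

lemmas incl_hom = K.map_hom[OF T.tp inclusion_hom left_hom_id]
  and incl_pure = K.map_pure[OF T.tp inclusion_hom left_hom_id]

lemma slice_incl:
  "f \<in> functionals \<Longrightarrow> z \<in> carrier (tensor A sub C) \<Longrightarrow> T.slice f (incl z) = K.slice f z"
  by (rule slice_natural[OF K.tp T.tp inclusion_hom])

text \<open>The slices of a tensor over X are those of its image over M, and slices
  separate.\<close>

lemma incl_inj:
  assumes "z \<in> carrier (tensor A sub C)" "z' \<in> carrier (tensor A sub C)" "incl z = incl z'"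
  shows "z = z'"
  by (rule K.slices_separate[OF lfr assms(1,2)])
    (use slice_incl[OF _ assms(1)] slice_incl[OF _ assms(2)] assms(3) in simp)

text \<open>A finite-rank map fixing the coaction of x writes it as a sum of act f x \<otimes> w,
  and act f x stays in the stable X.\<close>

lemma coact_lift:
  assumes x: "x \<in> X"
  shows "\<exists>z\<in>carrier (tensor A sub C). incl z = coact M x"
proof -
  note co = coact_closed[OF X_carrier[OF x]]
  obtain S where S: "S \<in> fin_rank A C" "tensor_map A M C (\<lambda>x. x) S (coact M x) = coact M x"
    using T.fin_rank_fixing[OF lfr co] by auto
  from S(1) have "\<exists>z\<in>carrier (tensor A sub C). incl z = tensor_map A M C (\<lambda>x. x) S (coact M x)"
  proof (induction rule: fin_rank.induct)
    case (rank_one f w)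
    have a: "T.slice f (coact M x) \<in> X" using stable_act[OF stable_X rank_one(1) x] by (simp add: act_def)
    have "incl (pure_tensor A sub C (T.slice f (coact M x)) w) = tensor_map A M C (\<lambda>x. x) (\<lambda>x. f x \<odot>\<^bsub>C\<^esub> w) (coact M x)"
      using incl_pure[of "T.slice f (coact M x)" w] a rank_one(2)
      by (simp add: T.map_rank_one[OF rank_one co])
    then show ?case using K.pure_closed[of "T.slice f (coact M x)" w] a rank_one(2) by auto
  next
    case (add S U)
    then obtain z z' where z: "z \<in> carrier (tensor A sub C)" "incl z = tensor_map A M C (\<lambda>x. x) S (coact M x)"
      "z' \<in> carrier (tensor A sub C)" "incl z' = tensor_map A M C (\<lambda>x. x) U (coact M x)" by auto
    have "incl (z \<oplus>\<^bsub>tensor A sub C\<^esub> z') = tensor_map A M C (\<lambda>x. x) (\<lambda>x. S x \<oplus>\<^bsub>C\<^esub> U x) (coact M x)"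
      using add_hom_add[OF incl_hom z(1,3)] z(2,4) add.hyps
      by (simp add: T.map_sum[OF _ _ co] C.L.fin_rank_left_hom)
    then show ?case using K.T.a_closed[OF z(1,3)] by auto
  next
    case (cong S U)
    then show ?case using T.map_fin_rank_cong[OF cong(1,2) co] by simp
  qed
  then show ?thesis using S(2) by simp
qed

lemma
  assumes "x \<in> X"
  shows coact_sub_closed: "coact_sub x \<in> carrier (tensor A sub C)"
    and incl_coact_sub: "incl (coact_sub x) = coact M x"
proof -
  have "\<exists>z. z \<in> carrier (tensor A sub C) \<and> incl z = coact M x" using coact_lift[OF assms] by auto
  from someI_ex[OF this] show "coact_sub x \<in> carrier (tensor A sub C)" "incl (coact_sub x) = coact M x"
    by (simp_all add: coact_sub_def tensor_sub)
qed

lemma coact_sub_hom: "coact_sub \<in> right_hom A sub (tensor A sub C)"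
proof (rule right_homI)
  note i = tensor_map_right_hom[OF K.tensor_right_axioms T.tensor_right_axioms inclusion_hom]
  interpret KT: right_module A "tensor A sub C" by (rule K.right_module_tensor)
  show "coact_sub x \<in> carrier (tensor A sub C)" if "x \<in> carrier sub" for x
    using coact_sub_closed that by simp
  show "coact_sub (x \<oplus>\<^bsub>sub\<^esub> y) = coact_sub x \<oplus>\<^bsub>tensor A sub C\<^esub> coact_sub y"
    if "x \<in> carrier sub" "y \<in> carrier sub" for x y
  proof (rule incl_inj)
    have xy: "x \<in> X" "y \<in> X" "x \<oplus>\<^bsub>M\<^esub> y \<in> X" using that op.stable_add[OF stable_X] by auto
    show "coact_sub (x \<oplus>\<^bsub>sub\<^esub> y) \<in> carrier (tensor A sub C)" using coact_sub_closed[OF xy(3)] by simp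
    show "coact_sub x \<oplus>\<^bsub>tensor A sub C\<^esub> coact_sub y \<in> carrier (tensor A sub C)"
      by (rule K.T.a_closed[OF coact_sub_closed[OF xy(1)] coact_sub_closed[OF xy(2)]])
    show "incl (coact_sub (x \<oplus>\<^bsub>sub\<^esub> y)) = incl (coact_sub x \<oplus>\<^bsub>tensor A sub C\<^esub> coact_sub y)"
      using xy right_hom_add[OF coact_hom X_carrier[OF xy(1)] X_carrier[OF xy(2)]]
      by (simp add: add_hom_add[OF incl_hom] coact_sub_closed incl_coact_sub)
  qed
  show "coact_sub (x \<triangleleft>\<^bsub>sub\<^esub> a) = coact_sub x \<triangleleft>\<^bsub>tensor A sub C\<^esub> a"
    if "x \<in> carrier sub" "a \<in> carrier A" for x a
  proof (rule incl_inj)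
    have xa: "x \<in> X" "x \<triangleleft>\<^bsub>M\<^esub> a \<in> X" using that stable_ract[OF stable_X] by auto
    show "coact_sub (x \<triangleleft>\<^bsub>sub\<^esub> a) \<in> carrier (tensor A sub C)" using coact_sub_closed[OF xa(2)] by simp
    show "coact_sub x \<triangleleft>\<^bsub>tensor A sub C\<^esub> a \<in> carrier (tensor A sub C)"
      by (rule KT.ract_closed[OF coact_sub_closed[OF xa(1)] that(2)])
    show "incl (coact_sub (x \<triangleleft>\<^bsub>sub\<^esub> a)) = incl (coact_sub x \<triangleleft>\<^bsub>tensor A sub C\<^esub> a)"
      using xa that(2) right_hom_ract[OF coact_hom X_carrier[OF xa(1)] that(2)]
      by (simp add: right_hom_ract[OF i] coact_sub_closed incl_coact_sub)
  qed
qed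

text \<open>Coassociativity is compared in M \<otimes> (C \<otimes> C), where it is that of M, and
  brought back by injectivity of \<open>?I\<close>.\<close>

lemma comodule_sub: "comodule A C sub"
proof (intro comodule.intro comodule_axioms.intro right_module_sub C.coring_axioms)
  show "coact sub \<in> right_hom A sub (tensor A sub C)" using coact_sub_hom by simp
next
  fix x assume "x \<in> carrier sub"
  then have x: "x \<in> X" by simp
  note z = coact_sub_closed[OF x]
  interpret CC: tensor_left A A C C ..
  interpret CCm: left_module A "tensor A C C" by (rule CC.left_module_tensor)
  interpret KC: right_module A "tensor A sub C" by (rule K.right_module_tensor)
  interpret MC: right_module A "tensor A M C" by (rule T.right_module_tensor)
  interpret K3: tensor_triple A sub C C ..
  interpret M3: tensor_triple A M C C ..
  interpret KCC: tensor_pair A "tensor A sub C" C ..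
  interpret MCC: tensor_pair A "tensor A M C" C ..
  interpret KD: tensor_pair A sub "tensor A C C" ..
  interpret MD: tensor_pair A M "tensor A C C" ..
  have \<Delta>: "comul C \<in> left_hom A C (tensor A C C)" using C.comul_hom by simp
  note I = KD.map_hom[OF MD.tp inclusion_hom left_hom_id]
    and I_pure = KD.map_pure[OF MD.tp inclusion_hom left_hom_id]
  let ?I = "tensor_map A M (tensor A C C) (\<lambda>x. x) (\<lambda>x. x)"
  note rK = K.map_hom[OF KCC.tp coact_sub_hom left_hom_id]
    and rK_pure = K.map_pure[OF KCC.tp coact_sub_hom left_hom_id]
  note rM = T.map_hom[OF MCC.tp coact_hom left_hom_id]
    and rM_pure = T.map_pure[OF MCC.tp coact_hom left_hom_id]
  note dK = K.map_hom[OF KD.tp right_hom_id \<Delta>] and dK_pure = K.map_pure[OF KD.tp right_hom_id \<Delta>]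
  note dM = T.map_hom[OF MD.tp right_hom_id \<Delta>] and dM_pure = T.map_pure[OF MD.tp right_hom_id \<Delta>]
  \<comment> \<open>Facts 1 and 2 show that the inclusion commutes with the associativity map, on t
    \<otimes> c and after the coaction; fact 3 is the same for the comultiplication on the right
    factor.\<close>
  have 1: "?I (tensor_assoc A sub C C (pure_tensor A (tensor A sub C) C t c))
      = tensor_assoc A M C C (pure_tensor A (tensor A M C) C (incl t) c)"
    if t: "t \<in> carrier (tensor A sub C)" and c: "c \<in> carrier C" for t c
  proof -
    have hK: "(\<lambda>t. pure_tensor A (tensor A sub C) C t c) \<in> add_hom (tensor A sub C) (tensor A (tensor A sub C) C)"
      using c by (simp add: add_hom_iff KCC.pure_closed KCC.add_left)
    have hM: "(\<lambda>t. pure_tensor A (tensor A M C) C t c) \<in> add_hom (tensor A M C) (tensor A (tensor A M C) C)"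
      using c by (simp add: add_hom_iff MCC.pure_closed MCC.add_left)
    show ?thesis
      by (rule K.hom_eq[OF MD.T.abelian_group_axioms add_hom_comp[OF add_hom_comp[OF hK K3.assoc_hom] I]
            add_hom_comp[OF add_hom_comp[OF incl_hom hM] M3.assoc_hom] _ t])
        (simp add: c K3.assoc_pure M3.assoc_pure incl_pure I_pure X_carrier CC.pure_closed)
  qed
  have 2: "?I (tensor_assoc A sub C C (tensor_map A (tensor A sub C) C coact_sub (\<lambda>x. x) t))
      = tensor_assoc A M C C (tensor_map A (tensor A M C) C (coact M) (\<lambda>x. x) (incl t))"
    if t: "t \<in> carrier (tensor A sub C)" for t
    by (rule K.hom_eq[OF MD.T.abelian_group_axioms add_hom_comp[OF add_hom_comp[OF rK K3.assoc_hom] I]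
          add_hom_comp[OF add_hom_comp[OF incl_hom rM] M3.assoc_hom] _ t])
      (simp add: rK_pure rM_pure incl_pure X_carrier 1 coact_sub_closed incl_coact_sub)
  have 3: "?I (tensor_map A sub (tensor A C C) (\<lambda>x. x) (comul C) t)
      = tensor_map A M (tensor A C C) (\<lambda>x. x) (comul C) (incl t)"
    if t: "t \<in> carrier (tensor A sub C)" for t
    by (rule K.hom_eq[OF MD.T.abelian_group_axioms add_hom_comp[OF dK I] add_hom_comp[OF incl_hom dM] _ t])
      (simp add: dK_pure dM_pure incl_pure I_pure X_carrier left_hom_closed[OF \<Delta>])
  \<comment> \<open>Functionals of C \<otimes> C separate here by
    \<open>locally_fin_rank_tensor\<close>, and their slices over X and over M agree.\<close>
  have inj: "y = y'" if "y \<in> carrier (tensor A sub (tensor A C C))" "y' \<in> carrier (tensor A sub (tensor A C C))"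
    "?I y = ?I y'" for y y'
  proof (rule KD.slices_separate[OF locally_fin_rank_tensor[OF bimodule_C C.L.left_module_axioms lfr lfr] that(1,2)])
    fix f assume f: "f \<in> left_hom A (tensor A C C) (regular_bimodule A)"
    show "KD.slice f y = KD.slice f y'"
      using slice_natural[OF KD.tp MD.tp inclusion_hom f that(1)]
        slice_natural[OF KD.tp MD.tp inclusion_hom f that(2)] that(3) by simp
  qed
  have "tensor_assoc A sub C C (tensor_map A (tensor A sub C) C coact_sub (\<lambda>x. x) (coact_sub x))
      = tensor_map A sub (tensor A C C) (\<lambda>x. x) (comul C) (coact_sub x)"
  proof (rule inj)
    show "tensor_assoc A sub C C (tensor_map A (tensor A sub C) C coact_sub (\<lambda>x. x) (coact_sub x))
        \<in> carrier (tensor A sub (tensor A C C))"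
      by (rule add_hom_closed[OF K3.assoc_hom add_hom_closed[OF rK z]])
    show "tensor_map A sub (tensor A C C) (\<lambda>x. x) (comul C) (coact_sub x) \<in> carrier (tensor A sub (tensor A C C))"
      by (rule add_hom_closed[OF dK z])
    show "?I (tensor_assoc A sub C C (tensor_map A (tensor A sub C) C coact_sub (\<lambda>x. x) (coact_sub x)))
        = ?I (tensor_map A sub (tensor A C C) (\<lambda>x. x) (comul C) (coact_sub x))"
      unfolding 2[OF z] 3[OF z] incl_coact_sub[OF x]
      using coact_coassoc[OF X_carrier[OF x]] by (simp add: id_def)
  qed
  then show "tensor_assoc A sub C C (tensor_map A (tensor A sub C) C (coact sub) id (coact sub x))
      = tensor_map A sub (tensor A C C) id (comul C) (coact sub x)"
    by (simp add: id_def)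
  have e: "counit C \<in> functionals" using C.counit_hom by simp
  show "tensor_lift sub (\<lambda>x c. x \<triangleleft>\<^bsub>sub\<^esub> counit C c) (coact sub x) = x"
    using slice_incl[OF e z] coact_counit[OF X_carrier[OF x]] by (simp add: incl_coact_sub[OF x])
qed

lemma is_subcomodule_sub: "is_subcomodule A C sub M"
  using comodule_sub inclusion_hom X_carrier incl_coact_sub
  by (auto simp: is_subcomodule_def comod_hom_def id_def)

end

context locally_projective_comodule
begin

lemma subcomodule_if_stable:
  assumes "op.stable X"
  shows "\<exists>K. is_subcomodule A C K M \<and> carrier K = X"
proof -
  interpret stable_subgroup A C M X by unfold_locales (rule assms)
  show ?thesis using is_subcomodule_sub by auto
qed

lemma subcomodules_eq: "subcomodules A C M = {X. op.stable X}"
  using stable_if_subcomodule subcomodule_if_stable unfolding subcomodules_def by blast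


lemma colinear_iff:
  "g \<in> comod_hom A C M M \<longleftrightarrow> g \<in> right_hom A M M \<and>
    (\<forall>f\<in>functionals. \<forall>m\<in>carrier M. g (act f m) = act f (g m))"
  unfolding act_def
  by (rule comod_hom_iff[OF lfr T.tp T.tp coact_closed coact_closed])

lemma colinearI:
  assumes "g \<in> right_hom A M M" "\<And>f m. f \<in> functionals \<Longrightarrow> m \<in> carrier M \<Longrightarrow> g (act f m) = act f (g m)"
  shows "g \<in> comod_hom A C M M"
  using assms by (simp add: colinear_iff)

lemma
  assumes "g \<in> comod_hom A C M M"
  shows colinear_right_hom: "g \<in> right_hom A M M"
    and colinear_act: "f \<in> functionals \<Longrightarrow> m \<in> carrier M \<Longrightarrow> g (act f m) = act f (g m)"
  using assms by (simp_all add: colinear_iff)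

lemma colinear_restrict:
  assumes g: "g \<in> comod_hom A C M M"
  shows "restrict g (carrier M) \<in> comod_hom A C M M"
proof (rule colinearI)
  note r = colinear_right_hom[OF g]
  show "restrict g (carrier M) \<in> right_hom A M M"
    by (rule right_homI)
      (simp_all add: M.ract_closed right_hom_closed[OF r] right_hom_add[OF r] right_hom_ract[OF r])
qed (simp add: act_closed colinear_act[OF g])

text \<open>Bridges \<open>functionals\<close> and the left dual ring, whose elements are
  extensional: restricting a functional leaves its action unchanged.
  \<open>colinear_restrict\<close> does the same for endomorphisms.\<close>

lemma act_restrict:
  assumes f: "f \<in> functionals"
  shows "restrict f (carrier C) \<in> functionals"
    and "m \<in> carrier M \<Longrightarrow> act (restrict f (carrier C)) m = act f m"
proof -
  show r: "restrict f (carrier C) \<in> functionals"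
    by (rule left_homI)
      (use left_hom_closed[OF f] in \<open>simp_all add: C.L.lact_closed left_hom_add[OF f] left_hom_lact[OF f]\<close>)
  have "T.slice (restrict f (carrier C)) (pure_tensor A M C x c) = T.slice f (pure_tensor A M C x c)"
    if "x \<in> carrier M" "c \<in> carrier C" for x c
    unfolding T.slice_pure[OF r that] T.slice_pure[OF f that] using that by simp
  then show "act (restrict f (carrier C)) m = act f m" if "m \<in> carrier M"
    unfolding act_def
    by (rule T.hom_eq[OF M.M.abelian_group_axioms T.slice_hom[OF r] T.slice_hom[OF f] _ coact_closed[OF that]])
qed

sublocale endo: operator_group_endo M "act ` functionals" "comod_hom A C M M"
proof
  fix f g assume f: "f \<in> comod_hom A C M M" and g: "g \<in> comod_hom A C M M"
  note fr = colinear_right_hom[OF f] and gr = colinear_right_hom[OF g]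
  show "f \<circ> g \<in> comod_hom A C M M"
    by (rule colinearI, rule right_homI)
      (simp_all add: right_hom_closed[OF fr] right_hom_closed[OF gr] right_hom_add[OF fr] right_hom_add[OF gr]
        right_hom_ract[OF fr] right_hom_ract[OF gr] colinear_act[OF f] colinear_act[OF g])
  show "(\<lambda>x. f x \<ominus>\<^bsub>M\<^esub> g x) \<in> comod_hom A C M M"
  proof (rule colinearI, rule right_homI)
    fix x a assume x: "x \<in> carrier M" and a: "a \<in> carrier A"
    show "f (x \<triangleleft>\<^bsub>M\<^esub> a) \<ominus>\<^bsub>M\<^esub> g (x \<triangleleft>\<^bsub>M\<^esub> a) = (f x \<ominus>\<^bsub>M\<^esub> g x) \<triangleleft>\<^bsub>M\<^esub> a"
      using add_hom_minus[OF M.M.abelian_group_axioms M.M.abelian_group_axioms M.ract_add_hom[OF a]] x a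
      by (simp add: right_hom_closed[OF fr] right_hom_closed[OF gr] right_hom_ract[OF fr] right_hom_ract[OF gr])
  next
    fix h x assume h: "h \<in> functionals" and x: "x \<in> carrier M"
    show "f (act h x) \<ominus>\<^bsub>M\<^esub> g (act h x) = act h (f x \<ominus>\<^bsub>M\<^esub> g x)"
      using add_hom_minus[OF M.M.abelian_group_axioms M.M.abelian_group_axioms act_hom[OF h]] x h
      by (simp add: right_hom_closed[OF fr] right_hom_closed[OF gr] colinear_act[OF f] colinear_act[OF g])
  qed (simp_all add: right_hom_closed[OF fr] right_hom_closed[OF gr] right_hom_add[OF fr] right_hom_add[OF gr]
      op.minus_add_minus M.M.minus_closed)
next
  show "(\<lambda>x. x) \<in> comod_hom A C M M" by (rule colinearI) (simp_all add: right_hom_id)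
qed (auto simp: right_hom_closed[OF colinear_right_hom] right_hom_add[OF colinear_right_hom] colinear_act)

section \<open>Quotient comodules\<close>

lemma abelian_subgroup_stable: "op.stable W \<Longrightarrow> abelian_subgroup W M"
  by (rule abelian_subgroupI3[OF additive_subgroupI M.M.abelian_group_axioms]) (simp add: op.stable_def)

abbreviation quotient :: "'m set \<Rightarrow> ('l, 'a, 'm set, 'c) comodule" where
  "quotient W \<equiv> quotient_comodule A C M W"

lemma quotient_simps [simp]:
  "carrier (quotient W) = a_rcosets\<^bsub>M\<^esub> W" "add (quotient W) = set_add M" "\<zero>\<^bsub>quotient W\<^esub> = W"
  by (simp_all add: quotient_comodule_def bimodule.extend_def comodule.fields_def quotient_module_def)

lemma quotient_ract_coact:
  "ract (quotient W) = (\<lambda>X a. \<Union>x\<in>X. W +>\<^bsub>M\<^esub> (x \<triangleleft>\<^bsub>M\<^esub> a))"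
  "coact (quotient W) = (\<lambda>X. tensor_map A (quotient_module M W) C (\<lambda>x. W +>\<^bsub>M\<^esub> x) id (coact M (SOME x. x \<in> X)))"
  by (simp_all add: quotient_comodule_def bimodule.extend_def comodule.fields_def quotient_module_def)

lemma coset_eq_iff:
  assumes W: "op.stable W" and x: "x \<in> carrier M" "y \<in> carrier M"
  shows "W +>\<^bsub>M\<^esub> x = W +>\<^bsub>M\<^esub> y \<longleftrightarrow> x \<ominus>\<^bsub>M\<^esub> y \<in> W"
proof -
  interpret W: abelian_subgroup W M by (rule abelian_subgroup_stable[OF W])
  have "x \<ominus>\<^bsub>M\<^esub> y \<in> W \<longleftrightarrow> x \<in> W +>\<^bsub>M\<^esub> y"
    using W.a_rcos_module[OF x(2,1)] by (simp add: a_minus_def)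
  also have "\<dots> \<longleftrightarrow> W +>\<^bsub>M\<^esub> x = W +>\<^bsub>M\<^esub> y"
    using M.M.a_repr_independence[of x W y] W.a_subgroup x W.a_rcos_self[OF x(1)] by auto
  finally show ?thesis by simp
qed

lemma mem_coset:
  assumes W: "op.stable W" and x: "x \<in> carrier M" "y \<in> W +>\<^bsub>M\<^esub> x"
  shows "y \<in> carrier M" "W +>\<^bsub>M\<^esub> y = W +>\<^bsub>M\<^esub> x"
proof -
  interpret W: abelian_subgroup W M by (rule abelian_subgroup_stable[OF W])
  show "y \<in> carrier M" using x by (rule W.a_elemrcos_carrier)
  show "W +>\<^bsub>M\<^esub> y = W +>\<^bsub>M\<^esub> x"
    using M.M.a_repr_independence[OF x(2,1) W.a_subgroup] by simp
qed

lemma self_mem_coset: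
  assumes W: "op.stable W" and x: "x \<in> carrier M" shows "x \<in> W +>\<^bsub>M\<^esub> x"
proof -
  interpret W: abelian_subgroup W M by (rule abelian_subgroup_stable[OF W])
  show ?thesis by (rule W.a_rcos_self[OF x])
qed

lemma coset_carrier: "op.stable W \<Longrightarrow> x \<in> carrier M \<Longrightarrow> W +>\<^bsub>M\<^esub> x \<in> a_rcosets\<^bsub>M\<^esub> W"
  using M.M.a_rcosetsI[OF op.stable_subset] by simp

lemma coset_carrierE:
  assumes "Z \<in> a_rcosets\<^bsub>M\<^esub> W" obtains x where "x \<in> carrier M" "Z = W +>\<^bsub>M\<^esub> x"
  using assms by (auto simp: A_RCOSETS_def')

lemma coset_add:
  assumes W: "op.stable W" and "x \<in> carrier M" "y \<in> carrier M"
  shows "(W +>\<^bsub>M\<^esub> x) <+>\<^bsub>M\<^esub> (W +>\<^bsub>M\<^esub> y) = W +>\<^bsub>M\<^esub> (x \<oplus>\<^bsub>M\<^esub> y)"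
proof -
  interpret W: abelian_subgroup W M by (rule abelian_subgroup_stable[OF W])
  show ?thesis by (rule W.a_rcos_sum[OF assms(2,3)])
qed

lemma coset_ract:
  assumes W: "op.stable W" and x: "x \<in> carrier M" and a: "a \<in> carrier A"
  shows "(W +>\<^bsub>M\<^esub> x) \<triangleleft>\<^bsub>quotient W\<^esub> a = W +>\<^bsub>M\<^esub> (x \<triangleleft>\<^bsub>M\<^esub> a)"
proof -
  have "W +>\<^bsub>M\<^esub> (y \<triangleleft>\<^bsub>M\<^esub> a) = W +>\<^bsub>M\<^esub> (x \<triangleleft>\<^bsub>M\<^esub> a)" if y: "y \<in> W +>\<^bsub>M\<^esub> x" for y
  proof -
    note yc = mem_coset[OF W x y]
    have "y \<ominus>\<^bsub>M\<^esub> x \<in> W" using coset_eq_iff[OF W yc(1) x] yc(2) by simp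
    then have "(y \<ominus>\<^bsub>M\<^esub> x) \<triangleleft>\<^bsub>M\<^esub> a \<in> W" by (rule stable_ract[OF W _ a])
    then have "y \<triangleleft>\<^bsub>M\<^esub> a \<ominus>\<^bsub>M\<^esub> x \<triangleleft>\<^bsub>M\<^esub> a \<in> W"
      using add_hom_minus[OF M.M.abelian_group_axioms M.M.abelian_group_axioms M.ract_add_hom[OF a] yc(1) x] by simp
    then show ?thesis using coset_eq_iff[OF W] yc(1) x a M.ract_closed by simp
  qed
  then have "(\<Union>y\<in>W +>\<^bsub>M\<^esub> x. W +>\<^bsub>M\<^esub> (y \<triangleleft>\<^bsub>M\<^esub> a)) = (\<Union>y\<in>W +>\<^bsub>M\<^esub> x. W +>\<^bsub>M\<^esub> (x \<triangleleft>\<^bsub>M\<^esub> a))"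
    by (rule SUP_cong[OF refl])
  also have "\<dots> = W +>\<^bsub>M\<^esub> (x \<triangleleft>\<^bsub>M\<^esub> a)"
    using self_mem_coset[OF W x] by (intro UN_constant_eq) auto
  finally show ?thesis by (simp add: quotient_ract_coact)
qed

lemma coset_zero: "op.stable W \<Longrightarrow> W +>\<^bsub>M\<^esub> \<zero>\<^bsub>M\<^esub> = W"
  using M.M.a_coset_add_zero[OF op.stable_subset] by simp

lemma coset_eq_self_iff:
  assumes "op.stable W" "x \<in> carrier M" shows "W +>\<^bsub>M\<^esub> x = W \<longleftrightarrow> x \<in> W"
  using coset_eq_iff[OF assms M.M.zero_closed] assms by (simp add: coset_zero op.minus_zero)

lemma right_module_quotient:
  assumes W: "op.stable W"
  shows "right_module A (quotient W)"
proof (intro right_module.intro right_module_axioms.intro abelian_groupI C.L.A.ring_axioms)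
  fix X Y Z a b
  assume X: "X \<in> carrier (quotient W)"
  then obtain x where x: "x \<in> carrier M" "X = W +>\<^bsub>M\<^esub> x" by (auto elim: coset_carrierE)
  note rules = coset_add[OF W] coset_ract[OF W] coset_carrier[OF W] M.ract_closed
  have W0: "W = W +>\<^bsub>M\<^esub> \<zero>\<^bsub>M\<^esub>" by (simp add: coset_zero[OF W])
  show "\<zero>\<^bsub>quotient W\<^esub> \<oplus>\<^bsub>quotient W\<^esub> X = X"
    using coset_add[OF W M.M.zero_closed x(1)] x by (simp add: coset_zero[OF W])
  show "X \<triangleleft>\<^bsub>quotient W\<^esub> \<one>\<^bsub>A\<^esub> = X"
    unfolding x(2) by (subst coset_ract[OF W x(1)]) (simp_all add: M.ract_one x(1))
  show "\<exists>Y\<in>carrier (quotient W). Y \<oplus>\<^bsub>quotient W\<^esub> X = \<zero>\<^bsub>quotient W\<^esub>"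
    using x coset_carrier[OF W, of "\<ominus>\<^bsub>M\<^esub> x"] coset_add[OF W, of "\<ominus>\<^bsub>M\<^esub> x" x]
    by (intro bexI[of _ "W +>\<^bsub>M\<^esub> (\<ominus>\<^bsub>M\<^esub> x)"]) (simp_all add: M.M.l_neg coset_zero[OF W])
  {
    assume a: "a \<in> carrier A"
    show "X \<triangleleft>\<^bsub>quotient W\<^esub> a \<in> carrier (quotient W)"
      unfolding x(2) coset_ract[OF W x(1) a] using x(1) a by (simp add: coset_carrier[OF W] M.ract_closed)
    assume b: "b \<in> carrier A"
    show "X \<triangleleft>\<^bsub>quotient W\<^esub> (a \<oplus>\<^bsub>A\<^esub> b) = X \<triangleleft>\<^bsub>quotient W\<^esub> a \<oplus>\<^bsub>quotient W\<^esub> X \<triangleleft>\<^bsub>quotient W\<^esub> b"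
      unfolding x(2) coset_ract[OF W x(1) a] coset_ract[OF W x(1) b] coset_ract[OF W x(1) C.L.A.a_closed[OF a b]]
      using x(1) a b by (simp add: coset_add[OF W] M.ract_closed M.ract_r_distr)
    show "X \<triangleleft>\<^bsub>quotient W\<^esub> (a \<otimes>\<^bsub>A\<^esub> b) = (X \<triangleleft>\<^bsub>quotient W\<^esub> a) \<triangleleft>\<^bsub>quotient W\<^esub> b"
      unfolding x(2) coset_ract[OF W x(1) a] coset_ract[OF W M.ract_closed[OF x(1) a] b]
        coset_ract[OF W x(1) C.L.A.m_closed[OF a b]]
      using x(1) a b by (simp add: M.ract_assoc)
  }
  assume Y: "Y \<in> carrier (quotient W)"
  then obtain y where y: "y \<in> carrier M" "Y = W +>\<^bsub>M\<^esub> y" by (auto elim: coset_carrierE)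
  have xy: "x \<oplus>\<^bsub>M\<^esub> y \<in> carrier M" using x y by simp
  show "X \<oplus>\<^bsub>quotient W\<^esub> Y \<in> carrier (quotient W)"
    using x y by (simp add: coset_add[OF W] coset_carrier[OF W])
  show "X \<oplus>\<^bsub>quotient W\<^esub> Y = Y \<oplus>\<^bsub>quotient W\<^esub> X"
    using x y by (simp add: coset_add[OF W] M.M.a_comm)
  show "(X \<oplus>\<^bsub>quotient W\<^esub> Y) \<triangleleft>\<^bsub>quotient W\<^esub> a = X \<triangleleft>\<^bsub>quotient W\<^esub> a \<oplus>\<^bsub>quotient W\<^esub> Y \<triangleleft>\<^bsub>quotient W\<^esub> a"
    if a: "a \<in> carrier A"
  proof -
    have "X \<oplus>\<^bsub>quotient W\<^esub> Y = W +>\<^bsub>M\<^esub> (x \<oplus>\<^bsub>M\<^esub> y)" using x y by (simp add: coset_add[OF W])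
    then show ?thesis
      unfolding x(2) y(2) coset_ract[OF W x(1) a] coset_ract[OF W y(1) a]
      using coset_ract[OF W xy a] x(1) y(1) a
      by (simp add: coset_add[OF W] M.ract_closed M.ract_l_distr)
  qed
  assume Z: "Z \<in> carrier (quotient W)"
  then obtain z where z: "z \<in> carrier M" "Z = W +>\<^bsub>M\<^esub> z" by (auto elim: coset_carrierE)
  show "X \<oplus>\<^bsub>quotient W\<^esub> Y \<oplus>\<^bsub>quotient W\<^esub> Z = X \<oplus>\<^bsub>quotient W\<^esub> (Y \<oplus>\<^bsub>quotient W\<^esub> Z)"
    using x y z by (simp add: coset_add[OF W] M.M.a_assoc)
qed (use coset_carrier[OF assms M.M.zero_closed] coset_zero[OF assms] in auto)

lemma projection_hom: "op.stable W \<Longrightarrow> (\<lambda>x. W +>\<^bsub>M\<^esub> x) \<in> right_hom A M (quotient W)"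
  by (rule right_homI) (simp_all add: coset_carrier coset_add coset_ract)

lemma tensor_pair_quotient: "op.stable W \<Longrightarrow> tensor_pair A (quotient W) C"
  by (intro tensor_pair.intro right_module_quotient C.L.left_module_axioms)

text \<open>The coaction of M/W is defined at a chosen representative of the coset; y exposes that
  representative.\<close>

lemma coact_quotient:
  assumes W: "op.stable W" and Z: "Z \<in> carrier (quotient W)"
  obtains y where "y \<in> carrier M" "Z = W +>\<^bsub>M\<^esub> y"
    "coact (quotient W) Z = tensor_map A (quotient W) C (\<lambda>x. W +>\<^bsub>M\<^esub> x) (\<lambda>x. x) (coact M y)"
proof -
  obtain x where x: "x \<in> carrier M" "Z = W +>\<^bsub>M\<^esub> x" using Z by (auto elim: coset_carrierE)
  define y where "y = (SOME y. y \<in> Z)"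
  have "y \<in> Z" unfolding y_def x(2) by (rule someI[of _ x]) (rule self_mem_coset[OF W x(1)])
  then have "y \<in> W +>\<^bsub>M\<^esub> x" by (simp only: x(2))
  note y = mem_coset[OF W x(1) this]
  have q: "tensor A (quotient_module M W) C = tensor A (quotient W) C"
    "pure_tensor A (quotient_module M W) C = pure_tensor A (quotient W) C"
    by (rule tensor_cong; simp add: quotient_comodule_def bimodule.extend_def comodule.fields_def quotient_module_def)+
  have "coact (quotient W) Z = tensor_map A (quotient W) C (\<lambda>x. W +>\<^bsub>M\<^esub> x) (\<lambda>x. x) (coact M y)"
    by (simp add: quotient_ract_coact tensor_map_def q id_def y_def)
  then show thesis using that[of y] y x(2) by simp
qed

lemma coact_quotient_closed:
  assumes W: "op.stable W" and Z: "Z \<in> carrier (quotient W)"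
  shows "coact (quotient W) Z \<in> carrier (tensor A (quotient W) C)"
proof -
  obtain y where y: "y \<in> carrier M"
    "coact (quotient W) Z = tensor_map A (quotient W) C (\<lambda>x. W +>\<^bsub>M\<^esub> x) (\<lambda>x. x) (coact M y)"
    using coact_quotient[OF W Z] by metis
  show ?thesis
    unfolding y(2)
    by (rule add_hom_closed[OF T.map_hom[OF tensor_pair_quotient[OF W] projection_hom[OF W] left_hom_id]
          coact_closed[OF y(1)]])
qed

text \<open>Two representatives differ by an element of W, and \<open>act f\<close> maps W into W.
  So the slices, unlike the definition of the coaction, visibly do not depend on the choice.\<close>

lemma slice_quotient:
  assumes W: "op.stable W" and f: "f \<in> functionals" and x: "x \<in> carrier M"
  shows "tensor_lift (quotient W) (\<lambda>x c. x \<triangleleft>\<^bsub>quotient W\<^esub> f c) (coact (quotient W) (W +>\<^bsub>M\<^esub> x)) = W +>\<^bsub>M\<^esub> act f x"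
proof -
  have Z: "W +>\<^bsub>M\<^esub> x \<in> carrier (quotient W)" using coset_carrier[OF W x] by simp
  obtain y where y: "y \<in> carrier M" "W +>\<^bsub>M\<^esub> x = W +>\<^bsub>M\<^esub> y"
    "coact (quotient W) (W +>\<^bsub>M\<^esub> x) = tensor_map A (quotient W) C (\<lambda>x. W +>\<^bsub>M\<^esub> x) (\<lambda>x. x) (coact M y)"
    using coact_quotient[OF W Z] by metis
  have "y \<ominus>\<^bsub>M\<^esub> x \<in> W" using coset_eq_iff[OF W y(1) x] y(2) by simp
  then have "act f (y \<ominus>\<^bsub>M\<^esub> x) \<in> W" by (rule stable_act[OF W f])
  then have "act f y \<ominus>\<^bsub>M\<^esub> act f x \<in> W"
    using add_hom_minus[OF M.M.abelian_group_axioms M.M.abelian_group_axioms act_hom[OF f] y(1) x] by simp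
  then have "W +>\<^bsub>M\<^esub> act f y = W +>\<^bsub>M\<^esub> act f x" using coset_eq_iff[OF W] act_closed[OF f] x y(1) by simp
  then show ?thesis
    unfolding y(3) slice_natural[OF T.tp tensor_pair_quotient[OF W] projection_hom[OF W] f coact_closed[OF y(1)]]
    by (simp add: act_def)
qed

lemma comod_hom_to_quotient_iff:
  assumes "op.stable W"
  shows "g \<in> comod_hom A C M (quotient W) \<longleftrightarrow> g \<in> right_hom A M (quotient W) \<and>
    (\<forall>f\<in>functionals. \<forall>m\<in>carrier M. g (act f m) =
      tensor_lift (quotient W) (\<lambda>x c. x \<triangleleft>\<^bsub>quotient W\<^esub> f c) (coact (quotient W) (g m)))"
  unfolding act_def
  by (rule comod_hom_iff[OF lfr T.tp tensor_pair_quotient[OF assms] coact_closed coact_quotient_closed[OF assms]])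

lemma comod_hom_from_quotient_iff:
  assumes "op.stable W"
  shows "h \<in> comod_hom A C (quotient W) M \<longleftrightarrow> h \<in> right_hom A (quotient W) M \<and>
    (\<forall>f\<in>functionals. \<forall>Z\<in>carrier (quotient W).
      h (tensor_lift (quotient W) (\<lambda>x c. x \<triangleleft>\<^bsub>quotient W\<^esub> f c) (coact (quotient W) Z)) = act f (h Z))"
  unfolding act_def
  by (rule comod_hom_iff[OF lfr tensor_pair_quotient[OF assms] T.tp coact_quotient_closed[OF assms] coact_closed])

section \<open>Self-cogeneration, self-projectivity and self-injectivity as properties of
  endomorphisms\<close>

lemma separating_endomorphism:
  assumes cog: "self_cogenerator A C M" and W: "op.stable W" and x: "x \<in> carrier M" "x \<notin> W"
  shows "\<exists>h\<in>comod_hom A C M M. (\<forall>w\<in>W. h w = \<zero>\<^bsub>M\<^esub>) \<and> h x \<noteq> \<zero>\<^bsub>M\<^esub>"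
proof -
  have "(\<Inter>h\<in>comod_hom A C (quotient W) M. a_kernel (quotient W) M h) = {W}"
    using cog W subcomodules_eq unfolding self_cogenerator_def by simp
  moreover have "W +>\<^bsub>M\<^esub> x \<noteq> W" using coset_eq_self_iff[OF W x(1)] x(2) by simp
  ultimately obtain h where h: "h \<in> comod_hom A C (quotient W) M" "W +>\<^bsub>M\<^esub> x \<notin> a_kernel (quotient W) M h"
    by blast
  note iff = h(1)[unfolded comod_hom_from_quotient_iff[OF W]]
  from iff have hr: "h \<in> right_hom A (quotient W) M" by simp
  let ?g = "\<lambda>x. h (W +>\<^bsub>M\<^esub> x)"
  have cc: "W +>\<^bsub>M\<^esub> y \<in> carrier (quotient W)" if "y \<in> carrier M" for y using coset_carrier[OF W that] by simp
  note pr = projection_hom[OF W]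
  have "?g \<in> comod_hom A C M M"
  proof (rule colinearI, rule right_homI)
    show "?g (act f m) = act f (?g m)" if "f \<in> functionals" "m \<in> carrier M" for f m
      using iff slice_quotient[OF W that] cc[OF that(2)] that(1) by metis
    show "?g y \<in> carrier M" if "y \<in> carrier M" for y by (rule right_hom_closed[OF hr cc[OF that]])
    show "?g (y \<oplus>\<^bsub>M\<^esub> z) = ?g y \<oplus>\<^bsub>M\<^esub> ?g z" if "y \<in> carrier M" "z \<in> carrier M" for y z
      using right_hom_add[OF hr cc[OF that(1)] cc[OF that(2)]] right_hom_add[OF pr that] by simp
    show "?g (y \<triangleleft>\<^bsub>M\<^esub> a) = ?g y \<triangleleft>\<^bsub>M\<^esub> a" if "y \<in> carrier M" "a \<in> carrier A" for y a
      using right_hom_ract[OF hr cc[OF that(1)] that(2)] right_hom_ract[OF pr that] by simp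
  qed
  moreover have "?g w = \<zero>\<^bsub>M\<^esub>" if "w \<in> W" for w
  proof -
    have "W +>\<^bsub>M\<^esub> w = \<zero>\<^bsub>quotient W\<^esub>" using coset_eq_self_iff[OF W] op.stable_carrier[OF W that] that by simp
    moreover have "h \<zero>\<^bsub>quotient W\<^esub> = \<zero>\<^bsub>M\<^esub>"
    proof -
      interpret Q: right_module A "quotient W" by (rule right_module_quotient[OF W])
      show ?thesis
        by (rule add_hom_zero[OF Q.M.abelian_group_axioms M.M.abelian_group_axioms right_hom_add_hom[OF hr]])
    qed
    ultimately show ?thesis by simp
  qed
  moreover have "?g x \<noteq> \<zero>\<^bsub>M\<^esub>" using h(2) cc[OF x(1)] unfolding a_kernel_def' by simp
  ultimately show ?thesis by (intro bexI[of _ ?g]) auto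
qed

text \<open>Modulo W = ker b a preimage of f m under b is unique, which gives a colinear map M ->
  M/W. Self-projectivity lifts it to an endomorphism g, and b (g m) = f m because b is constant on
  cosets of W.\<close>

lemma factorization:
  assumes proj: "self_projective A C M" and f: "f \<in> comod_hom A C M M" and b: "b \<in> comod_hom A C M M"
    and sub: "f ` carrier M \<subseteq> b ` carrier M"
  shows "\<exists>g\<in>comod_hom A C M M. \<forall>x\<in>carrier M. f x = b (g x)"
proof -
  define W where "W = {x \<in> carrier M. b x = \<zero>\<^bsub>M\<^esub>}"
  have W: "op.stable W" unfolding W_def by (rule endo.stable_ker[OF b])
  note br = colinear_right_hom[OF b] and fr = colinear_right_hom[OF f]
  have coset_iff: "W +>\<^bsub>M\<^esub> x = W +>\<^bsub>M\<^esub> y \<longleftrightarrow> b x = b y" if "x \<in> carrier M" "y \<in> carrier M" for x y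
    using coset_eq_iff[OF W that] that endo.endo_minus[OF b that] op.minus_eq_zeroD[of "b x" "b y"]
      endo.endo_closed[OF b] op.minus_self by (auto simp: W_def M.M.minus_closed)
  \<comment> \<open>An arbitrary choice of preimages under b; only the coset of \<open>s m\<close>
    modulo W is additive and colinear in m.\<close>
  define s where "s m = (SOME x. x \<in> carrier M \<and> b x = f m)" for m
  have s: "s m \<in> carrier M" "b (s m) = f m" if m: "m \<in> carrier M" for m
  proof -
    have "f m \<in> b ` carrier M" using sub m by auto
    then have "\<exists>x. x \<in> carrier M \<and> b x = f m" by (elim imageE) auto
    from someI_ex[OF this] show "s m \<in> carrier M" "b (s m) = f m" by (simp_all add: s_def)
  qed
  let ?g = "\<lambda>m. W +>\<^bsub>M\<^esub> s m"
  note pr = projection_hom[OF W]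
  have g: "?g \<in> comod_hom A C M (quotient W)"
    unfolding comod_hom_to_quotient_iff[OF W]
  proof (intro conjI ballI right_homI)
    show "?g m \<in> carrier (quotient W)" if "m \<in> carrier M" for m using coset_carrier[OF W s(1)[OF that]] by simp
    show "?g (m \<oplus>\<^bsub>M\<^esub> n) = ?g m \<oplus>\<^bsub>quotient W\<^esub> ?g n" if mn: "m \<in> carrier M" "n \<in> carrier M" for m n
    proof -
      have "?g (m \<oplus>\<^bsub>M\<^esub> n) = W +>\<^bsub>M\<^esub> (s m \<oplus>\<^bsub>M\<^esub> s n)"
        using mn s by (subst coset_iff) (simp_all add: right_hom_add[OF br] right_hom_add[OF fr])
      then show ?thesis using right_hom_add[OF pr s(1)[OF mn(1)] s(1)[OF mn(2)]] by simp
    qed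
    show "?g (m \<triangleleft>\<^bsub>M\<^esub> a) = ?g m \<triangleleft>\<^bsub>quotient W\<^esub> a" if ma: "m \<in> carrier M" "a \<in> carrier A" for m a
    proof -
      have "?g (m \<triangleleft>\<^bsub>M\<^esub> a) = W +>\<^bsub>M\<^esub> (s m \<triangleleft>\<^bsub>M\<^esub> a)"
        using ma s M.ract_closed by (subst coset_iff) (simp_all add: right_hom_ract[OF br] right_hom_ract[OF fr])
      then show ?thesis using right_hom_ract[OF pr s(1)[OF ma(1)] ma(2)] by simp
    qed
    show "?g (act h m)
        = tensor_lift (quotient W) (\<lambda>x c. x \<triangleleft>\<^bsub>quotient W\<^esub> h c) (coact (quotient W) (?g m))"
      if h: "h \<in> functionals" and m: "m \<in> carrier M" for h m
    proof -
      have "?g (act h m) = W +>\<^bsub>M\<^esub> act h (s m)"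
        using m h s act_closed[OF h] by (subst coset_iff) (simp_all add: colinear_act[OF b h] colinear_act[OF f h])
      then show ?thesis by (simp add: slice_quotient[OF W h s(1)[OF m]])
    qed
  qed
  have "W \<in> subcomodules A C M" using W subcomodules_eq by simp
  from proj[unfolded self_projective_def, rule_format, OF this g]
  obtain g where g: "g \<in> comod_hom A C M M" "\<forall>x\<in>carrier M. ?g x = W +>\<^bsub>M\<^esub> g x"
    by (elim bexE)
  have "f x = b (g x)" if "x \<in> carrier M" for x
    using coset_iff[OF s(1)[OF that] endo.endo_closed[OF g(1) that]] bspec[OF g(2) that] s(2)[OF that] by simp
  then show ?thesis using g(1) by auto
qed

text \<open>On W the map f is injective, and its inverse f(W) -> W \<subseteq> M is colinear;
  self-injectivity extends it from the subcomodule f(W) to M.\<close>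

lemma retraction:
  assumes inj: "self_injective A C M" and f: "f \<in> comod_hom A C M M" and W: "op.stable W"
    and ker: "\<And>w. w \<in> W \<Longrightarrow> f w = \<zero>\<^bsub>M\<^esub> \<Longrightarrow> w = \<zero>\<^bsub>M\<^esub>"
  shows "\<exists>k\<in>comod_hom A C M M. \<forall>w\<in>W. k (f w) = w"
proof -
  note Wc = op.stable_carrier[OF W] and fr = colinear_right_hom[OF f]
  have injf: "inj_on f W"
  proof (rule inj_onI)
    fix x y assume xy: "x \<in> W" "y \<in> W" "f x = f y"
    then have "f (x \<ominus>\<^bsub>M\<^esub> y) = \<zero>\<^bsub>M\<^esub>"
      using Wc endo.endo_minus[OF f] op.minus_self endo.endo_closed[OF f] by simp
    then have "x \<ominus>\<^bsub>M\<^esub> y = \<zero>\<^bsub>M\<^esub>" by (rule ker[OF op.stable_minus[OF W xy(1,2)]])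
    then show "x = y" using op.minus_eq_zeroD Wc xy by simp
  qed
  obtain K where K: "is_subcomodule A C K M" "carrier K = f ` W"
    using subcomodule_if_stable[OF endo.stable_image[OF f W]] by auto
  interpret K: comodule A C K using K(1) by (simp add: is_subcomodule_def)
  have i: "(\<lambda>x. x) \<in> right_hom A K M" using K(1) by (simp add: is_subcomodule_def comod_hom_def)
  have tK: "tensor_pair A K C" by (intro tensor_pair.intro K.M.right_module_axioms C.L.left_module_axioms)
  let ?g = "inv_into W f"
  have g: "?g (f w) = w" if "w \<in> W" for w using injf that by simp
  have "?g \<in> comod_hom A C K M"
  proof (rule comod_hom_iff[OF lfr tK T.tp, THEN iffD2], goal_cases)
    \<comment> \<open>Cases 1 and 2, closed at the end, place the coactions of K and M in the tensor
      products; this case is the slicewise colinearity of the inverse.\<close>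
    case 3
    show ?case
    proof (intro conjI ballI right_homI)
      show "?g x \<in> carrier M" if "x \<in> carrier K" for x using that K(2) g Wc by auto
      show "?g (x \<oplus>\<^bsub>K\<^esub> y) = ?g x \<oplus>\<^bsub>M\<^esub> ?g y" if xy: "x \<in> carrier K" "y \<in> carrier K" for x y
      proof -
        obtain u v where uv: "u \<in> W" "v \<in> W" "x = f u" "y = f v" using xy K(2) by auto
        have "x \<oplus>\<^bsub>K\<^esub> y = x \<oplus>\<^bsub>M\<^esub> y" by (rule right_hom_add[OF i xy])
        also have "\<dots> = f (u \<oplus>\<^bsub>M\<^esub> v)" using uv Wc by (simp add: right_hom_add[OF fr])
        finally show ?thesis using g op.stable_add[OF W uv(1,2)] uv by simp
      qed
      show "?g (x \<triangleleft>\<^bsub>K\<^esub> a) = ?g x \<triangleleft>\<^bsub>M\<^esub> a" if xa: "x \<in> carrier K" "a \<in> carrier A" for x a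
      proof -
        obtain u where u: "u \<in> W" "x = f u" using xa(1) K(2) by auto
        have "x \<triangleleft>\<^bsub>K\<^esub> a = x \<triangleleft>\<^bsub>M\<^esub> a" by (rule right_hom_ract[OF i xa])
        also have "\<dots> = f (u \<triangleleft>\<^bsub>M\<^esub> a)" using u Wc xa(2) by (simp add: right_hom_ract[OF fr])
        finally show ?thesis using g stable_ract[OF W u(1) xa(2)] u by simp
      qed
      show "?g (tensor_lift K (\<lambda>x c. x \<triangleleft>\<^bsub>K\<^esub> h c) (coact K x)) = T.slice h (coact M (?g x))"
        if h: "h \<in> functionals" and x: "x \<in> carrier K" for h x
      proof -
        obtain u where u: "u \<in> W" "x = f u" using x K(2) by auto
        have "act h x = f (act h u)" using u Wc by (simp add: colinear_act[OF f h])
        then have "?g (act h x) = act h (?g x)" using g stable_act[OF W h u(1)] u by simp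
        then show ?thesis by (simp add: slice_subcomodule(1)[OF K(1) h x] act_def)
      qed
    qed
  qed (use right_hom_closed[OF K.coact_hom] coact_closed in auto)
  then obtain k where "k \<in> comod_hom A C M M" "\<forall>x\<in>carrier K. k x = ?g x"
    using inj K(1) unfolding self_injective_def by metis
  then show ?thesis using K(2) g by auto
qed

section \<open>Full coprimeness and simplicity as a bimodule\<close>

lemma simple_bimodule_iff:
  "simple_bimodule (left_dual_ring A C) (comod_end_op A C M) (dual_end_bimodule M) \<longleftrightarrow>
    carrier M \<noteq> {\<zero>\<^bsub>M\<^esub>} \<and>
    (\<forall>N. op.stable N \<and> fully_invariant A C M N \<longrightarrow> N = {\<zero>\<^bsub>M\<^esub>} \<or> N = carrier M)"
proof -
  have sg: "subgroup N (add_monoid (dual_end_bimodule M)) \<longleftrightarrow> subgroup N (add_monoid M)" for N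
    by (simp add: dual_end_bimodule_def subgroup_def m_inv_def)
  have smult: "f \<odot>\<^bsub>dual_end_bimodule M\<^esub> x = act f x" for f x
    by (simp add: dual_end_bimodule_def act_def)
  have l: "(\<forall>f\<in>carrier (left_dual_ring A C). \<forall>x\<in>N. f \<odot>\<^bsub>dual_end_bimodule M\<^esub> x \<in> N) \<longleftrightarrow>
      (\<forall>\<omega>\<in>act ` functionals. \<forall>x\<in>N. \<omega> x \<in> N)" if N: "N \<subseteq> carrier M" for N
  proof
    assume L: "\<forall>f\<in>carrier (left_dual_ring A C). \<forall>x\<in>N. f \<odot>\<^bsub>dual_end_bimodule M\<^esub> x \<in> N"
    have "act f x \<in> N" if f: "f \<in> functionals" and x: "x \<in> N" for f x
    proof -
      have "restrict f (carrier C) \<in> carrier (left_dual_ring A C)"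
        using act_restrict(1)[OF f] by (simp add: left_dual_ring_def)
      with L x have "act (restrict f (carrier C)) x \<in> N" unfolding smult by blast
      then show ?thesis using act_restrict(2)[OF f] x N by auto
    qed
    then show "\<forall>\<omega>\<in>act ` functionals. \<forall>x\<in>N. \<omega> x \<in> N" by auto
  next
    assume "\<forall>\<omega>\<in>act ` functionals. \<forall>x\<in>N. \<omega> x \<in> N"
    then show "\<forall>f\<in>carrier (left_dual_ring A C). \<forall>x\<in>N. f \<odot>\<^bsub>dual_end_bimodule M\<^esub> x \<in> N"
      by (auto simp: left_dual_ring_def smult)
  qed
  have left: "left_submodule (left_dual_ring A C) (dual_end_bimodule M) N \<longleftrightarrow> op.stable N" for N
    unfolding left_submodule_def op.stable_def sg
    using l subgroup.subset[of N "add_monoid M"] by auto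
  have right: "right_submodule (comod_end_op A C M) (dual_end_bimodule M) N \<longleftrightarrow> fully_invariant A C M N"
    if N: "op.stable N" for N
  proof -
    have "(\<forall>x\<in>N. \<forall>f\<in>carrier (comod_end_op A C M). x \<triangleleft>\<^bsub>dual_end_bimodule M\<^esub> f \<in> N) \<longleftrightarrow> fully_invariant A C M N"
    proof
      assume L: "\<forall>x\<in>N. \<forall>f\<in>carrier (comod_end_op A C M). x \<triangleleft>\<^bsub>dual_end_bimodule M\<^esub> f \<in> N"
      have "f x \<in> N" if f: "f \<in> comod_hom A C M M" and x: "x \<in> N" for f x
      proof -
        have "restrict f (carrier M) \<in> carrier (comod_end_op A C M)"
          using colinear_restrict[OF f] by (simp add: comod_end_op_def)
        with L x have "x \<triangleleft>\<^bsub>dual_end_bimodule M\<^esub> restrict f (carrier M) \<in> N" by blast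
        then have "restrict f (carrier M) x \<in> N" by (simp add: dual_end_bimodule_def split del: if_split)
        then show ?thesis by (simp add: op.stable_carrier[OF N x])
      qed
      then show "fully_invariant A C M N" by (auto simp: fully_invariant_def)
    next
      assume "fully_invariant A C M N"
      then show "\<forall>x\<in>N. \<forall>f\<in>carrier (comod_end_op A C M). x \<triangleleft>\<^bsub>dual_end_bimodule M\<^esub> f \<in> N"
        by (auto simp: fully_invariant_def comod_end_op_def dual_end_bimodule_def)
    qed
    then show ?thesis using N unfolding right_submodule_def sg op.stable_def by simp
  qed
  have sel: "carrier (dual_end_bimodule M) = carrier M" "\<zero>\<^bsub>dual_end_bimodule M\<^esub> = \<zero>\<^bsub>M\<^esub>"
    by (simp_all add: dual_end_bimodule_def)
  show ?thesis unfolding simple_bimodule_def sel left using right by auto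
qed

lemma fully_inv_iff: "endo.fully_inv N \<longleftrightarrow> fully_invariant A C M N"
  by (auto simp: endo.fully_inv_def fully_invariant_def)

lemma colon_subcomodule_iff:
  assumes X: "op.stable X" and Y: "op.stable Y"
  shows "carrier M = colon_subcomodule A C M X Y \<longleftrightarrow>
    (\<forall>f\<in>endo.annihilator X. \<forall>x\<in>carrier M. f x \<in> Y)"
proof -
  \<comment> \<open>The zero endomorphism shows that the intersection defining the colon is not over
    an empty family, whose value would be the whole type.\<close>
  have z: "(\<lambda>x. x \<ominus>\<^bsub>M\<^esub> x) \<in> comod_hom A C M M" by (rule endo.endo_diff[OF endo.endo_id endo.endo_id])
  have ann: "f ` X = {\<zero>\<^bsub>M\<^esub>} \<longleftrightarrow> (\<forall>x\<in>X. f x = \<zero>\<^bsub>M\<^esub>)" for f :: "'m \<Rightarrow> 'm"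
    using op.stable_zero[OF X] by auto
  have "(\<lambda>x. x \<ominus>\<^bsub>M\<^esub> x) \<in> endo.annihilator X"
    using z op.minus_self op.stable_carrier[OF X] by (simp add: endo.annihilator_def)
  then show ?thesis
    unfolding colon_subcomodule_def ann by (auto simp: endo.annihilator_def)
qed

lemma coprime_operator_group:
  assumes "self_injective A C M" "self_cogenerator A C M" and cop: "fully_coprime A C M"
  shows "coprime_operator_group M (act ` functionals) (comod_hom A C M M)"
proof
  fix X Y assume X: "op.stable X" "endo.fully_inv X" and Y: "op.stable Y" "endo.fully_inv Y"
    and XY: "\<And>f x. f \<in> endo.annihilator X \<Longrightarrow> x \<in> carrier M \<Longrightarrow> f x \<in> Y"
  have "carrier M = colon_subcomodule A C M X Y"
    using XY by (simp add: colon_subcomodule_iff[OF X(1) Y(1)])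
  then show "X = carrier M \<or> Y = carrier M"
    using cop X Y by (simp add: fully_coprime_def subcomodules_eq fully_inv_iff)
qed (rule separating_endomorphism[OF assms(2)] retraction[OF assms(1)]; assumption)+

lemma fully_coprime_if_simple:
  assumes ne: "carrier M \<noteq> {\<zero>\<^bsub>M\<^esub>}"
    and simple: "\<And>N. op.stable N \<Longrightarrow> fully_invariant A C M N \<Longrightarrow> N = {\<zero>\<^bsub>M\<^esub>} \<or> N = carrier M"
  shows "fully_coprime A C M"
  unfolding fully_coprime_def
proof (intro conjI ballI impI ne, rule ccontr)
  fix X Y assume "X \<in> subcomodules A C M" "Y \<in> subcomodules A C M"
    and XY: "fully_invariant A C M X \<and> fully_invariant A C M Y \<and> carrier M = colon_subcomodule A C M X Y"
    and no: "\<not> (X = carrier M \<or> Y = carrier M)"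
  then have s: "op.stable X" "op.stable Y" by (simp_all add: subcomodules_eq)
  then have 0: "X = {\<zero>\<^bsub>M\<^esub>}" "Y = {\<zero>\<^bsub>M\<^esub>}" using simple XY no by auto
  \<comment> \<open>The identity kills X = 0, so M = (X : Y) forces M \<subseteq> Y = 0.\<close>
  have "(\<lambda>x. x) \<in> endo.annihilator X" using endo.endo_id by (simp add: endo.annihilator_def 0)
  then have "x \<in> Y" if "x \<in> carrier M" for x
    using colon_subcomodule_iff[OF s] XY that by auto
  then show False using ne 0 by auto
qed

lemma rank_if_finite_length:
  assumes "finite_length A C M"
  shows "\<exists>(\<l> :: 'm set \<Rightarrow> nat) n.
    (\<forall>X Y. op.stable X \<and> op.stable Y \<and> X \<subset> Y \<longrightarrow> \<l> X < \<l> Y) \<and> (\<forall>X. \<l> X \<le> n)"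
proof -
  obtain n and K :: "nat \<Rightarrow> 'm set" where K: "K 0 = {\<zero>\<^bsub>M\<^esub>}" "K n = carrier M" "\<forall>i\<le>n. op.stable (K i)"
    "\<forall>i<n. K i \<subset> K (Suc i) \<and> \<not> (\<exists>X. op.stable X \<and> K i \<subset> X \<and> X \<subset> K (Suc i))"
    using assms unfolding finite_length_def subcomodules_eq by auto
  have "op.covered (K i) (K (Suc i))" if "i < n" for i
    unfolding op.covered_def using K(3,4) that by (auto simp: psubset_eq)
  from op.rank_if_composition_series[OF K(1,2) this] show ?thesis by auto
qed

lemma simple_if_fully_coprime:
  assumes inj: "self_injective A C M" and cog: "self_cogenerator A C M" and cop: "fully_coprime A C M"
    and fin: "finite_length A C M \<or> (right_artinian A \<and> fin_gen_right_module A M)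
      \<or> (artinian_comodule A C M \<and> self_projective A C M)"
    and N: "op.stable N" "fully_invariant A C M N"
  shows "N = {\<zero>\<^bsub>M\<^esub>} \<or> N = carrier M"
proof (intro disjCI)
  assume "N \<noteq> carrier M"
  interpret E: coprime_operator_group M "act ` functionals" "comod_hom A C M M"
    by (rule coprime_operator_group[OF inj cog cop])
  have inv: "endo.fully_inv N" using N(2) by (simp add: fully_inv_iff)
  have bounded: "N = carrier M"
    if "\<exists>(\<l> :: 'm set \<Rightarrow> nat) n. (\<forall>X Y. op.stable X \<and> op.stable Y \<and> X \<subset> Y \<longrightarrow> \<l> X < \<l> Y) \<and> (\<forall>X. \<l> X \<le> n)"
      "N \<noteq> {\<zero>\<^bsub>M\<^esub>}"
  proof -
    from that(1) obtain \<l> :: "'m set \<Rightarrow> nat" and n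
      where l: "\<forall>X Y. op.stable X \<and> op.stable Y \<and> X \<subset> Y \<longrightarrow> \<l> X < \<l> Y" "\<forall>X. \<l> X \<le> n"
      by (elim exE conjE)
    show ?thesis by (rule E.simple_if_bounded[where \<l> = \<l> and n = n, OF _ _ N(1) inv that(2)]) (use l in auto)
  qed
  show "N = {\<zero>\<^bsub>M\<^esub>}"
  proof (rule ccontr)
    assume ne: "N \<noteq> {\<zero>\<^bsub>M\<^esub>}"
    from fin have "N = carrier M"
    proof (elim disjE conjE)
      assume "finite_length A C M"
      then show ?thesis by (rule bounded[OF rank_if_finite_length ne])
    next
      assume "right_artinian A" "fin_gen_right_module A M"
      from rank_if_fin_gen_right_artinian[OF M.right_module_axioms this]
      obtain \<l> :: "'m set \<Rightarrow> nat" and n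
        where "\<forall>X Y. right_submodule A M X \<and> right_submodule A M Y \<and> X \<subset> Y \<longrightarrow> \<l> X < \<l> Y" "\<forall>X. \<l> X \<le> n"
        by auto
      \<comment> \<open>Stable subgroups are right A-submodules, so a bounded strictly monotone rank
        on the latter restricts to them.\<close>
      then show ?thesis
        by (intro bounded[OF _ ne] exI[of _ \<l>] exI[of _ n]) (simp add: stable_right_submodule)
    next
      assume art: "artinian_comodule A C M" and proj: "self_projective A C M"
      have "minimum_condition {X. op.stable X}"
        by (rule minimum_condition_if_dcc) (use art in \<open>simp add: artinian_comodule_def subcomodules_eq\<close>)
      then show ?thesis
        by (rule E.simple_if_projective[OF _ factorization[OF proj] N(1) inv ne])
    qed
    then show False using \<open>N \<noteq> carrier M\<close> by simp
  qed
qed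

end

theorem proposition4p16:
  fixes R :: "('r, 'x) ring_scheme"
    and A :: "('r, 'a, 'y) module_scheme"
    and C :: "('a, 'c) coring"
    and M :: "('l, 'a, 'm, 'c) comodule"
  assumes "cring R" and "\<one>\<^bsub>R\<^esub> \<noteq> \<zero>\<^bsub>R\<^esub>"
    and "unital_algebra R A"
    and "coring A C" and "carrier C \<noteq> {\<zero>\<^bsub>C\<^esub>}" and "locally_projective A C"
    and "comodule A C M" and "carrier M \<noteq> {\<zero>\<^bsub>M\<^esub>}"
    and "self_injective A C M" and "self_cogenerator A C M"
    and "finite_length A C M
      \<or> (right_artinian A \<and> fin_gen_right_module A M)
      \<or> (artinian_comodule A C M \<and> self_projective A C M)"
  shows "fully_coprime A C M
    \<longleftrightarrow> simple_bimodule (left_dual_ring A C) (comod_end_op A C M) (dual_end_bimodule M)"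
proof -
  interpret locally_projective_comodule A C M
    by (intro locally_projective_comodule.intro locally_projective_comodule_axioms.intro assms)
  show ?thesis
    unfolding simple_bimodule_iff
    using fully_coprime_if_simple simple_if_fully_coprime[OF assms(9,10) _ assms(11)] assms(8) by auto
qed

end
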